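(* The discriminant $\Delta_4$ of the binary quartic form $$P=ax^4+bx^3y+cx^2y^2+dxy^3+ey^4$$ is given by $$\begin{aligned}\Delta_4=\;& b^2c^2d^2-4ac^3d^2-4b^3d^3+18abcd^3-27a^2d^4-4b^2c^3e+16ac^4e+18b^3cde\\ &-80abc^2de-6ab^2d^2e+144a^2cd^2e-27b^4e^2+144ab^2ce^2-128a^2c^2e^2-192a^2bde^2+256a^3e^3.\end{aligned}$$ Moreover, the singular locus of the 3-fold $\mathcal{D}_4:\Delta_4=0$ in $\mathbb{P}^4$ (with coordinates $a,b,c,d,e$) has dimension $2$, and the Hilbert polynomial of the Milnor algebra $M(f)$ of $f=\Delta_4$ is $$P(M(f))(k)=8k^2-21k+26.$$ The multiplicity of every point on $\mathcal{D}_4$ is $\leq 3$.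
   Context: The discriminant $\Delta_n\in\mathbb{C}[a_0,\dots,a_n]$ of the general binary form $a_0x^n+a_1x^{n-1}y+\dots+a_ny^n$ is the usual one: if $a_0\ne0$ and $\alpha_1,\dots,\alpha_n$ are the roots of the form in the variable $x$ after setting $y=1$, then $\Delta_n=a_0^{2n-2}\prod_{i<j}(\alpha_i-\alpha_j)^2$. For a homogeneous polynomial $f$ in $S=\mathbb{C}[a,b,c,d,e]$, the Milnor algebra is $M(f)=S/J_f$ with $J_f$ the ideal generated by all first partial derivatives of $f$, and $P(M(f))$ is its Hilbert polynomial: $P(M(f))(k)=\dim_{\mathbb{C}}M(f)_k$ for all large $k$. *)

theory Defs
  imports
    "HOL-Analysis.Finite_Cartesian_Product"
    "HOL-Library.Poly_Mapping"
    "HOL-Library.Numeral_Type"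
    "HOL-Computational_Algebra.Polynomial"
    "HOL-Algebra.QuotRing"
    "HOL-Algebra.Embedded_Algebras"
begin

section \<open>Complex polynomials in finitely many variables\<close>

text \<open>
  The variables are indexed by a finite type, so that the whole type \<open>'v mpol\<close> is the
  polynomial ring. Exponent vectors and coefficient families are finitely supported functions,
  and the ring operations are those of the library (convolution product).
\<close>

type_synonym 'v mpol = "('v \<Rightarrow>\<^sub>0 nat) \<Rightarrow>\<^sub>0 complex"

definition mvar :: "'v \<Rightarrow> 'v mpol" where
  "mvar i = Poly_Mapping.single (Poly_Mapping.single i 1) 1"

definition mconst :: "complex \<Rightarrow> 'v mpol" where
  "mconst c = Poly_Mapping.single 0 c"

definition mon_deg :: "('v::finite \<Rightarrow>\<^sub>0 nat) \<Rightarrow> nat" where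
  "mon_deg m = (\<Sum>i\<in>UNIV. Poly_Mapping.lookup m i)"

definition homog_part :: "nat \<Rightarrow> 'v::finite mpol set" where
  "homog_part k = {p. \<forall>m\<in>Poly_Mapping.keys p. mon_deg m = k}"

definition mpol_eval :: "complex ^ 'v::finite \<Rightarrow> 'v mpol \<Rightarrow> complex" where
  "mpol_eval x p = (\<Sum>m\<in>Poly_Mapping.keys p.
     Poly_Mapping.lookup p m * (\<Prod>i\<in>UNIV. (x $ i) ^ Poly_Mapping.lookup m i))"

definition mpol_subst :: "('v::finite \<Rightarrow> 'v mpol) \<Rightarrow> 'v mpol \<Rightarrow> 'v mpol" where
  "mpol_subst g p = (\<Sum>m\<in>Poly_Mapping.keys p.
     mconst (Poly_Mapping.lookup p m) * (\<Prod>i\<in>UNIV. g i ^ Poly_Mapping.lookup m i))"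

text \<open>If \<open>i\<close> does not occur in \<open>m\<close>, the truncated exponent is harmless: the coefficient is 0.\<close>

definition mpol_pderiv :: "'v \<Rightarrow> 'v mpol \<Rightarrow> 'v mpol" where
  "mpol_pderiv i p = (\<Sum>m\<in>Poly_Mapping.keys p.
     Poly_Mapping.single (m - Poly_Mapping.single i 1)
       (of_nat (Poly_Mapping.lookup m i) * Poly_Mapping.lookup p m))"

section \<open>Discriminant of the general binary form\<close>

text \<open>
  The general binary form of degree \<open>n\<close> has \<open>n + 1\<close> coefficients, so the index type \<open>'v\<close> has
  \<open>n + 1\<close> elements. For a numeral type such as \<^typ>\<open>5\<close>, \<^term>\<open>of_nat\<close> maps \<open>0, \<dots>, n\<close>
  bijectively onto it.
\<close>

definition binary_form ::
    "complex ^ 'v::{finite,comm_ring_1} \<Rightarrow> complex \<Rightarrow> complex \<Rightarrow> complex" where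
  "binary_form a x y = (let n = CARD('v) - 1 in
     \<Sum>i\<le>n. a $ of_nat i * x ^ (n - i) * y ^ i)"

definition is_discriminant :: "'v::{finite,comm_ring_1} mpol \<Rightarrow> bool" where
  "is_discriminant D \<longleftrightarrow> (let n = CARD('v) - 1 in
     \<forall>(a :: complex ^ 'v::{finite,comm_ring_1}) (\<alpha> :: nat \<Rightarrow> complex).
       a $ 0 \<noteq> 0 \<longrightarrow>
       (\<forall>x. binary_form a x 1 = a $ 0 * (\<Prod>i<n. x - \<alpha> i)) \<longrightarrow>
       mpol_eval a D = (a $ 0) ^ (2 * n - 2) * (\<Prod>j<n. \<Prod>i<j. (\<alpha> i - \<alpha> j)\<^sup>2))"

definition discriminant :: "'v::{finite,comm_ring_1} mpol" where
  "discriminant = (THE D. is_discriminant D)"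

abbreviation disc4 :: "5 mpol" where
  "disc4 \<equiv> discriminant"

lemma binary_form_quartic:
  fixes v :: "complex ^ 5"
  shows "binary_form v x y =
    v $ 0 * x ^ 4 + v $ 1 * x ^ 3 * y + v $ 2 * x ^ 2 * y ^ 2 + v $ 3 * x * y ^ 3 + v $ 4 * y ^ 4"
  by (simp add: binary_form_def numeral_eq_Suc)

section \<open>Milnor algebra and Hilbert polynomial\<close>

definition mpol_ring :: "'v mpol ring" where
  "mpol_ring = \<lparr>carrier = UNIV, mult = (*), one = 1, zero = 0, add = (+)\<rparr>"

definition jacobian_ideal :: "'v mpol \<Rightarrow> 'v mpol set" where
  "jacobian_ideal f = genideal mpol_ring (range (\<lambda>i. mpol_pderiv i f))"

definition milnor_algebra :: "'v mpol \<Rightarrow> 'v mpol set ring" where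
  "milnor_algebra f = mpol_ring Quot jacobian_ideal f"

definition milnor_class :: "'v mpol \<Rightarrow> 'v mpol \<Rightarrow> 'v mpol set" where
  "milnor_class f p = a_r_coset mpol_ring (jacobian_ideal f) p"

text \<open>
  \<open>milnor_dim f k d\<close>: the degree \<open>k\<close> part of the Milnor algebra has dimension \<open>d\<close> over the
  copy of the complex numbers formed by the classes of the constants.
\<close>

definition milnor_dim :: "'v::finite mpol \<Rightarrow> nat \<Rightarrow> nat \<Rightarrow> bool" where
  "milnor_dim f k d \<longleftrightarrow>
     ring.dimension (milnor_algebra f) d
       (milnor_class f ` range mconst) (milnor_class f ` homog_part k)"

definition milnor_hilbert_poly :: "'v::finite mpol \<Rightarrow> rat poly \<Rightarrow> bool" where
  "milnor_hilbert_poly f P \<longleftrightarrow>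
     (\<forall>\<^sub>F k in sequentially. \<exists>d. milnor_dim f k d \<and> of_nat d = poly P (of_nat k))"

section \<open>Projective space with its Zariski topology\<close>

text \<open>A point is the set of all its homogeneous coordinate vectors.\<close>

definition proj_space :: "(complex ^ 'v::finite) set set" where
  "proj_space = (UNIV - {0}) // {(x, y). x \<noteq> 0 \<and> (\<exists>c. c \<noteq> 0 \<and> y = c *s x)}"

definition proj_zeros :: "'v::finite mpol set \<Rightarrow> (complex ^ 'v) set set" where
  "proj_zeros F = {p \<in> proj_space. \<forall>x\<in>p. \<forall>f\<in>F. mpol_eval x f = 0}"

definition zariski_closed :: "(complex ^ 'v::finite) set set \<Rightarrow> bool" where
  "zariski_closed Z \<longleftrightarrow> (\<exists>F. F \<subseteq> (\<Union>k. homog_part k) \<and> Z = proj_zeros F)"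

definition zariski_irreducible :: "(complex ^ 'v::finite) set set \<Rightarrow> bool" where
  "zariski_irreducible Z \<longleftrightarrow> Z \<noteq> {} \<and>
     (\<forall>A B. zariski_closed A \<longrightarrow> zariski_closed B \<longrightarrow> Z \<subseteq> A \<union> B \<longrightarrow> Z \<subseteq> A \<or> Z \<subseteq> B)"

definition irreducible_chain ::
    "(complex ^ 'v::finite) set set \<Rightarrow> nat \<Rightarrow> (nat \<Rightarrow> (complex ^ 'v) set set) \<Rightarrow> bool" where
  "irreducible_chain X n Z \<longleftrightarrow>
     (\<forall>i\<le>n. zariski_closed (Z i) \<and> zariski_irreducible (Z i) \<and> Z i \<subseteq> X) \<and>
     (\<forall>i<n. Z i \<subset> Z (Suc i))"

text \<open>
  Krull dimension of a Zariski closed set \<open>X\<close>, as a topological space: because \<open>X\<close> is closed,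
  its irreducible closed subsets are those of projective space contained in it.
\<close>

definition zariski_dim :: "(complex ^ 'v::finite) set set \<Rightarrow> nat \<Rightarrow> bool" where
  "zariski_dim X d \<longleftrightarrow> zariski_closed X \<and>
     (\<exists>Z. irreducible_chain X d Z) \<and> (\<forall>n Z. irreducible_chain X n Z \<longrightarrow> n \<le> d)"

section \<open>Hypersurfaces\<close>

definition hypersurface :: "'v::finite mpol \<Rightarrow> (complex ^ 'v) set set" where
  "hypersurface f = proj_zeros {f}"

definition singular_locus :: "'v::finite mpol \<Rightarrow> (complex ^ 'v) set set" where
  "singular_locus f =
     {p \<in> hypersurface f. \<forall>x\<in>p. \<forall>i. mpol_eval x (mpol_pderiv i f) = 0}"

text \<open>
  The multiplicity at a point \<open>[x]\<close> with \<open>x $ i \<noteq> 0\<close> is the order at the origin of the local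
  equation: dehomogenize in the affine chart where coordinate \<open>i\<close> is 1, then translate the point
  to the origin. It depends neither on the representative \<open>x\<close> nor on the chart \<open>i\<close>.
\<close>

definition local_equation :: "'v::finite mpol \<Rightarrow> complex ^ 'v \<Rightarrow> 'v \<Rightarrow> 'v mpol" where
  "local_equation f x i =
     mpol_subst (\<lambda>j. if j = i then 1 else mvar j + mconst (x $ j / x $ i)) f"

definition order_at_origin :: "'v::finite mpol \<Rightarrow> nat" where
  "order_at_origin g = (LEAST k. \<exists>m\<in>Poly_Mapping.keys g. mon_deg m = k)"

definition point_multiplicity :: "'v::finite mpol \<Rightarrow> complex ^ 'v \<Rightarrow> 'v \<Rightarrow> nat" where
  "point_multiplicity f x i = order_at_origin (local_equation f x i)"

end

theory Submission
  imports
    Defs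
    "HOL-Analysis.Cartesian_Space"
    "HOL-Library.Product_Lexorder"
    "HOL-Computational_Algebra.Fundamental_Theorem_Algebra"
begin



text \<open>
  Everything rests on the two invariants \<open>I\<close> and \<open>J\<close> of the binary quartic, of degree 2 and 3, and
  on the relation \<open>27 \<Delta> = 4 I\<^sup>3 - J\<^sup>2\<close> (\<open>quartic_disc_invariants\<close>).

  \<^bold>\<open>The formula.\<close> The quartic and its resolvent cubic have the same discriminant, because the
  differences of the roots of the resolvent are products of two differences of roots of the quartic.
  This reduces the formula to the cubic (\<open>quartic_disc_roots\<close>). The discriminant is unique because a
  polynomial is determined by its values where the leading coefficient is nonzero.

  \<^bold>\<open>Dimensions.\<close> The discriminant vanishes exactly on the forms \<open>l\<^sup>2 q\<close>, and \<open>I\<close> and \<open>J\<close> vanish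
  together exactly on the forms \<open>l\<^sup>3 m\<close>. Two forms of the same kind are joined by a polynomial curve of
  such forms: move the factors along straight lines. Both loci are therefore irreducible
  (\<open>irreducible_by_curves\<close>). The gradient of \<open>\<Delta>\<close> is a combination of \<open>I\<^sup>2\<close> and \<open>J\<close>, so the second
  locus consists of singular points, and chains of linear subspaces inside the two loci give the lower
  bounds 3 and 2. For the upper bounds it suffices that a chain of irreducible closed sets in
  projective space has length at most the dimension of the space (\<open>irreducible_chain_length\<close>): one can
  extend a chain in the singular locus by the irreducible hypersurface and by the whole space. The
  length is bounded by counting forms of degree \<open>k\<close> that are independent modulo the forms
  vanishing on the members of the chain; each step of the chain raises the growth in \<open>k\<close> by one power.

  \<^bold>\<open>Hilbert polynomial.\<close> The discriminant is a free divisor. The polynomial vector fields \<open>v\<close> with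
  \<open>v(\<Delta>) = 0\<close> form a free module (\<open>annihilating_fields_generated\<close>,
  \<open>logarithmic_fields_independent\<close>), generated by the three linear fields of the action of \<open>sl\<^sub>2\<close> and by
  one quadratic field, the Hessian covariant. The Hessian changes \<open>I\<close> by \<open>4 J\<close> and \<open>J\<close> by
  \<open>24 I\<^sup>2\<close>. If \<open>v(\<Delta>) = 0\<close> then \<open>6 I\<^sup>2 v(I) = J v(J)\<close>; since \<open>I\<^sup>2\<close> and \<open>J\<close> are coprime, a
  multiple of the Hessian can be subtracted from \<open>v\<close> so that the difference annihilates \<open>I\<close> and \<open>J\<close>,
  and Cramer's rule with two coprime minors expresses it through the linear fields.
  The Milnor algebra \<open>M\<close> thus has the resolution
  \<open>0 \<longrightarrow> S(-6)\<^sup>3 \<oplus> S(-7) \<longrightarrow> S(-5)\<^sup>5 \<longrightarrow> S \<longrightarrow> M \<longrightarrow> 0\<close>,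
  and with \<open>s(k) = (k + 4 choose 4)\<close> its Hilbert function is
  \<open>s(k) - 5 s(k - 5) + 3 s(k - 6) + s(k - 7) = 8 k\<^sup>2 - 21 k + 26\<close> for \<open>k \<ge> 7\<close>.

  \<^bold>\<open>Multiplicities.\<close> Restrict the local equation to a line through the point, parallel to the
  \<open>a\<close>-axis or to the \<open>e\<close>-axis, or to the diagonal of the two. The monomials \<open>256 a\<^sup>3 e\<^sup>3\<close>,
  \<open>- 27 b\<^sup>4 e\<^sup>2\<close>, \<open>- 27 a\<^sup>2 d\<^sup>4\<close> and \<open>16 a c\<^sup>4 e\<close> show that some such restriction has order at most 3.
\<close>

section \<open>Polynomials in finitely many variables\<close>

lemma mpol_sum_of_terms:
  "p = (\<Sum>m\<in>Poly_Mapping.keys p. Poly_Mapping.single m (Poly_Mapping.lookup p m))"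
proof (rule poly_mapping_eqI)
  fix k
  have "Poly_Mapping.lookup (\<Sum>m\<in>Poly_Mapping.keys p. Poly_Mapping.single m (Poly_Mapping.lookup p m)) k
     = (\<Sum>m\<in>Poly_Mapping.keys p. if m = k then Poly_Mapping.lookup p k else 0)"
    unfolding lookup_sum by (intro sum.cong) (auto simp: lookup_single)
  also have "\<dots> = Poly_Mapping.lookup p k"
    by (simp add: in_keys_iff)
  finally show "Poly_Mapping.lookup p k =
    Poly_Mapping.lookup (\<Sum>m\<in>Poly_Mapping.keys p. Poly_Mapping.single m (Poly_Mapping.lookup p m)) k"
    by simp
qed

text \<open>
  Identities that are additive in a polynomial need to be checked only on terms \<open>c x\<^sup>m\<close>; the product
  rules below are proved in this way in each factor.
\<close>

lemma mpol_induct [case_names monomial add]: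
  fixes p :: "'v mpol"
  assumes "\<And>m c. P (Poly_Mapping.single m c)" and "\<And>p q. P p \<Longrightarrow> P q \<Longrightarrow> P (p + q)"
  shows "P p"
proof -
  have "P (\<Sum>m\<in>M. Poly_Mapping.single m (Poly_Mapping.lookup p m))" if "finite M" for M
    using that
  proof induction
    case empty
    show ?case using assms(1)[of 0 0] by simp
  qed (simp add: assms)
  then show ?thesis by (subst mpol_sum_of_terms) simp
qed

lemma mconst_add: "mconst (c + d) = mconst c + mconst d"
  and mconst_mult: "mconst (c * d) = mconst c * mconst d"
  and mconst_0 [simp]: "mconst 0 = 0"
  and mconst_1 [simp]: "mconst 1 = 1"
  and mconst_uminus: "mconst (- c) = - mconst c"
  and mconst_numeral [simp]: "mconst (numeral n) = numeral n"
  by (simp_all add: mconst_def single_add mult_single single_uminus)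

lemma lookup_mconst_mult: "Poly_Mapping.lookup (mconst c * p) m = c * Poly_Mapping.lookup p m"
proof (induction p rule: mpol_induct)
  case (monomial n d)
  show ?case by (simp add: mconst_def mult_single lookup_single when_def)
next
  case (add p q)
  then show ?case by (simp add: distrib_left lookup_add)
qed

subsection \<open>Evaluation\<close>

lemma mpol_eval_single:
  "mpol_eval x (Poly_Mapping.single m c) = c * (\<Prod>i\<in>UNIV. (x $ i) ^ Poly_Mapping.lookup m i)"
  by (simp add: mpol_eval_def)

lemma mpol_eval_add: "mpol_eval x (p + q) = mpol_eval x p + mpol_eval x q"
  unfolding mpol_eval_def by (rule setsum_keys_plus_distrib) (simp_all add: distrib_right)

lemma mpol_eval_mult: "mpol_eval x (p * q) = mpol_eval x p * mpol_eval x q"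
proof (induction p rule: mpol_induct)
  case (monomial m c)
  show ?case
  proof (induction q rule: mpol_induct)
    case (monomial n d)
    show ?case
      by (simp add: mult_single mpol_eval_single lookup_add power_add prod.distrib)
  qed (simp add: mpol_eval_add distrib_left)
qed (simp add: mpol_eval_add distrib_right)

lemma mpol_eval_mconst [simp]: "mpol_eval x (mconst c) = c"
  by (simp add: mconst_def mpol_eval_single)

lemma mpol_eval_0 [simp]: "mpol_eval x 0 = 0"
  by (simp add: mpol_eval_def)

lemma mpol_eval_1 [simp]: "mpol_eval x 1 = 1"
  using mpol_eval_mconst[of x 1] by simp

lemma mpol_eval_numeral [simp]: "mpol_eval x (numeral n) = numeral n"
  using mpol_eval_mconst[of x "numeral n"] by simp

lemma mpol_eval_mvar [simp]: "mpol_eval x (mvar i) = x $ i"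
proof -
  have "(\<Prod>j\<in>UNIV. (x $ j) ^ Poly_Mapping.lookup (Poly_Mapping.single i 1) j) =
    (\<Prod>j\<in>UNIV. if j = i then x $ i else 1)"
    by (intro prod.cong) (auto simp: lookup_single)
  then show ?thesis by (simp add: mvar_def mpol_eval_single)
qed

lemma mpol_eval_uminus: "mpol_eval x (- p) = - mpol_eval x p"
  using mpol_eval_mult[of x "mconst (- 1)" p] mpol_eval_mconst[of x "- 1"]
  by (simp add: mconst_uminus)

lemma mpol_eval_diff: "mpol_eval x (p - q) = mpol_eval x p - mpol_eval x q"
  using mpol_eval_add[of x p "- q"] by (simp add: mpol_eval_uminus)

lemma mpol_eval_power: "mpol_eval x (p ^ n) = mpol_eval x p ^ n"
  by (induction n) (simp_all add: mpol_eval_mult)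

lemma mpol_eval_sum: "mpol_eval x (sum f A) = (\<Sum>i\<in>A. mpol_eval x (f i))"
  by (induction A rule: infinite_finite_induct) (simp_all add: mpol_eval_add)

lemma mpol_eval_prod: "mpol_eval x (prod f A) = (\<Prod>i\<in>A. mpol_eval x (f i))"
  by (induction A rule: infinite_finite_induct) (simp_all add: mpol_eval_mult)

lemmas mpol_eval_simps = mpol_eval_add mpol_eval_mult mpol_eval_diff mpol_eval_uminus
  mpol_eval_power mpol_eval_sum

lemma mpol_eval_subst: "mpol_eval x (mpol_subst g p) = mpol_eval (\<chi> j. mpol_eval x (g j)) p"
  unfolding mpol_subst_def
  by (simp add: mpol_eval_sum mpol_eval_mult mpol_eval_prod mpol_eval_power mpol_eval_def[of "\<chi> j. _ j"])

subsection \<open>Partial derivatives\<close>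

lemma mpol_pderiv_single:
  "mpol_pderiv i (Poly_Mapping.single m c) =
    Poly_Mapping.single (m - Poly_Mapping.single i 1) (of_nat (Poly_Mapping.lookup m i) * c)"
  by (simp add: mpol_pderiv_def)

lemma mpol_pderiv_add: "mpol_pderiv i (p + q) = mpol_pderiv i p + mpol_pderiv i q"
  unfolding mpol_pderiv_def
  by (rule setsum_keys_plus_distrib) (simp_all add: distrib_left flip: single_add)

lemma mpol_pderiv_mult: "mpol_pderiv i (p * q) = mpol_pderiv i p * q + p * mpol_pderiv i q"
proof (induction p rule: mpol_induct)
  case (monomial m c)
  show ?case
  proof (induction q rule: mpol_induct)
    case (monomial n d)
    have shift: "(k - Poly_Mapping.single i 1) + l = (k + l) - Poly_Mapping.single i 1"
      if "Poly_Mapping.lookup k i \<noteq> 0" for k l :: "'a \<Rightarrow>\<^sub>0 nat"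
      using that by (intro poly_mapping_eqI) (auto simp: lookup_add lookup_minus lookup_single when_def)
    have left: "mpol_pderiv i (Poly_Mapping.single m c) * Poly_Mapping.single n d =
      Poly_Mapping.single (m + n - Poly_Mapping.single i 1) (of_nat (Poly_Mapping.lookup m i) * (c * d))"
      using shift[of m n]
      by (cases "Poly_Mapping.lookup m i = 0") (simp_all add: mpol_pderiv_single mult_single mult.assoc)
    have right: "Poly_Mapping.single m c * mpol_pderiv i (Poly_Mapping.single n d) =
      Poly_Mapping.single (m + n - Poly_Mapping.single i 1) (of_nat (Poly_Mapping.lookup n i) * (c * d))"
      using shift[of n m]
      by (cases "Poly_Mapping.lookup n i = 0")
        (simp_all add: mpol_pderiv_single mult_single add.commute[of m] mult.left_commute)
    show ?case
      unfolding left right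
      by (simp add: mult_single mpol_pderiv_single lookup_add distrib_right flip: single_add)
  qed (simp add: mpol_pderiv_add algebra_simps)
qed (simp add: mpol_pderiv_add algebra_simps)

lemma mpol_pderiv_mconst [simp]: "mpol_pderiv i (mconst c) = 0"
  by (simp add: mconst_def mpol_pderiv_single)

lemma mpol_pderiv_1 [simp]: "mpol_pderiv i 1 = 0"
  using mpol_pderiv_mconst[of i 1] by simp

lemma mpol_pderiv_numeral [simp]: "mpol_pderiv i (numeral n) = 0"
  using mpol_pderiv_mconst[of i "numeral n"] by simp

lemma mpol_pderiv_mvar: "mpol_pderiv i (mvar j) = (if i = j then 1 else 0)"
  by (auto simp: mvar_def mpol_pderiv_single lookup_single)

lemma mpol_pderiv_uminus: "mpol_pderiv i (- p) = - mpol_pderiv i p"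
  using mpol_pderiv_mult[of i "mconst (- 1)" p] mpol_pderiv_mconst[of i "- 1"]
  by (simp add: mconst_uminus)

lemma mpol_pderiv_diff: "mpol_pderiv i (p - q) = mpol_pderiv i p - mpol_pderiv i q"
  using mpol_pderiv_add[of i p "- q"] by (simp add: mpol_pderiv_uminus)

lemma mpol_pderiv_power: "mpol_pderiv i (p ^ Suc n) = of_nat (Suc n) * p ^ n * mpol_pderiv i p"
proof (induction n)
  case (Suc n)
  have "mpol_pderiv i (p ^ Suc (Suc n)) = mpol_pderiv i p * p ^ Suc n + p * mpol_pderiv i (p ^ Suc n)"
    by (subst power_Suc, rule mpol_pderiv_mult)
  also have "\<dots> = mpol_pderiv i p * p ^ Suc n + p * (of_nat (Suc n) * p ^ n * mpol_pderiv i p)"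
    by (simp only: Suc)
  also have "\<dots> = of_nat (Suc (Suc n)) * p ^ Suc n * mpol_pderiv i p"
    by (simp add: algebra_simps)
  finally show ?case .
qed simp

lemmas mpol_pderiv_simps = mpol_pderiv_add mpol_pderiv_mult mpol_pderiv_diff mpol_pderiv_uminus
  mpol_pderiv_mvar

subsection \<open>Homogeneous parts\<close>

lemma mon_deg_add: "mon_deg (m + n) = mon_deg m + mon_deg n"
  by (simp add: mon_deg_def lookup_add sum.distrib)

lemma mon_deg_single [simp]: "mon_deg (Poly_Mapping.single i n) = n"
proof -
  have "mon_deg (Poly_Mapping.single i n) = (\<Sum>j\<in>UNIV. if j = i then n else 0)"
    unfolding mon_deg_def by (intro sum.cong) (auto simp: lookup_single)
  then show ?thesis by simp
qed

lemma homog_part_iff: "p \<in> homog_part k \<longleftrightarrow> (\<forall>m. Poly_Mapping.lookup p m \<noteq> 0 \<longrightarrow> mon_deg m = k)"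
  by (auto simp: homog_part_def in_keys_iff)

lemma homog_part_0 [simp]: "0 \<in> homog_part k"
  by (simp add: homog_part_def)

lemma homog_part_add: "p \<in> homog_part k \<Longrightarrow> q \<in> homog_part k \<Longrightarrow> p + q \<in> homog_part k"
  using keys_add[of p q] by (auto simp: homog_part_def)

lemma homog_part_uminus: "p \<in> homog_part k \<Longrightarrow> - p \<in> homog_part k"
  by (simp add: homog_part_iff)

lemma homog_part_diff: "p \<in> homog_part k \<Longrightarrow> q \<in> homog_part k \<Longrightarrow> p - q \<in> homog_part k"
  using homog_part_add[of p k "- q"] by (simp add: homog_part_uminus)

lemma homog_part_sum: "(\<And>i. i \<in> A \<Longrightarrow> f i \<in> homog_part k) \<Longrightarrow> sum f A \<in> homog_part k"
  by (induction A rule: infinite_finite_induct) (auto intro: homog_part_add)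

lemma homog_part_single: "mon_deg m = k \<Longrightarrow> Poly_Mapping.single m c \<in> homog_part k"
  by (simp add: homog_part_def)

lemma homog_part_mult:
  assumes "p \<in> homog_part k" and "q \<in> homog_part l"
  shows "p * q \<in> homog_part (k + l)"
  using assms keys_mult[of p q] by (auto simp: homog_part_def mon_deg_add)

lemma homog_part_mvar: "mvar i \<in> homog_part (Suc 0)"
  by (simp add: mvar_def homog_part_single)

lemma homog_part_mconst: "mconst c \<in> homog_part 0"
  by (simp add: mconst_def homog_part_single mon_deg_def)

lemma homog_part_1: "1 \<in> homog_part 0"
  using homog_part_mconst[of 1] by simp

lemma homog_part_numeral: "numeral n \<in> homog_part 0"
  using homog_part_mconst[of "numeral n"] by simp

lemma homog_part_power: "p \<in> homog_part k \<Longrightarrow> p ^ n \<in> homog_part (n * k)"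
  by (induction n) (auto intro: homog_part_1 homog_part_mult)

lemma homog_part_mult': "p \<in> homog_part k \<Longrightarrow> q \<in> homog_part l \<Longrightarrow> n = k + l \<Longrightarrow> p * q \<in> homog_part n"
  using homog_part_mult by blast

lemma homog_part_power': "p \<in> homog_part k \<Longrightarrow> m = n * k \<Longrightarrow> p ^ n \<in> homog_part m"
  using homog_part_power by blast

lemma homog_part_numeral_mult: "p \<in> homog_part k \<Longrightarrow> numeral n * p \<in> homog_part k"
  using homog_part_mult[OF homog_part_numeral] by simp

lemma homog_part_mconst_mult: "p \<in> homog_part k \<Longrightarrow> mconst c * p \<in> homog_part k"
  using homog_part_mult[OF homog_part_mconst] by simp

lemma mpol_eval_scale:
  assumes "p \<in> homog_part k"
  shows "mpol_eval (c *s x) p = c ^ k * mpol_eval x p"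
proof -
  have "mpol_eval (c *s x) p = (\<Sum>m\<in>Poly_Mapping.keys p.
     c ^ k * (Poly_Mapping.lookup p m * (\<Prod>i\<in>UNIV. (x $ i) ^ Poly_Mapping.lookup m i)))"
    unfolding mpol_eval_def
  proof (intro sum.cong refl)
    fix m assume "m \<in> Poly_Mapping.keys p"
    then have "mon_deg m = k" using assms by (simp add: homog_part_def)
    then have "(\<Prod>i\<in>UNIV. c ^ Poly_Mapping.lookup m i) = c ^ k"
      by (simp add: mon_deg_def flip: power_sum)
    then show "Poly_Mapping.lookup p m * (\<Prod>i\<in>UNIV. ((c *s x) $ i) ^ Poly_Mapping.lookup m i) =
      c ^ k * (Poly_Mapping.lookup p m * (\<Prod>i\<in>UNIV. (x $ i) ^ Poly_Mapping.lookup m i))"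
      by (simp add: power_mult_distrib prod.distrib)
  qed
  then show ?thesis by (simp add: mpol_eval_def sum_distrib_left)
qed

lemma homog_part_pderiv:
  assumes "p \<in> homog_part (Suc k)"
  shows "mpol_pderiv i p \<in> homog_part k"
  unfolding mpol_pderiv_def
proof (rule homog_part_sum)
  fix m assume m: "m \<in> Poly_Mapping.keys p"
  show "Poly_Mapping.single (m - Poly_Mapping.single i 1)
     (of_nat (Poly_Mapping.lookup m i) * Poly_Mapping.lookup p m) \<in> homog_part k"
  proof (cases "Poly_Mapping.lookup m i = 0")
    case False
    then have "m = (m - Poly_Mapping.single i 1) + Poly_Mapping.single i 1"
      by (intro poly_mapping_eqI) (auto simp: lookup_add lookup_minus lookup_single when_def)
    then have "mon_deg m = mon_deg (m - Poly_Mapping.single i 1) + 1"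
      by (metis mon_deg_add mon_deg_single)
    then show ?thesis
      using assms m by (intro homog_part_single) (simp add: homog_part_def)
  qed simp
qed

text \<open>
  Relations among homogeneous polynomials may have inhomogeneous coefficients. Passing to one
  component makes the coefficients homogeneous of the expected degree.
\<close>

definition homog_component :: "nat \<Rightarrow> 'v::finite mpol \<Rightarrow> 'v mpol" where
  "homog_component k p = (\<Sum>m\<in>Poly_Mapping.keys p.
     if mon_deg m = k then Poly_Mapping.single m (Poly_Mapping.lookup p m) else 0)"

lemma homog_component_in: "homog_component k p \<in> homog_part k"
  unfolding homog_component_def by (intro homog_part_sum) (simp add: homog_part_single)

lemma homog_component_add:
  "homog_component k (p + q) = homog_component k p + homog_component k q"
  unfolding homog_component_def
  by (rule setsum_keys_plus_distrib) (simp_all flip: single_add)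

lemma homog_component_0 [simp]: "homog_component k 0 = 0"
  by (simp add: homog_component_def)

lemma homog_component_sum: "homog_component k (sum f A) = (\<Sum>i\<in>A. homog_component k (f i))"
  by (induction A rule: infinite_finite_induct) (simp_all add: homog_component_add)

lemma homog_component_of_homog:
  assumes "p \<in> homog_part l"
  shows "homog_component k p = (if l = k then p else 0)"
proof (cases "l = k")
  case True
  have "homog_component k p = (\<Sum>m\<in>Poly_Mapping.keys p. Poly_Mapping.single m (Poly_Mapping.lookup p m))"
    unfolding homog_component_def using assms True by (intro sum.cong) (auto simp: homog_part_def)
  then show ?thesis using True mpol_sum_of_terms[of p] by simp
next
  case False
  then show ?thesis
    unfolding homog_component_def using assms by (auto simp: homog_part_def intro!: sum.neutral)
qed

lemma homog_component_mult:
  assumes "q \<in> homog_part d"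
  shows "homog_component (k + d) (p * q) = homog_component k p * q"
proof (induction p rule: mpol_induct)
  case (monomial m c)
  have m: "Poly_Mapping.single m c \<in> homog_part (mon_deg m)"
    by (rule homog_part_single) simp
  from homog_component_of_homog[OF homog_part_mult[OF this assms]]
    homog_component_of_homog[OF m]
  show ?case by simp
qed (simp add: homog_component_add distrib_right)

subsection \<open>A polynomial that vanishes everywhere is zero\<close>

lemma base_expansion_unique:
  fixes f g :: "nat \<Rightarrow> nat"
  assumes "\<And>j. j < n \<Longrightarrow> f j < N \<and> g j < N"
    and "(\<Sum>j<n. f j * N ^ j) = (\<Sum>j<n. g j * N ^ j)" and "j < n"
  shows "f j = g j"
  using assms
proof (induction n arbitrary: f g j)
  case (Suc n)
  have split: "(\<Sum>j<Suc n. h j * N ^ j) = h 0 + N * (\<Sum>j<n. h (Suc j) * N ^ j)" for h :: "nat \<Rightarrow> nat"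
    by (subst sum.lessThan_Suc_shift) (simp add: sum_distrib_left algebra_simps)
  have lt: "f 0 < N" "g 0 < N" using Suc.prems(1)[of 0] by auto
  have eq: "f 0 + N * (\<Sum>j<n. f (Suc j) * N ^ j) = g 0 + N * (\<Sum>j<n. g (Suc j) * N ^ j)"
    using Suc.prems(2) unfolding split .
  from arg_cong[OF eq, of "\<lambda>x. x mod N"] lt have 0: "f 0 = g 0" by simp
  from eq 0 lt have "(\<Sum>j<n. f (Suc j) * N ^ j) = (\<Sum>j<n. g (Suc j) * N ^ j)" by simp
  then have "f (Suc i) = g (Suc i)" if "i < n" for i
    using Suc.IH[of "\<lambda>j. f (Suc j)" "\<lambda>j. g (Suc j)" i] Suc.prems(1) that by auto
  with 0 Suc.prems(3) show ?case by (cases j) auto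
qed simp

text \<open>
  Kronecker substitution: in base \<open>N\<close> larger than all exponents, \<open>x\<^sub>i = t ^ (N ^ i)\<close> sends
  distinct monomials of \<open>p\<close> to distinct powers of \<open>t\<close>, so it leaves a nonzero univariate
  polynomial.
\<close>

lemma mpol_nonzero_at_some_point:
  fixes p :: "'v::finite mpol"
  assumes "p \<noteq> 0"
  shows "\<exists>x. mpol_eval x p \<noteq> 0"
proof -
  let ?n = "CARD('v)"
  obtain h where h: "bij_betw h (UNIV :: 'v set) {..<?n}"
    using ex_bij_betw_finite_nat[of "UNIV :: 'v set"] by (auto simp: atLeast0LessThan)
  define N where "N = Suc (\<Sum>m\<in>Poly_Mapping.keys p. mon_deg m)"
  define w where "w m = (\<Sum>i\<in>UNIV. Poly_Mapping.lookup m i * N ^ h i)" for m :: "'v \<Rightarrow>\<^sub>0 nat"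
  have bound: "Poly_Mapping.lookup m i < N" if "m \<in> Poly_Mapping.keys p" for m i
  proof -
    have "Poly_Mapping.lookup m i \<le> mon_deg m"
      unfolding mon_deg_def by (rule member_le_sum) auto
    also have "\<dots> \<le> (\<Sum>m\<in>Poly_Mapping.keys p. mon_deg m)"
      using that by (intro member_le_sum) auto
    finally show ?thesis by (simp add: N_def)
  qed
  define h' where "h' = inv_into UNIV h"
  have h'h: "h' (h i) = i" for i
    using h by (simp add: h'_def bij_betw_def)
  have w_alt: "w m = (\<Sum>j<?n. Poly_Mapping.lookup m (h' j) * N ^ j)" for m
    unfolding w_def using sum.reindex_bij_betw[OF h, of "\<lambda>j. Poly_Mapping.lookup m (h' j) * N ^ j"]
    by (simp only: h'h)
  have inj: "m = l" if "m \<in> Poly_Mapping.keys p" "l \<in> Poly_Mapping.keys p" "w m = w l" for m l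
  proof (rule poly_mapping_eqI)
    fix i
    have "Poly_Mapping.lookup m (h' (h i)) = Poly_Mapping.lookup l (h' (h i))"
    proof (rule base_expansion_unique[of ?n "\<lambda>j. Poly_Mapping.lookup m (h' j)" N
          "\<lambda>j. Poly_Mapping.lookup l (h' j)" "h i"])
      show "h i < ?n" using bij_betwE[OF h] by auto
      show "Poly_Mapping.lookup m (h' j) < N \<and> Poly_Mapping.lookup l (h' j) < N" for j
        using bound that by blast
      show "(\<Sum>j<?n. Poly_Mapping.lookup m (h' j) * N ^ j) = (\<Sum>j<?n. Poly_Mapping.lookup l (h' j) * N ^ j)"
        using that(3) unfolding w_alt .
    qed
    then show "Poly_Mapping.lookup m i = Poly_Mapping.lookup l i" by (simp only: h'h)
  qed
  define P where "P = (\<Sum>m\<in>Poly_Mapping.keys p. Polynomial.monom (Poly_Mapping.lookup p m) (w m))"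
  have P: "poly P t = mpol_eval (\<chi> i. t ^ (N ^ h i)) p" for t
    unfolding P_def mpol_eval_def w_def
    by (simp add: poly_sum poly_monom power_sum power_mult[symmetric] mult.commute[of "N ^ _"])
  obtain m where m: "m \<in> Poly_Mapping.keys p"
    using assms by fastforce
  have "Polynomial.coeff P (w m) = (\<Sum>l\<in>Poly_Mapping.keys p. if l = m then Poly_Mapping.lookup p m else 0)"
    unfolding P_def Polynomial.coeff_sum
  proof (intro sum.cong refl)
    fix l assume "l \<in> Poly_Mapping.keys p"
    with inj[of l m] m show "Polynomial.coeff (Polynomial.monom (Poly_Mapping.lookup p l) (w l)) (w m) =
      (if l = m then Poly_Mapping.lookup p m else 0)"
      by (cases "l = m") auto
  qed
  also have "\<dots> \<noteq> 0" using m by (simp add: in_keys_iff)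
  finally have "P \<noteq> 0" by auto
  then obtain t where "poly P t \<noteq> 0" using poly_all_0_iff_0 by blast
  then show ?thesis using P by auto
qed

section \<open>The discriminant of the quartic and its two invariants\<close>

definition quartic_disc :: "'a::comm_ring_1 \<Rightarrow> 'a \<Rightarrow> 'a \<Rightarrow> 'a \<Rightarrow> 'a \<Rightarrow> 'a" where
  "quartic_disc a b c d e =
     b^2 * c^2 * d^2 - 4 * a * c^3 * d^2 - 4 * b^3 * d^3 + 18 * a * b * c * d^3
     - 27 * a^2 * d^4 - 4 * b^2 * c^3 * e + 16 * a * c^4 * e + 18 * b^3 * c * d * e
     - 80 * a * b * c^2 * d * e - 6 * a * b^2 * d^2 * e + 144 * a^2 * c * d^2 * e
     - 27 * b^4 * e^2 + 144 * a * b^2 * c * e^2 - 128 * a^2 * c^2 * e^2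
     - 192 * a^2 * b * d * e^2 + 256 * a^3 * e^3"

definition quartic_I :: "'a::comm_ring_1 \<Rightarrow> 'a \<Rightarrow> 'a \<Rightarrow> 'a \<Rightarrow> 'a \<Rightarrow> 'a" where
  "quartic_I a b c d e = 12 * a * e - 3 * b * d + c^2"

definition quartic_J :: "'a::comm_ring_1 \<Rightarrow> 'a \<Rightarrow> 'a \<Rightarrow> 'a \<Rightarrow> 'a \<Rightarrow> 'a" where
  "quartic_J a b c d e = 72 * a * c * e + 9 * b * c * d - 27 * a * d^2 - 27 * b^2 * e - 2 * c^3"

definition cubic_disc :: "'a::comm_ring_1 \<Rightarrow> 'a \<Rightarrow> 'a \<Rightarrow> 'a \<Rightarrow> 'a" where
  "cubic_disc a b c d =
     b^2 * c^2 - 4 * a * c^3 - 4 * b^3 * d + 18 * a * b * c * d - 27 * a^2 * d^2"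

lemma quartic_disc_invariants:
  "27 * quartic_disc a b c d e = 4 * quartic_I a b c d e ^ 3 - quartic_J a b c d e ^ 2"
  unfolding quartic_disc_def quartic_I_def quartic_J_def
  by (simp add: algebra_simps eval_nat_numeral)

text \<open>
  The cubic on the right is the resolvent, whose roots are \<open>x y + z w\<close>, \<open>x z + y w\<close>, \<open>x w + y z\<close> if
  \<open>x\<close>, \<open>y\<close>, \<open>z\<close>, \<open>w\<close> are the roots of the quartic with the elementary symmetric functions \<open>e1\<close> to \<open>e4\<close>.
\<close>

lemma quartic_disc_resolvent:
  "quartic_disc 1 (- e1) e2 (- e3) e4 =
     cubic_disc 1 (- e2) (e1 * e3 - 4 * e4) (- (e3^2 + e1^2 * e4 - 4 * e2 * e4))"
  unfolding quartic_disc_def cubic_disc_def by (simp add: algebra_simps eval_nat_numeral)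

lemma cubic_disc_roots:
  "cubic_disc a (- a * (x + y + z)) (a * (x * y + x * z + y * z)) (- a * (x * y * z)) =
    a ^ 4 * ((x - y)^2 * (x - z)^2 * (y - z)^2)"
  unfolding cubic_disc_def by (simp add: algebra_simps eval_nat_numeral)

lemma quartic_disc_homogeneous:
  "quartic_disc (t * a) (t * b) (t * c) (t * d) (t * e) = t ^ 6 * quartic_disc a b c d e"
  unfolding quartic_disc_def by (simp add: algebra_simps eval_nat_numeral)

text \<open>
  If the leading coefficient is zero, one root is at infinity and the other three are the roots of a
  cubic.
\<close>

lemma quartic_disc_leading_zero: "quartic_disc 0 b c d e = b^2 * cubic_disc b c d e"
  unfolding quartic_disc_def cubic_disc_def by (simp add: algebra_simps eval_nat_numeral)

lemma quartic_disc_roots: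
  fixes x y z w :: "'a::comm_ring_1"
  shows "quartic_disc a (- a * (x + y + z + w)) (a * (x * y + x * z + x * w + y * z + y * w + z * w))
      (- a * (x * y * z + x * y * w + x * z * w + y * z * w)) (a * (x * y * z * w)) =
    a ^ 6 * ((x - y)^2 * (x - z)^2 * (x - w)^2 * (y - z)^2 * (y - w)^2 * (z - w)^2)"
proof -
  define u v r where "u = x * y + z * w" and "v = x * z + y * w" and "r = x * w + y * z"
  have "quartic_disc a (- a * (x + y + z + w)) (a * (x * y + x * z + x * w + y * z + y * w + z * w))
      (- a * (x * y * z + x * y * w + x * z * w + y * z * w)) (a * (x * y * z * w)) =
    a ^ 6 * quartic_disc 1 (- (x + y + z + w)) (x * y + x * z + x * w + y * z + y * w + z * w)
      (- (x * y * z + x * y * w + x * z * w + y * z * w)) (x * y * z * w)"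
    by (simp only: quartic_disc_homogeneous[symmetric] mult_minus_left mult_minus_right mult_1_right)
  also have "quartic_disc 1 (- (x + y + z + w)) (x * y + x * z + x * w + y * z + y * w + z * w)
      (- (x * y * z + x * y * w + x * z * w + y * z * w)) (x * y * z * w) =
    cubic_disc 1 (- 1 * (u + v + r)) (1 * (u * v + u * r + v * r)) (- 1 * (u * v * r))"
    unfolding quartic_disc_resolvent u_def v_def r_def
    by (rule arg_cong4[where f = cubic_disc]) (simp_all add: algebra_simps eval_nat_numeral)
  also have "\<dots> = (u - v)^2 * (u - r)^2 * (v - r)^2"
    unfolding cubic_disc_roots by simp
  also have "u - v = (x - w) * (y - z)" unfolding u_def v_def by (simp add: algebra_simps)
  also have "u - r = (x - z) * (y - w)" unfolding u_def r_def by (simp add: algebra_simps)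
  also have "v - r = (x - y) * (z - w)" unfolding v_def r_def by (simp add: algebra_simps)
  finally show ?thesis by (simp add: power_mult_distrib mult_ac)
qed

text \<open>
  The coefficients are those of \<open>(s x + t y)\<^sup>2 (p x\<^sup>2 + q x y + r y\<^sup>2)\<close>, and the right side is the
  square of the value of the second factor at the double root. So \<open>I\<close> vanishes only if the linear form
  divides that factor too, which is how triple roots are recognized below.
\<close>

lemma quartic_I_double_root:
  fixes s t p q r :: "'a::comm_ring_1"
  shows "quartic_I (s^2 * p) (s^2 * q + 2 * s * t * p) (s^2 * r + 2 * s * t * q + t^2 * p) (2 * s * t * r + t^2 * q) (t^2 * r)
    = (p * t^2 - q * s * t + r * s^2)^2"
  unfolding quartic_I_def by (simp add: algebra_simps eval_nat_numeral)

lemma quartic_J_double_root: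
  fixes s t p q r :: "'a::comm_ring_1"
  shows "quartic_J (s^2 * p) (s^2 * q + 2 * s * t * p) (s^2 * r + 2 * s * t * q + t^2 * p) (2 * s * t * r + t^2 * q) (t^2 * r)
    = - 2 * (p * t^2 - q * s * t + r * s^2)^3"
  unfolding quartic_J_def by (simp add: algebra_simps eval_nat_numeral)

lemma quartic_disc_double_root:
  fixes s t p q r :: complex
  shows "quartic_disc (s^2 * p) (s^2 * q + 2 * s * t * p) (s^2 * r + 2 * s * t * q + t^2 * p) (2 * s * t * r + t^2 * q) (t^2 * r) = 0"
proof -
  let ?D = "quartic_disc (s^2 * p) (s^2 * q + 2 * s * t * p) (s^2 * r + 2 * s * t * q + t^2 * p) (2 * s * t * r + t^2 * q) (t^2 * r)"
  have "27 * ?D = 0"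
    unfolding quartic_disc_invariants quartic_I_double_root quartic_J_double_root
    by (simp add: power_mult_distrib flip: power_mult)
  then show ?thesis by simp
qed

section \<open>Roots\<close>

lemma complex_poly_splits:
  fixes p :: "complex poly"
  assumes "p \<noteq> 0"
  shows "\<exists>\<alpha>. \<forall>x. poly p x = lead_coeff p * (\<Prod>i<Polynomial.degree p. x - \<alpha> i)"
proof -
  obtain A where A: "size A = Polynomial.degree p" "p = Polynomial.smult (lead_coeff p) (\<Prod>x\<in>#A. [:-x, 1:])"
    using alg_closed_imp_factorization[OF assms] by blast
  obtain xs where xs: "A = mset xs" using ex_mset by metis
  have "poly (\<Prod>x\<in>#mset ys. [:-x, 1:]) x = (\<Prod>i<length ys. x - ys ! i)" for ys and x :: complex
    by (induction ys) (simp_all add: prod.lessThan_Suc_shift algebra_simps del: prod.lessThan_Suc)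
  then have "poly p x = lead_coeff p * (\<Prod>i<length xs. x - xs ! i)" for x
    by (subst A(2)) (simp add: xs)
  then show ?thesis using A(1) xs by (intro exI[of _ "\<lambda>i. xs ! i"]) simp
qed

lemma quartic_coeffs_of_roots:
  fixes a b c d e :: complex
  assumes "\<And>X. a * X^4 + b * X^3 + c * X^2 + d * X + e = a * ((X - x) * (X - y) * (X - z) * (X - w))"
  shows "b = - a * (x + y + z + w)" and "c = a * (x * y + x * z + x * w + y * z + y * w + z * w)"
    and "d = - a * (x * y * z + x * y * w + x * z * w + y * z * w)" and "e = a * (x * y * z * w)"
proof -
  have "poly [:e, d, c, b, a:] = poly [:a * (x * y * z * w), - a * (x * y * z + x * y * w + x * z * w + y * z * w),
    a * (x * y + x * z + x * w + y * z + y * w + z * w), - a * (x + y + z + w), a:]"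
  proof
    fix X
    have "poly [:e, d, c, b, a:] X = a * X^4 + b * X^3 + c * X^2 + d * X + e"
      by (simp add: algebra_simps eval_nat_numeral)
    also have "\<dots> = poly [:a * (x * y * z * w), - a * (x * y * z + x * y * w + x * z * w + y * z * w),
      a * (x * y + x * z + x * w + y * z + y * w + z * w), - a * (x + y + z + w), a:] X"
      unfolding assms by (simp add: algebra_simps)
    finally show "poly [:e, d, c, b, a:] X = \<dots>" .
  qed
  then show "b = - a * (x + y + z + w)" and "c = a * (x * y + x * z + x * w + y * z + y * w + z * w)"
    and "d = - a * (x * y * z + x * y * w + x * z * w + y * z * w)" and "e = a * (x * y * z * w)"
    unfolding poly_eq_poly_eq_iff by simp_all
qed

lemma cubic_coeffs_of_roots:
  fixes a b c d :: complex
  assumes "\<And>X. a * X^3 + b * X^2 + c * X + d = a * ((X - x) * (X - y) * (X - z))"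
  shows "b = - a * (x + y + z)" and "c = a * (x * y + x * z + y * z)" and "d = - a * (x * y * z)"
proof -
  have "poly [:d, c, b, a:] = poly [:- a * (x * y * z), a * (x * y + x * z + y * z), - a * (x + y + z), a:]"
  proof
    fix X
    have "poly [:d, c, b, a:] X = a * X^3 + b * X^2 + c * X + d"
      by (simp add: algebra_simps eval_nat_numeral)
    also have "\<dots> = poly [:- a * (x * y * z), a * (x * y + x * z + y * z), - a * (x + y + z), a:] X"
      unfolding assms by (simp add: algebra_simps)
    finally show "poly [:d, c, b, a:] X = \<dots>" .
  qed
  then show "b = - a * (x + y + z)" and "c = a * (x * y + x * z + y * z)" and "d = - a * (x * y * z)"
    unfolding poly_eq_poly_eq_iff by simp_all
qed

lemma quartic_splits:
  fixes a b c d e :: complex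
  assumes "a \<noteq> 0"
  shows "\<exists>\<alpha>. \<forall>X. a * X^4 + b * X^3 + c * X^2 + d * X + e = a * (\<Prod>i<(4::nat). X - \<alpha> i)"
proof -
  have "\<exists>\<alpha>. \<forall>x. poly [:e, d, c, b, a:] x = a * (\<Prod>i<(4::nat). x - \<alpha> i)"
    using complex_poly_splits[of "[:e, d, c, b, a:]"] assms by (simp add: eval_nat_numeral)
  moreover have "poly [:e, d, c, b, a:] X = a * X^4 + b * X^3 + c * X^2 + d * X + e" for X
    by (simp add: algebra_simps eval_nat_numeral)
  ultimately show ?thesis by metis
qed

lemma cubic_splits:
  fixes a b c d :: complex
  assumes "a \<noteq> 0"
  shows "\<exists>x y z. \<forall>X. a * X^3 + b * X^2 + c * X + d = a * ((X - x) * (X - y) * (X - z))"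
proof -
  have "\<exists>\<alpha>. \<forall>x. poly [:d, c, b, a:] x = a * (\<Prod>i<(3::nat). x - \<alpha> i)"
    using complex_poly_splits[of "[:d, c, b, a:]"] assms by (simp add: eval_nat_numeral)
  then obtain \<alpha> where "\<And>x. poly [:d, c, b, a:] x = a * (\<Prod>i<(3::nat). x - \<alpha> i)" by blast
  moreover have "poly [:d, c, b, a:] X = a * X^3 + b * X^2 + c * X + d" for X
    by (simp add: algebra_simps eval_nat_numeral)
  moreover have "(\<Prod>i<(3::nat). X - \<alpha> i) = (X - \<alpha> 0) * (X - \<alpha> 1) * (X - \<alpha> 2)" for X
    by (simp add: eval_nat_numeral)
  ultimately show ?thesis by metis
qed

lemma prod_lessThan_4: "(\<Prod>i<(4::nat). f i) = f 0 * f 1 * f 2 * f 3"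
  by (simp add: eval_nat_numeral)

lemma quartic_disc_eq_0_imp_double_root:
  fixes a b c d e :: complex
  assumes "quartic_disc a b c d e = 0"
  shows "\<exists>s t p q r. a = s^2 * p \<and> b = s^2 * q + 2 * s * t * p \<and> c = s^2 * r + 2 * s * t * q + t^2 * p \<and>
    d = 2 * s * t * r + t^2 * q \<and> e = t^2 * r"
proof (cases "a = 0")
  case False
  obtain \<alpha> where "\<And>X. a * X^4 + b * X^3 + c * X^2 + d * X + e = a * (\<Prod>i<(4::nat). X - \<alpha> i)"
    using quartic_splits[OF False] by blast
  then obtain x y z w where
    "\<And>X. a * X^4 + b * X^3 + c * X^2 + d * X + e = a * ((X - x) * (X - y) * (X - z) * (X - w))"
    unfolding prod_lessThan_4 by blast
  note vieta = quartic_coeffs_of_roots[OF this]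
  \<comment> \<open>The form is \<open>(X - x)\<^sup>2\<close> times \<open>a (X - z) (X - w)\<close>.\<close>
  have double: ?thesis if "b = - a * (2 * x + z + w)" "c = a * (x^2 + 2 * x * z + 2 * x * w + z * w)"
    "d = - a * (x^2 * z + x^2 * w + 2 * x * z * w)" "e = a * (x^2 * z * w)" for x z w
    using that
    by (intro exI[of _ 1] exI[of _ "- x"] exI[of _ a] exI[of _ "- a * (z + w)"] exI[of _ "a * (z * w)"])
      (simp add: algebra_simps power2_eq_square)
  have "a ^ 6 * ((x - y)^2 * (x - z)^2 * (x - w)^2 * (y - z)^2 * (y - w)^2 * (z - w)^2) = 0"
    using assms unfolding vieta quartic_disc_roots .
  with False consider "x = y" | "x = z" | "x = w" | "y = z" | "y = w" | "z = w" by auto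
  then show ?thesis
  proof cases
    case 1 show ?thesis by (rule double[of x z w]) (simp_all add: vieta 1 algebra_simps power2_eq_square)
  next
    case 2 show ?thesis by (rule double[of x y w]) (simp_all add: vieta 2 algebra_simps power2_eq_square)
  next
    case 3 show ?thesis by (rule double[of x y z]) (simp_all add: vieta 3 algebra_simps power2_eq_square)
  next
    case 4 show ?thesis by (rule double[of y x w]) (simp_all add: vieta 4 algebra_simps power2_eq_square)
  next
    case 5 show ?thesis by (rule double[of y x z]) (simp_all add: vieta 5 algebra_simps power2_eq_square)
  next
    case 6 show ?thesis by (rule double[of z x y]) (simp_all add: vieta 6 algebra_simps power2_eq_square)
  qed
next
  case True
  note a = True
  show ?thesis
  proof (cases "b = 0")
    case False
    obtain x y z where
      "\<And>X. b * X^3 + c * X^2 + d * X + e = b * ((X - x) * (X - y) * (X - z))"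
      using cubic_splits[OF False] by blast
    note vieta = cubic_coeffs_of_roots[OF this]
    have double: ?thesis if "c = - b * (2 * x + z)" "d = b * (x^2 + 2 * x * z)" "e = - b * (x^2 * z)" for x z
      using that
      by (intro exI[of _ 1] exI[of _ "- x"] exI[of _ 0] exI[of _ b] exI[of _ "- b * z"])
        (simp add: a algebra_simps power2_eq_square)
    have "b^2 * (b ^ 4 * ((x - y)^2 * (x - z)^2 * (y - z)^2)) = 0"
      using assms unfolding a quartic_disc_leading_zero vieta cubic_disc_roots .
    with False consider "x = y" | "x = z" | "y = z" by auto
    then show ?thesis
    proof cases
      case 1 show ?thesis by (rule double[of x z]) (simp_all add: vieta 1 algebra_simps power2_eq_square)
    next
      case 2 show ?thesis by (rule double[of x y]) (simp_all add: vieta 2 algebra_simps power2_eq_square)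
    next
      case 3 show ?thesis by (rule double[of y x]) (simp_all add: vieta 3 algebra_simps power2_eq_square)
    qed
  next
    case True
    show ?thesis
      by (rule exI[of _ 0], rule exI[of _ 1], rule exI[of _ c], rule exI[of _ d], rule exI[of _ e])
        (simp add: a True)
  qed
qed

text \<open>
  The relation between \<open>\<Delta>\<close>, \<open>I\<close> and \<open>J\<close> gives a double root, and the value of \<open>I\<close> shows that the
  linear form divides the remaining quadratic factor. The result has the coefficients of
  \<open>(s x + t y)\<^sup>3 (u x + v y)\<close>.
\<close>

lemma quartic_invariants_eq_0_imp_triple_root:
  fixes a b c d e :: complex
  assumes "quartic_I a b c d e = 0" and "quartic_J a b c d e = 0"
  shows "\<exists>s t u v. a = s^3 * u \<and> b = s^3 * v + 3 * s^2 * t * u \<and> c = 3 * s^2 * t * v + 3 * s * t^2 * u \<and>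
    d = 3 * s * t^2 * v + t^3 * u \<and> e = t^3 * v"
proof -
  have "quartic_disc a b c d e = 0"
    using quartic_disc_invariants[of a b c d e] assms by simp
  then obtain s t p q r where sol: "a = s^2 * p" "b = s^2 * q + 2 * s * t * p" "c = s^2 * r + 2 * s * t * q + t^2 * p"
    "d = 2 * s * t * r + t^2 * q" "e = t^2 * r"
    using quartic_disc_eq_0_imp_double_root by blast
  have 0: "p * t^2 - q * s * t + r * s^2 = 0"
    using assms(1) unfolding sol quartic_I_double_root by simp
  have triple: ?thesis if "p = s * u" "q = s * v + t * u" "r = t * v" for u v
    using that by (intro exI[of _ s] exI[of _ t] exI[of _ u] exI[of _ v])
      (simp add: sol algebra_simps eval_nat_numeral)
  consider "s \<noteq> 0" | "s = 0" "t \<noteq> 0" | "s = 0" "t = 0" by blast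
  then show ?thesis
  proof cases
    case 1
    have "r = t * ((q - t * (p/s)) / s)"
      using 0 1 by (simp add: field_simps power2_eq_square)
    then show ?thesis using 1 by (intro triple[of "p/s" "(q - t * (p/s)) / s"]) (simp_all add: field_simps)
  next
    case 2
    then show ?thesis using 0 by (intro triple[of "q/t" "r/t"]) simp_all
  next
    case 3
    then show ?thesis by (intro exI[of _ 0]) (simp add: sol)
  qed
qed

lemma quartic_invariants_triple_root:
  fixes s t u v :: "'a::comm_ring_1"
  shows "quartic_I (s^3 * u) (s^3 * v + 3 * s^2 * t * u) (3 * s^2 * t * v + 3 * s * t^2 * u)
      (3 * s * t^2 * v + t^3 * u) (t^3 * v) = 0"
    and "quartic_J (s^3 * u) (s^3 * v + 3 * s^2 * t * u) (3 * s^2 * t * v + 3 * s * t^2 * u)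
      (3 * s * t^2 * v + t^3 * u) (t^3 * v) = 0"
proof -
  let ?p = "s * u" and ?q = "s * v + t * u" and ?r = "t * v"
  have eqs: "s^2 * ?p = s^3 * u" "s^2 * ?q + 2 * s * t * ?p = s^3 * v + 3 * s^2 * t * u"
    "s^2 * ?r + 2 * s * t * ?q + t^2 * ?p = 3 * s^2 * t * v + 3 * s * t^2 * u"
    "2 * s * t * ?r + t^2 * ?q = 3 * s * t^2 * v + t^3 * u" "t^2 * ?r = t^3 * v"
    and 0: "?p * t^2 - ?q * s * t + ?r * s^2 = 0"
    by (simp_all add: algebra_simps eval_nat_numeral)
  show "quartic_I (s^3 * u) (s^3 * v + 3 * s^2 * t * u) (3 * s^2 * t * v + 3 * s * t^2 * u)
      (3 * s * t^2 * v + t^3 * u) (t^3 * v) = 0"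
    using quartic_I_double_root[of s ?p ?q t ?r] unfolding eqs 0 by simp
  show "quartic_J (s^3 * u) (s^3 * v + 3 * s^2 * t * u) (3 * s^2 * t * v + 3 * s * t^2 * u)
      (3 * s * t^2 * v + t^3 * u) (t^3 * v) = 0"
    using quartic_J_double_root[of s ?p ?q t ?r] unfolding eqs 0 by simp
qed

section \<open>The discriminant polynomial\<close>

lemma UNIV_5: "(UNIV :: 5 set) = {0, 1, 2, 3, 4}"
proof -
  have "card {0, 1, 2, 3, 4 :: 5} = CARD(5)" by simp
  then show ?thesis by (metis card_subset_eq finite subset_UNIV)
qed

lemma sum_5: "(\<Sum>i\<in>(UNIV :: 5 set). f i) = f 0 + f 1 + f 2 + f 3 + f 4"
  unfolding UNIV_5 by (simp add: add.assoc)

lemma forall_5: "(\<forall>i :: 5. P i) \<longleftrightarrow> P 0 \<and> P 1 \<and> P 2 \<and> P 3 \<and> P 4"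
proof -
  have "(\<forall>i :: 5. P i) \<longleftrightarrow> (\<forall>i \<in> UNIV. P (i :: 5))" by simp
  then show ?thesis unfolding UNIV_5 by simp
qed

abbreviation quartic_disc_mpol :: "5 mpol" where
  "quartic_disc_mpol \<equiv> quartic_disc (mvar 0) (mvar 1) (mvar 2) (mvar 3) (mvar 4)"

abbreviation quartic_I_mpol :: "5 mpol" where
  "quartic_I_mpol \<equiv> quartic_I (mvar 0) (mvar 1) (mvar 2) (mvar 3) (mvar 4)"

abbreviation quartic_J_mpol :: "5 mpol" where
  "quartic_J_mpol \<equiv> quartic_J (mvar 0) (mvar 1) (mvar 2) (mvar 3) (mvar 4)"

lemma mpol_eval_quartic_disc:
  "mpol_eval x quartic_disc_mpol = quartic_disc (x $ 0) (x $ 1) (x $ 2) (x $ 3) (x $ 4)"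
  by (simp add: quartic_disc_def mpol_eval_simps)

lemma mpol_eval_quartic_I:
  "mpol_eval x quartic_I_mpol = quartic_I (x $ 0) (x $ 1) (x $ 2) (x $ 3) (x $ 4)"
  by (simp add: quartic_I_def mpol_eval_simps)

lemma mpol_eval_quartic_J:
  "mpol_eval x quartic_J_mpol = quartic_J (x $ 0) (x $ 1) (x $ 2) (x $ 3) (x $ 4)"
  by (simp add: quartic_J_def mpol_eval_simps)

lemma is_discriminant_quartic: "is_discriminant quartic_disc_mpol"
  unfolding is_discriminant_def Let_def
proof (intro allI impI)
  fix x :: "complex ^ 5" and \<alpha> :: "nat \<Rightarrow> complex"
  assume "\<forall>X. binary_form x X 1 = x $ 0 * (\<Prod>i<CARD(5) - 1. X - \<alpha> i)"
  then have "x $ 0 * X^4 + x $ 1 * X^3 + x $ 2 * X^2 + x $ 3 * X + x $ 4 =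
    x $ 0 * ((X - \<alpha> 0) * (X - \<alpha> 1) * (X - \<alpha> 2) * (X - \<alpha> 3))" for X
    by (simp add: binary_form_quartic prod_lessThan_4)
  note vieta = quartic_coeffs_of_roots[OF this]
  have "mpol_eval x quartic_disc_mpol = (x $ 0) ^ 6 * ((\<alpha> 0 - \<alpha> 1)^2 * (\<alpha> 0 - \<alpha> 2)^2 *
      (\<alpha> 0 - \<alpha> 3)^2 * (\<alpha> 1 - \<alpha> 2)^2 * (\<alpha> 1 - \<alpha> 3)^2 * (\<alpha> 2 - \<alpha> 3)^2)"
    unfolding mpol_eval_quartic_disc vieta quartic_disc_roots ..
  then show "mpol_eval x quartic_disc_mpol =
    (x $ 0) ^ (2 * (CARD(5) - 1) - 2) * (\<Prod>j<CARD(5) - 1. \<Prod>i<j. (\<alpha> i - \<alpha> j)\<^sup>2)"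
    by (simp add: eval_nat_numeral mult_ac)
qed

text \<open>
  The defining formula fixes the values only where the leading coefficient is nonzero; that is a
  dense set, and a polynomial is determined by its values there.
\<close>

lemma is_discriminant_unique:
  fixes D E :: "5 mpol"
  assumes "is_discriminant D" and "is_discriminant E"
  shows "D = E"
proof -
  have "mpol_eval x (mvar 0 * (D - E)) = 0" for x
  proof (cases "x $ 0 = 0")
    case False
    obtain \<alpha> where "\<And>X. x $ 0 * X^4 + x $ 1 * X^3 + x $ 2 * X^2 + x $ 3 * X + x $ 4 =
        x $ 0 * (\<Prod>i<(4::nat). X - \<alpha> i)"
      using quartic_splits[OF False, of "x $ 1" "x $ 2" "x $ 3" "x $ 4"] by blast
    then have "\<forall>X. binary_form x X 1 = x $ 0 * (\<Prod>i<CARD(5) - 1. X - \<alpha> i)"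
      by (simp add: binary_form_quartic)
    with assms[unfolded is_discriminant_def Let_def, rule_format, of x \<alpha>] False
    have "mpol_eval x D = mpol_eval x E" by simp
    then show ?thesis by (simp add: mpol_eval_simps)
  qed (simp add: mpol_eval_simps)
  then have "mvar 0 * (D - E) = 0"
    using mpol_nonzero_at_some_point by blast
  moreover have "mpol_eval (\<chi> i. 1) (mvar (0::5)) = 1" by simp
  then have "mvar (0::5) \<noteq> (0 :: 5 mpol)"
    by (metis mpol_eval_0 zero_neq_one)
  ultimately show ?thesis by simp
qed

lemma disc4_eq: "disc4 = quartic_disc_mpol"
  unfolding discriminant_def
  by (rule the_equality[where P = is_discriminant])
    (use is_discriminant_quartic is_discriminant_unique in blast)+

section \<open>Counting monomials\<close>

text \<open>
  Exponent vectors of degree \<open>k\<close> correspond to lists of length \<open>CARD('v)\<close> with sum \<open>k\<close>.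
\<close>

lemma card_monomials:
  "finite {m :: 'v::finite \<Rightarrow>\<^sub>0 nat. mon_deg m = k}" (is "finite ?M")
  "card {m :: 'v::finite \<Rightarrow>\<^sub>0 nat. mon_deg m = k} = (k + CARD('v) - 1) choose k"
proof -
  let ?n = "CARD('v)"
  let ?L = "{l :: nat list. length l = ?n \<and> sum_list l = k}"
  obtain h where h: "bij_betw h {..<?n} (UNIV :: 'v set)"
    using ex_bij_betw_nat_finite[of "UNIV :: 'v set"] by (auto simp: atLeast0LessThan)
  define F where "F m = map (\<lambda>j. Poly_Mapping.lookup m (h j)) [0..<?n]" for m :: "'v \<Rightarrow>\<^sub>0 nat"
  have sum_F: "sum_list (F m) = mon_deg m" for m
    using sum.reindex_bij_betw[OF h, of "Poly_Mapping.lookup m"]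
    by (simp add: F_def mon_deg_def interv_sum_list_conv_sum_set_nat atLeast0LessThan)
  have inj: "inj F"
  proof (rule injI)
    fix m l assume eq: "F m = F l"
    show "m = l"
    proof (rule poly_mapping_eqI)
      fix i
      obtain j where j: "j < ?n" "h j = i"
        using bij_betw_imp_surj_on[OF h] by (metis UNIV_I imageE lessThan_iff)
      have "F m ! j = F l ! j" using eq by simp
      with j show "Poly_Mapping.lookup m i = Poly_Mapping.lookup l i" by (simp add: F_def)
    qed
  qed
  have img: "F ` ?M = ?L"
  proof (intro equalityI subsetI)
    fix l assume "l \<in> F ` ?M"
    then show "l \<in> ?L" using sum_F by (auto simp: F_def)
  next
    fix l assume l: "l \<in> ?L"
    define g where "g = inv_into {..<?n} h"
    have g: "g (h j) = j" if "j < ?n" for j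
      using h that by (simp add: g_def bij_betw_def)
    define m where "m = Abs_poly_mapping (\<lambda>i. l ! g i)"
    have lm: "Poly_Mapping.lookup m i = l ! g i" for i
      unfolding m_def by (subst lookup_Abs_poly_mapping) auto
    have "F m = l" using l g by (intro nth_equalityI) (auto simp: F_def lm)
    moreover from this have "m \<in> ?M" using sum_F[of m] l by auto
    ultimately show "l \<in> F ` ?M" by blast
  qed
  have "finite ?L"
  proof (rule finite_subset)
    show "?L \<subseteq> {l. set l \<subseteq> {..k} \<and> length l = ?n}"
      using member_le_sum_list by auto
  qed (simp add: finite_lists_length_eq)
  then show "finite ?M"
    using img inj by (metis finite_imageD inj_on_subset subset_UNIV)
  have "card ?M = card ?L"
    unfolding img[symmetric] using inj by (metis card_image inj_on_subset subset_UNIV)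
  then show "card ?M = (k + ?n - 1) choose k"
    by (simp add: card_length_sum_list)
qed

section \<open>Linear algebra\<close>

global_interpretation mpol_vs: vector_space "\<lambda>c p. mconst c * (p :: 'v mpol)"
  by unfold_locales (simp_all add: algebra_simps mconst_add mconst_mult)

definition monomials :: "nat \<Rightarrow> 'v::finite mpol set" where
  "monomials k = (\<lambda>m. Poly_Mapping.single m 1) ` {m. mon_deg m = k}"

lemma inj_on_single_1: "inj_on (\<lambda>m. Poly_Mapping.single m (1::complex)) A"
  by (rule inj_onI) (metis lookup_single_eq lookup_single_not_eq zero_neq_one)

lemma card_monomials_set:
  "finite (monomials k :: 'v::finite mpol set)"
  "card (monomials k :: 'v::finite mpol set) = (k + CARD('v) - 1) choose k"
  unfolding monomials_def using card_monomials[where 'v = 'v, of k]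
  by (simp_all add: card_image inj_on_single_1)

lemma homog_part_subspace: "mpol_vs.subspace (homog_part k)"
  unfolding mpol_vs.subspace_def by (auto intro: homog_part_add homog_part_mconst_mult)

lemma span_monomials: "mpol_vs.span (monomials k) = (homog_part k :: 'v::finite mpol set)"
proof
  show "mpol_vs.span (monomials k) \<subseteq> (homog_part k :: 'v mpol set)"
    by (rule mpol_vs.span_minimal[OF _ homog_part_subspace])
      (auto simp: monomials_def homog_part_single)
  show "(homog_part k :: 'v mpol set) \<subseteq> mpol_vs.span (monomials k)"
  proof
    fix p :: "'v mpol" assume p: "p \<in> homog_part k"
    have "(\<Sum>m\<in>Poly_Mapping.keys p. Poly_Mapping.single m (Poly_Mapping.lookup p m))
      \<in> mpol_vs.span (monomials k)"
    proof (rule mpol_vs.span_sum)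
      fix m assume "m \<in> Poly_Mapping.keys p"
      then have "Poly_Mapping.single m 1 \<in> monomials k"
        using p by (auto simp: monomials_def homog_part_def)
      from mpol_vs.span_scale[OF mpol_vs.span_base[OF this], of "Poly_Mapping.lookup p m"]
      show "Poly_Mapping.single m (Poly_Mapping.lookup p m) \<in> mpol_vs.span (monomials k)"
        by (simp add: mconst_def mult_single)
    qed
    then show "p \<in> mpol_vs.span (monomials k)" using mpol_sum_of_terms[of p] by metis
  qed
qed

section \<open>Points and closed sets of projective space\<close>

definition proj_point :: "complex ^ 'v::finite \<Rightarrow> (complex ^ 'v) set" where
  "proj_point x = {c *s x | c. c \<noteq> 0}"

lemma proj_space_eq: "proj_space = proj_point ` {x. x \<noteq> 0}"
proof -
  have "{(x, y). x \<noteq> 0 \<and> (\<exists>c. c \<noteq> 0 \<and> y = c *s x)} `` {x} = proj_point x"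
    if "x \<noteq> 0" for x :: "complex ^ 'v"
    using that by (auto simp: proj_point_def)
  then show ?thesis
    unfolding proj_space_def quotient_def by (auto simp: image_def)
qed

lemma proj_point_self: "x \<in> proj_point x"
  unfolding proj_point_def by (rule CollectI, rule exI[of _ 1]) simp

lemma homog_eval_proj_point:
  assumes "f \<in> homog_part k"
  shows "(\<forall>y\<in>proj_point x. mpol_eval y f = 0) \<longleftrightarrow> mpol_eval x f = 0"
  using proj_point_self[of x] by (auto simp: proj_point_def mpol_eval_scale[OF assms])

lemma proj_point_in_zeros:
  assumes "F \<subseteq> (\<Union>k. homog_part k)" and "x \<noteq> 0"
  shows "proj_point x \<in> proj_zeros F \<longleftrightarrow> (\<forall>f\<in>F. mpol_eval x f = 0)"
proof -
  have "proj_point x \<in> proj_space" using assms by (auto simp: proj_space_eq)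
  moreover have "(\<forall>y\<in>proj_point x. mpol_eval y f = 0) \<longleftrightarrow> mpol_eval x f = 0" if "f \<in> F" for f
    using that assms homog_eval_proj_point by blast
  ultimately show ?thesis unfolding proj_zeros_def by blast
qed

lemma proj_zeros_subset_space: "proj_zeros F \<subseteq> proj_space"
  by (auto simp: proj_zeros_def)

lemma zariski_closed_subset_space: "zariski_closed Z \<Longrightarrow> Z \<subseteq> proj_space"
  using proj_zeros_subset_space by (auto simp: zariski_closed_def)

lemma zariski_closed_zeros: "F \<subseteq> (\<Union>k. homog_part k) \<Longrightarrow> zariski_closed (proj_zeros F)"
  by (auto simp: zariski_closed_def)

text \<open>
  Two sets are compared through a single form: this extracts, from a defining family of \<open>A\<close>, one
  member that does not vanish on all of \<open>Z\<close>.
\<close>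

lemma closed_not_subset:
  assumes "zariski_closed A" and "Z \<subseteq> proj_space" and "\<not> Z \<subseteq> A"
  obtains x f k where "x \<noteq> 0" "proj_point x \<in> Z" "f \<in> homog_part k" "mpol_eval x f \<noteq> 0"
    "\<And>y. y \<noteq> 0 \<Longrightarrow> proj_point y \<in> A \<Longrightarrow> mpol_eval y f = 0"
proof -
  obtain F where F: "F \<subseteq> (\<Union>k. homog_part k)" "A = proj_zeros F"
    using assms by (auto simp: zariski_closed_def)
  obtain p where "p \<in> Z" "p \<notin> A" using assms by blast
  then obtain x where x: "x \<noteq> 0" "proj_point x \<in> Z" "proj_point x \<notin> A"
    using assms(2) by (auto simp: proj_space_eq)
  then obtain f where f: "f \<in> F" "mpol_eval x f \<noteq> 0"
    unfolding F(2) proj_point_in_zeros[OF F(1) x(1)] by blast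
  from f F obtain k where "f \<in> homog_part k" by blast
  with x f that show ?thesis
    using proj_point_in_zeros[OF F(1)] F(2) by blast
qed

section \<open>Irreducibility\<close>

definition curve_at :: "('v::finite \<Rightarrow> complex poly) \<Rightarrow> complex \<Rightarrow> complex ^ 'v" where
  "curve_at \<gamma> t = (\<chi> i. poly (\<gamma> i) t)"

definition mpol_along :: "('v::finite \<Rightarrow> complex poly) \<Rightarrow> 'v mpol \<Rightarrow> complex poly" where
  "mpol_along \<gamma> p = (\<Sum>m\<in>Poly_Mapping.keys p.
     [:Poly_Mapping.lookup p m:] * (\<Prod>i\<in>UNIV. \<gamma> i ^ Poly_Mapping.lookup m i))"

lemma poly_mpol_along: "poly (mpol_along \<gamma> p) t = mpol_eval (curve_at \<gamma> t) p"
  by (simp add: mpol_along_def mpol_eval_def curve_at_def poly_sum poly_prod)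

text \<open>
  Take forms \<open>f\<close> and \<open>g\<close> vanishing on \<open>A\<close> and on \<open>B\<close>, with \<open>f\<close> nonzero at a point \<open>u\<close> of \<open>Z\<close> and \<open>g\<close>
  nonzero at a point \<open>v\<close>. Along a polynomial curve from \<open>u\<close> to \<open>v\<close> both become nonzero univariate
  polynomials, so their product is nonzero somewhere on the curve, at a point outside of
  \<open>A \<union> B\<close>. The curve may pass through the zero vector, which is no projective point; one
  coordinate of the curve is therefore included in the product.
\<close>

lemma irreducible_by_curves:
  assumes "Z \<noteq> {}" and "Z \<subseteq> proj_space"
    and curves: "\<And>u v. u \<noteq> 0 \<Longrightarrow> v \<noteq> 0 \<Longrightarrow> proj_point u \<in> Z \<Longrightarrow> proj_point v \<in> Z \<Longrightarrow>
      \<exists>\<gamma>. curve_at \<gamma> 0 = u \<and> curve_at \<gamma> 1 = v \<and>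
        (\<forall>t. curve_at \<gamma> t \<noteq> 0 \<longrightarrow> proj_point (curve_at \<gamma> t) \<in> Z)"
  shows "zariski_irreducible Z"
  unfolding zariski_irreducible_def
proof (intro conjI allI impI)
  show "Z \<noteq> {}" by fact
next
  fix A B :: "(complex ^ 'a) set set"
  assume closed: "zariski_closed A" "zariski_closed B" and cover: "Z \<subseteq> A \<union> B"
  show "Z \<subseteq> A \<or> Z \<subseteq> B"
  proof (rule ccontr)
    assume neg: "\<not> (Z \<subseteq> A \<or> Z \<subseteq> B)"
    obtain u f k where u: "u \<noteq> 0" "proj_point u \<in> Z" "mpol_eval u f \<noteq> 0"
      and f: "\<And>y. y \<noteq> 0 \<Longrightarrow> proj_point y \<in> A \<Longrightarrow> mpol_eval y f = 0"
      using closed_not_subset[OF closed(1) assms(2)] neg by metis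
    obtain v g l where v: "v \<noteq> 0" "proj_point v \<in> Z" "mpol_eval v g \<noteq> 0"
      and g: "\<And>y. y \<noteq> 0 \<Longrightarrow> proj_point y \<in> B \<Longrightarrow> mpol_eval y g = 0"
      using closed_not_subset[OF closed(2) assms(2)] neg by metis
    obtain \<gamma> where \<gamma>: "curve_at \<gamma> 0 = u" "curve_at \<gamma> 1 = v"
      and inZ: "\<And>t. curve_at \<gamma> t \<noteq> 0 \<Longrightarrow> proj_point (curve_at \<gamma> t) \<in> Z"
      using curves[OF u(1) v(1) u(2) v(2)] by blast
    obtain i where i: "u $ i \<noteq> 0" using u(1) by (auto simp: vec_eq_iff)
    have "\<gamma> i \<noteq> 0" using i \<gamma>(1) by (auto simp: curve_at_def)
    moreover have "mpol_along \<gamma> f \<noteq> 0" using poly_mpol_along[of \<gamma> f 0] \<gamma>(1) u(3) by auto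
    moreover have "mpol_along \<gamma> g \<noteq> 0" using poly_mpol_along[of \<gamma> g 1] \<gamma>(2) v(3) by auto
    ultimately have "mpol_along \<gamma> f * mpol_along \<gamma> g * \<gamma> i \<noteq> 0" by simp
    then obtain t where "poly (mpol_along \<gamma> f * mpol_along \<gamma> g * \<gamma> i) t \<noteq> 0"
      using poly_all_0_iff_0 by blast
    then have t: "mpol_eval (curve_at \<gamma> t) f \<noteq> 0" "mpol_eval (curve_at \<gamma> t) g \<noteq> 0" "curve_at \<gamma> t \<noteq> 0"
      by (auto simp: poly_mpol_along curve_at_def vec_eq_iff)
    from inZ[OF t(3)] cover f[OF t(3)] g[OF t(3)] t show False by blast
  qed
qed

section \<open>Lengths of chains of irreducible closed sets\<close>

definition vanishes_on :: "(complex ^ 'v::finite) set set \<Rightarrow> 'v mpol \<Rightarrow> bool" where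
  "vanishes_on Z p \<longleftrightarrow> (\<forall>x. x \<noteq> 0 \<longrightarrow> proj_point x \<in> Z \<longrightarrow> mpol_eval x p = 0)"

lemma vanishes_on_mono: "Z \<subseteq> W \<Longrightarrow> vanishes_on W p \<Longrightarrow> vanishes_on Z p"
  by (auto simp: vanishes_on_def)

text \<open>
  The vanishing ideal of an irreducible set is prime.
\<close>

lemma vanishes_on_irreducible:
  assumes W: "zariski_irreducible W" "W \<subseteq> proj_space"
    and g: "g \<in> homog_part d" and p: "p \<in> homog_part k" and "vanishes_on W (g * p)"
  shows "vanishes_on W g \<or> vanishes_on W p"
proof -
  have zeros: "W \<subseteq> proj_zeros {f} \<longleftrightarrow> vanishes_on W f" if "f \<in> homog_part l" for f l
  proof -
    have "{f} \<subseteq> (\<Union>k. homog_part k)" using that by auto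
    from proj_point_in_zeros[OF this] W(2) show ?thesis
      unfolding vanishes_on_def by (auto simp: proj_space_eq)
  qed
  have closed: "zariski_closed (proj_zeros {f})" if "f \<in> homog_part l" for f :: "'a mpol" and l
    using that by (intro zariski_closed_zeros) auto
  have "W \<subseteq> proj_zeros {g} \<union> proj_zeros {p}"
  proof
    fix z assume "z \<in> W"
    then obtain x where x: "x \<noteq> 0" "z = proj_point x" using W(2) by (auto simp: proj_space_eq)
    with \<open>z \<in> W\<close> assms(5) have "mpol_eval x g = 0 \<or> mpol_eval x p = 0"
      by (auto simp: vanishes_on_def mpol_eval_mult)
    moreover have "{g} \<subseteq> (\<Union>k. homog_part k)" "{p} \<subseteq> (\<Union>k. homog_part k)" using g p by auto
    ultimately show "z \<in> proj_zeros {g} \<union> proj_zeros {p}"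
      using x proj_point_in_zeros[of "{g}" x] proj_point_in_zeros[of "{p}" x] by auto
  qed
  then show ?thesis
    using W(1) closed[OF g] closed[OF p] zeros[OF g] zeros[OF p]
    unfolding zariski_irreducible_def by metis
qed

text \<open>
  This says that the homogeneous coordinate ring of \<open>Z\<close> has dimension at least \<open>N\<close> in degree \<open>k\<close>. The
  family is indexed, so that families can be concatenated.
\<close>

definition forms_independent_on ::
    "(complex ^ 'v::finite) set set \<Rightarrow> nat \<Rightarrow> nat \<Rightarrow> bool" where
  "forms_independent_on Z k N \<longleftrightarrow> (\<exists>f. (\<forall>j<N. f j \<in> homog_part k) \<and>
     (\<forall>c. vanishes_on Z (\<Sum>j<N. mconst (c j) * f j) \<longrightarrow> (\<forall>j<N. c j = 0)))"

lemma forms_independent_on_fewer: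
  assumes "forms_independent_on Z k N" and "M \<le> N"
  shows "forms_independent_on Z k M"
proof -
  obtain f where f: "\<And>j. j < N \<Longrightarrow> f j \<in> homog_part k"
    and ind: "\<And>c. vanishes_on Z (\<Sum>j<N. mconst (c j) * f j) \<Longrightarrow> (\<forall>j<N. c j = 0)"
    using assms(1) unfolding forms_independent_on_def by blast
  have main: "\<forall>j<M. c j = 0" if "vanishes_on Z (\<Sum>j<M. mconst (c j) * f j)" for c
  proof -
    have "(\<Sum>j<N. mconst (if j < M then c j else 0) * f j) = (\<Sum>j<M. mconst (c j) * f j)"
      using assms(2) by (intro sum.mono_neutral_cong_right) auto
    with that ind[of "\<lambda>j. if j < M then c j else 0"]
    have all: "\<forall>j<N. (if j < M then c j else 0) = 0" by simp
    show ?thesis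
    proof (intro allI impI)
      fix j assume "j < M"
      with all[rule_format, of j] assms(2) show "c j = 0" by simp
    qed
  qed
  show ?thesis
    unfolding forms_independent_on_def
  proof (intro exI[of _ f] conjI)
    show "\<forall>j<M. f j \<in> homog_part k" using f assms(2) by simp
    show "\<forall>c. vanishes_on Z (\<Sum>j<M. mconst (c j) * f j) \<longrightarrow> (\<forall>j<M. c j = 0)"
      by (intro allI[of "\<lambda>c. _ c \<longrightarrow> _ c"] impI main)
  qed
qed

lemma forms_independent_on_larger:
  assumes "forms_independent_on Z k N" and "Z \<subseteq> W"
  shows "forms_independent_on W k N"
proof -
  obtain f where f: "\<forall>j<N. f j \<in> homog_part k"
    and ind: "\<And>c. vanishes_on Z (\<Sum>j<N. mconst (c j) * f j) \<Longrightarrow> (\<forall>j<N. c j = 0)"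
    using assms(1) unfolding forms_independent_on_def by blast
  show ?thesis
    unfolding forms_independent_on_def
  proof (intro exI[of _ f] conjI f)
    show "\<forall>c. vanishes_on W (\<Sum>j<N. mconst (c j) * f j) \<longrightarrow> (\<forall>j<N. c j = 0)"
      by (intro allI[of "\<lambda>c. _ c \<longrightarrow> _ c"] impI ind vanishes_on_mono[OF assms(2)])
  qed
qed

lemma forms_independent_on_one:
  assumes "Z \<noteq> {}" and "Z \<subseteq> proj_space"
  shows "forms_independent_on Z k 1"
proof -
  obtain x where x: "x \<noteq> 0" "proj_point x \<in> Z"
    using assms by (auto simp: proj_space_eq)
  obtain i where i: "x $ i \<noteq> 0" using x(1) by (auto simp: vec_eq_iff)
  show ?thesis
    unfolding forms_independent_on_def
  proof (intro exI[of _ "\<lambda>_. mvar i ^ k"] conjI allI impI)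
    show "mvar i ^ k \<in> homog_part k" for j
      by (rule homog_part_power'[OF homog_part_mvar]) simp
  next
    fix c :: "nat \<Rightarrow> complex" and j assume "vanishes_on Z (\<Sum>j<1. mconst (c j) * mvar i ^ k)" "j < (1::nat)"
    with x i show "c j = 0" by (auto simp: vanishes_on_def mpol_eval_simps)
  qed
qed

text \<open>
  Forms independent on \<open>Z\<close> stay independent on \<open>W\<close> when the multiples by \<open>g\<close> of independent forms on
  \<open>W\<close> are added: restriction to \<open>Z\<close> kills the multiples of \<open>g\<close>, and \<open>g\<close> can then be cancelled because
  the vanishing ideal of \<open>W\<close> is prime.
\<close>

lemma forms_independent_on_step:
  assumes W: "zariski_irreducible W" "W \<subseteq> proj_space" and ZW: "Z \<subseteq> W"
    and g: "g \<in> homog_part d" "vanishes_on Z g" "\<not> vanishes_on W g"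
    and N: "forms_independent_on Z (d + k) N" and M: "forms_independent_on W k M"
  shows "forms_independent_on W (d + k) (N + M)"
proof -
  obtain f where f: "\<And>j. j < N \<Longrightarrow> f j \<in> homog_part (d + k)"
    and ind_f: "\<And>c. vanishes_on Z (\<Sum>j<N. mconst (c j) * f j) \<Longrightarrow> (\<forall>j<N. c j = 0)"
    using N unfolding forms_independent_on_def by blast
  obtain h where h: "\<And>j. j < M \<Longrightarrow> h j \<in> homog_part k"
    and ind_h: "\<And>c. vanishes_on W (\<Sum>j<M. mconst (c j) * h j) \<Longrightarrow> (\<forall>j<M. c j = 0)"
    using M unfolding forms_independent_on_def by blast
  define r where "r j = (if j < N then f j else g * h (j - N))" for j
  have r: "r j \<in> homog_part (d + k)" if "j < N + M" for j
    using that f h homog_part_mult[OF g(1)] by (auto simp: r_def)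
  have split: "(\<Sum>j<N + M. mconst (c j) * r j) =
    (\<Sum>j<N. mconst (c j) * f j) + g * (\<Sum>j<M. mconst (c (N + j)) * h j)" for c
  proof -
    have "(\<Sum>j<N + M. mconst (c j) * r j) =
      (\<Sum>j<N. mconst (c j) * r j) + (\<Sum>j<M. mconst (c (N + j)) * r (N + j))"
      by (induction M) (simp_all add: add_ac)
    also have "(\<Sum>j<N. mconst (c j) * r j) = (\<Sum>j<N. mconst (c j) * f j)"
      by (simp add: r_def)
    also have "(\<Sum>j<M. mconst (c (N + j)) * r (N + j)) = g * (\<Sum>j<M. mconst (c (N + j)) * h j)"
      by (simp add: r_def sum_distrib_left mult.left_commute)
    finally show ?thesis .
  qed
  have main: "\<forall>j<N + M. c j = 0" if van: "vanishes_on W (\<Sum>j<N + M. mconst (c j) * r j)" for c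
  proof -
    let ?A = "\<Sum>j<N. mconst (c j) * f j" and ?B = "\<Sum>j<M. mconst (c (N + j)) * h j"
    have sum: "vanishes_on W (?A + g * ?B)" using van unfolding split .
    have "vanishes_on Z ?A"
      using vanishes_on_mono[OF ZW sum] g(2) by (simp add: vanishes_on_def mpol_eval_simps)
    then have c: "\<forall>j<N. c j = 0" by (rule ind_f)
    then have "?A = 0" by simp
    with sum have "vanishes_on W (g * ?B)" by simp
    moreover have "?B \<in> homog_part k" using h by (intro homog_part_sum homog_part_mconst_mult) auto
    ultimately have "vanishes_on W ?B"
      using vanishes_on_irreducible[OF W g(1)] g(3) by blast
    then have c': "\<forall>j<M. c (N + j) = 0" by (rule ind_h)
    show ?thesis
    proof (intro allI impI)
      fix j assume "j < N + M"
      with c c'[rule_format, of "j - N"] show "c j = 0" by (cases "j < N") auto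
    qed
  qed
  show ?thesis
    unfolding forms_independent_on_def
  proof (intro exI[of _ r] conjI)
    show "\<forall>j<N + M. r j \<in> homog_part (d + k)" using r by simp
    show "\<forall>c. vanishes_on W (\<Sum>j<N + M. mconst (c j) * r j) \<longrightarrow> (\<forall>j<N + M. c j = 0)"
      by (intro allI[of "\<lambda>c. _ c \<longrightarrow> _ c"] impI main)
  qed
qed

text \<open>
  Summing the previous inequality over \<open>k\<close>, \<open>k - E\<close>, \<open>k - 2 E\<close>, and so on, turns a lower bound of
  order \<open>k\<^sup>n\<close> for one member of the chain into one of order \<open>k\<^sup>n\<^sup>+\<^sup>1\<close> for the next. In terms of the
  quotients \<open>k div E\<close> the summation is Pascal's rule.
\<close>

lemma forms_independent_on_chain:
  assumes "irreducible_chain X n Z"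
  shows "\<exists>D\<ge>1. \<forall>k. forms_independent_on (Z n) k ((k div D + n) choose n)"
  using assms
proof (induction n)
  case 0
  then have "Z 0 \<noteq> {}" "Z 0 \<subseteq> proj_space"
    using zariski_closed_subset_space unfolding irreducible_chain_def zariski_irreducible_def by auto
  then show ?case using forms_independent_on_one by (intro exI[of _ 1]) auto
next
  case (Suc n)
  have "irreducible_chain X n Z"
    using Suc.prems unfolding irreducible_chain_def by auto
  then obtain D where D: "D \<ge> 1"
    and ind: "\<And>k. forms_independent_on (Z n) k ((k div D + n) choose n)"
    using Suc.IH by blast
  let ?W = "Z (Suc n)"
  have W: "zariski_irreducible ?W" "?W \<subseteq> proj_space" and ZW: "Z n \<subset> ?W"
    and Zn: "zariski_closed (Z n)"
    using Suc.prems zariski_closed_subset_space unfolding irreducible_chain_def by auto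
  have "\<not> ?W \<subseteq> Z n" using ZW by blast
  from closed_not_subset[OF Zn W(2) this] obtain x f d where
    x: "x \<noteq> 0" "proj_point x \<in> ?W" "mpol_eval x f \<noteq> 0" and f: "f \<in> homog_part d"
    and van: "\<And>y. y \<noteq> 0 \<Longrightarrow> proj_point y \<in> Z n \<Longrightarrow> mpol_eval y f = 0" by metis
  \<comment> \<open>The coordinate makes the degree of \<open>g\<close> positive, the power makes it a multiple of \<open>D\<close>.\<close>
  obtain i where i: "x $ i \<noteq> 0" using x(1) by (auto simp: vec_eq_iff)
  define g where "g = (f * mvar i) ^ D"
  define E where "E = D * (d + 1)"
  have g: "g \<in> homog_part E"
    unfolding g_def E_def
    by (rule homog_part_power) (use homog_part_mult[OF f homog_part_mvar[of i]] in simp)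
  have gZ: "vanishes_on (Z n) g" using van D by (auto simp: vanishes_on_def g_def mpol_eval_simps)
  have gW: "\<not> vanishes_on ?W g" using x i by (auto simp: vanishes_on_def g_def mpol_eval_simps)
  have E: "E \<ge> 1" "D \<le> E" using D by (simp_all add: E_def)
  have "forms_independent_on ?W k ((k div E + Suc n) choose Suc n)" for k
  proof (induction k rule: less_induct)
    case (less k)
    have Z: "forms_independent_on (Z n) k ((k div E + n) choose n)"
    proof (rule forms_independent_on_fewer[OF ind])
      have "k div E \<le> k div D" using D E by (intro div_le_mono2) auto
      then show "(k div E + n) choose n \<le> (k div D + n) choose n"
        by (intro binomial_right_mono) auto
    qed
    show ?case
    proof (cases "k < E")
      case True
      then show ?thesis using forms_independent_on_larger[OF Z] ZW by auto
    next
      case False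
      then have k: "E + (k - E) = k" by simp
      have q: "k div E = Suc ((k - E) div E)"
        using False E by (simp add: le_div_geq)
      have "forms_independent_on ?W (k - E) (((k - E) div E + Suc n) choose Suc n)"
        using less[of "k - E"] False E by auto
      with forms_independent_on_step[OF W _ g gZ gW, of "k - E"] Z ZW
      have "forms_independent_on ?W k (((k div E + n) choose n) + (((k - E) div E + Suc n) choose Suc n))"
        unfolding k by auto
      moreover have "(k div E + Suc n) choose Suc n =
        ((k div E + n) choose n) + (((k - E) div E + Suc n) choose Suc n)"
        unfolding q by simp
      ultimately show ?thesis by simp
    qed
  qed
  with E(1) show ?case by blast
qed

lemma forms_independent_on_bound:
  fixes Z :: "(complex ^ 'v::finite) set set"
  assumes "forms_independent_on Z k N"
  shows "N \<le> (k + CARD('v) - 1) choose k"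
proof -
  obtain f where f: "\<And>j. j < N \<Longrightarrow> f j \<in> homog_part k"
    and ind: "\<And>c. vanishes_on Z (\<Sum>j<N. mconst (c j) * f j) \<Longrightarrow> (\<forall>j<N. c j = 0)"
    using assms unfolding forms_independent_on_def by blast
  have van0: "vanishes_on Z 0" by (simp add: vanishes_on_def)
  have inj: "inj_on f {..<N}"
  proof (rule inj_onI, rule ccontr)
    fix i j assume ij: "i \<in> {..<N}" "j \<in> {..<N}" "f i = f j" "i \<noteq> j"
    define c where "c l = (if l = i then 1 else if l = j then - 1 else (0::complex))" for l
    have "(\<Sum>l<N. mconst (c l) * f l) = (\<Sum>l\<in>{i, j}. mconst (c l) * f l)"
      using ij by (intro sum.mono_neutral_right) (auto simp: c_def)
    also have "\<dots> = 0" using ij by (simp add: c_def mconst_uminus)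
    finally have "c i = 0" using ind[of c] van0 ij by auto
    then show False by (simp add: c_def)
  qed
  have "mpol_vs.independent (f ` {..<N})"
  proof (rule mpol_vs.independent_if_scalars_zero)
    fix c p assume sum: "(\<Sum>p\<in>f ` {..<N}. mconst (c p) * p) = 0" and p: "p \<in> f ` {..<N}"
    have "(\<Sum>j<N. mconst (c (f j)) * f j) = 0"
      using sum by (simp add: sum.reindex[OF inj])
    with ind[of "\<lambda>j. c (f j)"] van0 p show "c p = 0" by auto
  qed simp
  moreover have "f ` {..<N} \<subseteq> mpol_vs.span (monomials k)"
    using f by (auto simp: span_monomials)
  ultimately have "card (f ` {..<N}) \<le> card (monomials k :: 'v mpol set)"
    using mpol_vs.independent_span_bound card_monomials_set(1) by blast
  then show ?thesis by (simp add: card_image[OF inj] card_monomials_set)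
qed

lemma irreducible_chain_length:
  fixes Z :: "nat \<Rightarrow> (complex ^ 'v::finite) set set"
  assumes "irreducible_chain X n Z"
  shows "n \<le> CARD('v) - 1"
proof (rule ccontr)
  let ?m = "CARD('v) - 1"
  assume "\<not> n \<le> ?m"
  then have n: "Suc ?m \<le> n" by simp
  have "irreducible_chain X (Suc ?m) Z"
    using assms n unfolding irreducible_chain_def by auto
  then obtain D where D: "D \<ge> 1"
    and ind: "\<And>k. forms_independent_on (Z (Suc ?m)) k ((k div D + Suc ?m) choose Suc ?m)"
    using forms_independent_on_chain by blast
  have c: "CARD('v) \<ge> 1" by (simp add: Suc_leI)
  have bound: "(q + Suc ?m) choose Suc ?m \<le> (D * q + ?m) choose ?m" for q
  proof -
    have "(D * q div D + Suc ?m) choose Suc ?m \<le> (D * q + CARD('v) - 1) choose (D * q)"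
      by (rule forms_independent_on_bound[OF ind])
    also have "D * q + CARD('v) - 1 = D * q + ?m" using c by simp
    also have "(D * q + ?m) choose (D * q) = (D * q + ?m) choose ?m"
      using binomial_symmetric[OF le_add1[of "D * q" ?m]] by (simp only: diff_add_inverse)
    finally show ?thesis using D by simp
  qed
  \<comment> \<open>In \<open>q\<close> the left side has order \<open>s\<close> and the right side order \<open>s - 1\<close>; this \<open>q\<close> is large enough.\<close>
  define s where "s = Suc ?m"
  define q where "q = s ^ s * (D + 1) ^ ?m"
  have s: "s \<ge> 1" by (simp add: s_def)
  have Q: "real (q + s) > 0" using s by simp
  have "(real (q + s) / real s) ^ s \<le> real ((q + s) choose s)"
    by (rule binomial_ge_n_over_k_pow_k) simp
  also have "\<dots> \<le> real ((D * q + ?m) choose ?m)" using bound[of q] by (simp add: s_def)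
  also have "\<dots> \<le> real ((D * q + ?m) ^ ?m)"
    by (metis binomial_le_pow le_add2 of_nat_le_iff)
  also have "\<dots> \<le> real (((D + 1) * (q + s)) ^ ?m)"
    by (intro of_nat_mono power_mono) (simp_all add: s_def algebra_simps)
  also have "\<dots> = real ((D + 1) ^ ?m) * real (q + s) ^ ?m"
    by (simp only: power_mult_distrib of_nat_mult of_nat_power)
  finally have "real (q + s) ^ s \<le> real (s ^ s * (D + 1) ^ ?m) * real (q + s) ^ ?m"
    using s by (simp add: power_divide divide_le_eq mult_ac)
  moreover have "real (q + s) ^ s = real (q + s) * real (q + s) ^ ?m"
    using power_Suc[of "real (q + s)" ?m] by (simp only: s_def[symmetric])
  ultimately have "real (q + s) * real (q + s) ^ ?m \<le> real q * real (q + s) ^ ?m"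
    by (simp only: q_def[symmetric])
  with Q have "real (q + s) \<le> real q"
    by (metis mult_le_cancel_right zero_less_power not_less)
  with s show False by simp
qed

section \<open>The discriminant hypersurface and its singular locus\<close>

text \<open>
  A definition by cases for an arbitrary type, because it is used for points, for curves with
  polynomial coordinates, and for vector fields.
\<close>

definition vec5 :: "'a \<Rightarrow> 'a \<Rightarrow> 'a \<Rightarrow> 'a \<Rightarrow> 'a \<Rightarrow> 5 \<Rightarrow> 'a" where
  "vec5 a b c d e i = (if i = 0 then a else if i = 1 then b else if i = 2 then c
     else if i = 3 then d else e)"

lemma vec5_simps [simp]:
  "vec5 a b c d e 0 = a" "vec5 a b c d e 1 = b" "vec5 a b c d e 2 = c" "vec5 a b c d e 3 = d"
  "vec5 a b c d e 4 = e"
  by (simp_all add: vec5_def)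

lemma curve_at_vec5:
  "curve_at (vec5 A B C D E) t = (\<chi> i. vec5 (poly A t) (poly B t) (poly C t) (poly D t) (poly E t) i)"
  by (simp add: curve_at_def vec_eq_iff vec5_def)

lemma vec5_eq_iff:
  fixes x :: "'a ^ 5"
  shows "(\<chi> i. vec5 a b c d e i) = x \<longleftrightarrow>
    a = x $ 0 \<and> b = x $ 1 \<and> c = x $ 2 \<and> d = x $ 3 \<and> e = x $ 4"
  unfolding vec_eq_iff by (subst forall_5) simp

lemma homog_quartic_I: "quartic_I_mpol \<in> homog_part 2"
  unfolding quartic_I_def
  by (intro homog_part_add homog_part_diff homog_part_power'[OF homog_part_mvar]
      homog_part_mult'[OF homog_part_numeral_mult[OF homog_part_mvar] homog_part_mvar]) simp_all

lemma homog_quartic_J: "quartic_J_mpol \<in> homog_part 3"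
proof -
  note v = homog_part_mvar
  have v2: "mvar i ^ 2 \<in> homog_part 2" for i :: 5 by (rule homog_part_power'[OF v]) simp
  have v3: "mvar i ^ 3 \<in> homog_part 3" for i :: 5 by (rule homog_part_power'[OF v]) simp
  have t1: "numeral n * mvar i * mvar j * mvar k \<in> homog_part 3" for n and i j k :: 5
    by (rule homog_part_mult'[OF homog_part_mult'[OF homog_part_numeral_mult[OF v] v refl] v]) simp
  have t2: "numeral n * mvar i * mvar j ^ 2 \<in> homog_part 3" for n and i j :: 5
    by (rule homog_part_mult'[OF homog_part_numeral_mult[OF v] v2]) simp
  have t3: "numeral n * mvar i ^ 2 * mvar j \<in> homog_part 3" for n and i j :: 5
    by (rule homog_part_mult'[OF homog_part_numeral_mult[OF v2] v]) simp
  show ?thesis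
    unfolding quartic_J_def by (intro homog_part_add homog_part_diff homog_part_numeral_mult t1 t2 t3 v3)
qed

lemma mpol_eq_from_27:
  fixes p :: "'v mpol"
  assumes "27 * p = q"
  shows "p = mconst (1 / 27) * q"
  unfolding assms[symmetric] mult.assoc[symmetric] mconst_numeral[symmetric] mconst_mult[symmetric] by simp

lemma homog_quartic_disc: "quartic_disc_mpol \<in> homog_part 6"
proof -
  have "quartic_disc_mpol = mconst (1 / 27) * (4 * quartic_I_mpol ^ 3 - quartic_J_mpol ^ 2)"
    by (rule mpol_eq_from_27) (rule quartic_disc_invariants)
  also have "\<dots> \<in> homog_part 6"
    by (intro homog_part_mconst_mult homog_part_diff homog_part_numeral_mult
        homog_part_power'[OF homog_quartic_I] homog_part_power'[OF homog_quartic_J]) simp_all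
  finally show ?thesis .
qed

text \<open>
  All that is needed about the gradient of \<open>\<Delta>\<close>: it is expressed through those of the invariants,
  so that the 16 terms of \<open>\<Delta>\<close> are never differentiated.
\<close>

lemma pderiv_quartic_disc:
  "27 * mpol_pderiv i quartic_disc_mpol =
     12 * quartic_I_mpol ^ 2 * mpol_pderiv i quartic_I_mpol
     - 2 * quartic_J_mpol * mpol_pderiv i quartic_J_mpol"
proof -
  have "mpol_pderiv i (27 * quartic_disc_mpol) = mpol_pderiv i (4 * quartic_I_mpol ^ Suc 2 - quartic_J_mpol ^ Suc 1)"
    by (simp add: quartic_disc_invariants eval_nat_numeral)
  then show ?thesis
    unfolding mpol_pderiv_mult mpol_pderiv_diff mpol_pderiv_power by (simp add: mult.assoc)
qed

lemma hypersurface_disc_point: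
  fixes x :: "complex ^ 5"
  assumes "x \<noteq> 0"
  shows "proj_point x \<in> hypersurface quartic_disc_mpol \<longleftrightarrow>
    quartic_disc (x $ 0) (x $ 1) (x $ 2) (x $ 3) (x $ 4) = 0"
proof -
  have "{quartic_disc_mpol} \<subseteq> (\<Union>k. homog_part k)" using homog_quartic_disc by blast
  from proj_point_in_zeros[OF this assms] show ?thesis
    by (simp add: hypersurface_def mpol_eval_quartic_disc)
qed

lemma singular_locus_as_zeros:
  assumes f: "f \<in> homog_part (Suc k)"
  shows "insert f (range (\<lambda>i. mpol_pderiv i f)) \<subseteq> (\<Union>k. homog_part k)"
    and "singular_locus f = proj_zeros (insert f (range (\<lambda>i. mpol_pderiv i f)))"
  using f homog_part_pderiv[OF f] by (blast, auto simp: singular_locus_def hypersurface_def proj_zeros_def)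

lemma singular_locus_if_invariants_vanish:
  fixes x :: "complex ^ 5"
  assumes "x \<noteq> 0" and I: "quartic_I (x $ 0) (x $ 1) (x $ 2) (x $ 3) (x $ 4) = 0"
    and J: "quartic_J (x $ 0) (x $ 1) (x $ 2) (x $ 3) (x $ 4) = 0"
  shows "proj_point x \<in> singular_locus quartic_disc_mpol"
proof -
  have f: "quartic_disc_mpol \<in> homog_part (Suc 5)" using homog_quartic_disc by simp
  have "27 * mpol_eval x quartic_disc_mpol = 0"
    using I J by (simp add: mpol_eval_quartic_disc quartic_disc_invariants)
  moreover have "27 * mpol_eval x (mpol_pderiv i quartic_disc_mpol) = 0" for i
  proof -
    have "27 * mpol_eval x (mpol_pderiv i quartic_disc_mpol) =
      mpol_eval x (27 * mpol_pderiv i quartic_disc_mpol)" by (simp add: mpol_eval_mult)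
    then show ?thesis
      using I J
      by (simp add: pderiv_quartic_disc mpol_eval_simps mpol_eval_quartic_I mpol_eval_quartic_J)
  qed
  ultimately show ?thesis
    using proj_point_in_zeros[OF singular_locus_as_zeros(1)[OF f] assms(1)]
    by (simp add: singular_locus_as_zeros(2)[OF f])
qed

text \<open>
  The linear factor and the quadratic factor of \<open>l\<^sup>2 q\<close> move along straight lines.
\<close>

lemma irreducible_hypersurface_disc: "zariski_irreducible (hypersurface quartic_disc_mpol)"
proof (rule irreducible_by_curves)
  have "proj_point (axis 0 1) \<in> hypersurface quartic_disc_mpol"
    by (subst hypersurface_disc_point) (simp_all add: axis_def quartic_disc_def vec_eq_iff)
  then show "hypersurface quartic_disc_mpol \<noteq> {}" by blast
  show "hypersurface quartic_disc_mpol \<subseteq> proj_space"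
    unfolding hypersurface_def by (rule proj_zeros_subset_space)
next
  fix u v :: "complex ^ 5"
  assume "u \<noteq> 0" "v \<noteq> 0" "proj_point u \<in> hypersurface quartic_disc_mpol"
    "proj_point v \<in> hypersurface quartic_disc_mpol"
  then have disc: "quartic_disc (u $ 0) (u $ 1) (u $ 2) (u $ 3) (u $ 4) = 0"
    "quartic_disc (v $ 0) (v $ 1) (v $ 2) (v $ 3) (v $ 4) = 0"
    by (simp_all add: hypersurface_disc_point)
  obtain s t p q r where
    u: "u $ 0 = s^2 * p" "u $ 1 = s^2 * q + 2 * s * t * p" "u $ 2 = s^2 * r + 2 * s * t * q + t^2 * p"
      "u $ 3 = 2 * s * t * r + t^2 * q" "u $ 4 = t^2 * r"
    using quartic_disc_eq_0_imp_double_root[OF disc(1)] by metis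
  obtain s' t' p' q' r' where
    v: "v $ 0 = s'^2 * p'" "v $ 1 = s'^2 * q' + 2 * s' * t' * p'"
      "v $ 2 = s'^2 * r' + 2 * s' * t' * q' + t'^2 * p'"
      "v $ 3 = 2 * s' * t' * r' + t'^2 * q'" "v $ 4 = t'^2 * r'"
    using quartic_disc_eq_0_imp_double_root[OF disc(2)] by metis
  define S T P Q R where "S = [:s, s' - s:]" and "T = [:t, t' - t:]" and "P = [:p, p' - p:]"
    and "Q = [:q, q' - q:]" and "R = [:r, r' - r:]"
  define \<gamma> where "\<gamma> = vec5 (S^2 * P) (S^2 * Q + 2 * S * T * P) (S^2 * R + 2 * S * T * Q + T^2 * P)
    (2 * S * T * R + T^2 * Q) (T^2 * R)"
  have ends: "poly S 0 = s" "poly T 0 = t" "poly P 0 = p" "poly Q 0 = q" "poly R 0 = r"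
    "poly S 1 = s'" "poly T 1 = t'" "poly P 1 = p'" "poly Q 1 = q'" "poly R 1 = r'"
    by (simp_all add: S_def T_def P_def Q_def R_def)
  have "curve_at \<gamma> 0 = u" "curve_at \<gamma> 1 = v"
    unfolding \<gamma>_def curve_at_vec5 vec5_eq_iff by (simp_all add: ends u v)
  moreover have "proj_point (curve_at \<gamma> t) \<in> hypersurface quartic_disc_mpol" if "curve_at \<gamma> t \<noteq> 0" for t
    unfolding hypersurface_disc_point[OF that] by (simp add: \<gamma>_def curve_at_vec5 quartic_disc_double_root)
  ultimately show "\<exists>\<gamma>. curve_at \<gamma> 0 = u \<and> curve_at \<gamma> 1 = v \<and>
      (\<forall>t. curve_at \<gamma> t \<noteq> 0 \<longrightarrow> proj_point (curve_at \<gamma> t) \<in> hypersurface quartic_disc_mpol)"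
    by blast
qed

definition triple_root_locus :: "(complex ^ 5) set set" where
  "triple_root_locus = proj_zeros {quartic_I_mpol, quartic_J_mpol}"

lemma closed_triple_root_locus: "zariski_closed triple_root_locus"
  unfolding triple_root_locus_def
  using homog_quartic_I homog_quartic_J by (intro zariski_closed_zeros) auto

lemma triple_root_locus_point:
  fixes x :: "complex ^ 5"
  assumes "x \<noteq> 0"
  shows "proj_point x \<in> triple_root_locus \<longleftrightarrow>
    quartic_I (x $ 0) (x $ 1) (x $ 2) (x $ 3) (x $ 4) = 0 \<and>
    quartic_J (x $ 0) (x $ 1) (x $ 2) (x $ 3) (x $ 4) = 0"
proof -
  have "{quartic_I_mpol, quartic_J_mpol} \<subseteq> (\<Union>k. homog_part k)"
    using homog_quartic_I homog_quartic_J by blast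
  from proj_point_in_zeros[OF this assms] show ?thesis
    by (simp add: triple_root_locus_def mpol_eval_quartic_I mpol_eval_quartic_J)
qed

lemma irreducible_triple_root_locus: "zariski_irreducible triple_root_locus"
proof (rule irreducible_by_curves)
  have "proj_point (axis 0 1) \<in> triple_root_locus"
    by (subst triple_root_locus_point) (simp_all add: axis_def quartic_I_def quartic_J_def vec_eq_iff)
  then show "triple_root_locus \<noteq> {}" by blast
  show "triple_root_locus \<subseteq> proj_space"
    unfolding triple_root_locus_def by (rule proj_zeros_subset_space)
next
  fix u v :: "complex ^ 5"
  assume uv: "u \<noteq> 0" "v \<noteq> 0" "proj_point u \<in> triple_root_locus" "proj_point v \<in> triple_root_locus"
  from uv(3)[unfolded triple_root_locus_point[OF uv(1)]] obtain s t p q where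
    u: "u $ 0 = s^3 * p" "u $ 1 = s^3 * q + 3 * s^2 * t * p" "u $ 2 = 3 * s^2 * t * q + 3 * s * t^2 * p"
      "u $ 3 = 3 * s * t^2 * q + t^3 * p" "u $ 4 = t^3 * q"
    using quartic_invariants_eq_0_imp_triple_root by metis
  from uv(4)[unfolded triple_root_locus_point[OF uv(2)]] obtain s' t' p' q' where
    v: "v $ 0 = s'^3 * p'" "v $ 1 = s'^3 * q' + 3 * s'^2 * t' * p'"
      "v $ 2 = 3 * s'^2 * t' * q' + 3 * s' * t'^2 * p'"
      "v $ 3 = 3 * s' * t'^2 * q' + t'^3 * p'" "v $ 4 = t'^3 * q'"
    using quartic_invariants_eq_0_imp_triple_root by metis
  define S T P Q where "S = [:s, s' - s:]" and "T = [:t, t' - t:]" and "P = [:p, p' - p:]"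
    and "Q = [:q, q' - q:]"
  define \<gamma> where "\<gamma> = vec5 (S^3 * P) (S^3 * Q + 3 * S^2 * T * P) (3 * S^2 * T * Q + 3 * S * T^2 * P)
    (3 * S * T^2 * Q + T^3 * P) (T^3 * Q)"
  have ends: "poly S 0 = s" "poly T 0 = t" "poly P 0 = p" "poly Q 0 = q"
    "poly S 1 = s'" "poly T 1 = t'" "poly P 1 = p'" "poly Q 1 = q'"
    by (simp_all add: S_def T_def P_def Q_def)
  have "curve_at \<gamma> 0 = u" "curve_at \<gamma> 1 = v"
    unfolding \<gamma>_def curve_at_vec5 vec5_eq_iff by (simp_all add: ends u v)
  moreover have "proj_point (curve_at \<gamma> t) \<in> triple_root_locus" if "curve_at \<gamma> t \<noteq> 0" for t
    unfolding triple_root_locus_point[OF that]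
    by (simp add: \<gamma>_def curve_at_vec5 quartic_invariants_triple_root)
  ultimately show "\<exists>\<gamma>. curve_at \<gamma> 0 = u \<and> curve_at \<gamma> 1 = v \<and>
      (\<forall>t. curve_at \<gamma> t \<noteq> 0 \<longrightarrow> proj_point (curve_at \<gamma> t) \<in> triple_root_locus)"
    by blast
qed

definition coordinate_subspace :: "'v::finite set \<Rightarrow> (complex ^ 'v) set set" where
  "coordinate_subspace S = proj_zeros (mvar ` S)"

lemma closed_coordinate_subspace: "zariski_closed (coordinate_subspace S)"
  unfolding coordinate_subspace_def using homog_part_mvar by (intro zariski_closed_zeros) auto

lemma coordinate_subspace_point:
  assumes "x \<noteq> 0"
  shows "proj_point x \<in> coordinate_subspace S \<longleftrightarrow> (\<forall>i\<in>S. x $ i = 0)"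
proof -
  have "mvar ` S \<subseteq> (\<Union>k. homog_part k)" using homog_part_mvar by blast
  from proj_point_in_zeros[OF this assms] show ?thesis by (simp add: coordinate_subspace_def)
qed

lemma irreducible_coordinate_subspace:
  assumes "i \<notin> S"
  shows "zariski_irreducible (coordinate_subspace S)"
proof (rule irreducible_by_curves)
  have "proj_point (axis i 1) \<in> coordinate_subspace S"
    using assms by (subst coordinate_subspace_point) (auto simp: axis_def vec_eq_iff)
  then show "coordinate_subspace S \<noteq> {}" by blast
  show "coordinate_subspace S \<subseteq> proj_space"
    unfolding coordinate_subspace_def by (rule proj_zeros_subset_space)
next
  fix u v :: "complex ^ 'a"
  assume "u \<noteq> 0" "v \<noteq> 0" "proj_point u \<in> coordinate_subspace S" "proj_point v \<in> coordinate_subspace S"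
  then have S: "\<forall>i\<in>S. u $ i = 0" "\<forall>i\<in>S. v $ i = 0" by (simp_all add: coordinate_subspace_point)
  define \<gamma> where "\<gamma> i = [:u $ i, v $ i - u $ i:]" for i
  have "curve_at \<gamma> 0 = u" "curve_at \<gamma> 1 = v"
    by (simp_all add: \<gamma>_def curve_at_def vec_eq_iff)
  moreover have "proj_point (curve_at \<gamma> t) \<in> coordinate_subspace S" if "curve_at \<gamma> t \<noteq> 0" for t
    unfolding coordinate_subspace_point[OF that] using S by (simp add: curve_at_def \<gamma>_def)
  ultimately show "\<exists>\<gamma>. curve_at \<gamma> 0 = u \<and> curve_at \<gamma> 1 = v \<and>
      (\<forall>t. curve_at \<gamma> t \<noteq> 0 \<longrightarrow> proj_point (curve_at \<gamma> t) \<in> coordinate_subspace S)"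
    by blast
qed

lemma irreducible_chain_0:
  assumes "zariski_closed W" "zariski_irreducible W"
  shows "irreducible_chain W 0 (\<lambda>_. W)"
  using assms by (simp add: irreducible_chain_def)

lemma irreducible_chain_extend:
  assumes "irreducible_chain X n Z" and "zariski_closed W" "zariski_irreducible W" and "X \<subset> W"
  shows "irreducible_chain W (Suc n) (Z(Suc n := W))"
  using assms unfolding irreducible_chain_def by (auto simp: le_Suc_eq less_Suc_eq)

lemma psubset_by_point:
  assumes "A \<subseteq> B" and "p \<in> B" and "p \<notin> A"
  shows "A \<subset> B"
  using assms by blast

lemma coordinate_subspace_mono:
  assumes "S \<subseteq> T"
  shows "coordinate_subspace T \<subseteq> coordinate_subspace S"
  using assms by (auto simp: coordinate_subspace_def proj_zeros_def)

abbreviation pt5 :: "complex \<Rightarrow> complex \<Rightarrow> complex \<Rightarrow> complex \<Rightarrow> complex \<Rightarrow> complex ^ 5" where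
  "pt5 a b c d e \<equiv> \<chi> i. vec5 a b c d e i"

lemma pt5_eq_0_iff: "pt5 a b c d e = 0 \<longleftrightarrow> a = 0 \<and> b = 0 \<and> c = 0 \<and> d = 0 \<and> e = 0"
  by (simp add: vec5_eq_iff)

lemma subset_by_points:
  assumes "A \<subseteq> proj_space" and "\<And>x. x \<noteq> 0 \<Longrightarrow> proj_point x \<in> A \<Longrightarrow> proj_point x \<in> B"
  shows "A \<subseteq> B"
  using assms by (auto simp: proj_space_eq)

lemma line_in_triple_root_locus: "coordinate_subspace {2, 3, 4} \<subset> triple_root_locus"
proof (rule psubset_by_point)
  show "coordinate_subspace {2, 3, 4} \<subseteq> triple_root_locus"
  proof (rule subset_by_points)
    show "coordinate_subspace {2, 3, 4} \<subseteq> proj_space"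
      using closed_coordinate_subspace by (rule zariski_closed_subset_space)
  qed (auto simp: coordinate_subspace_point triple_root_locus_point quartic_I_def quartic_J_def)
  have "pt5 0 0 0 0 1 \<noteq> 0" by (simp add: pt5_eq_0_iff)
  then show "proj_point (pt5 0 0 0 0 1) \<in> triple_root_locus"
    and "proj_point (pt5 0 0 0 0 1) \<notin> coordinate_subspace {2, 3, 4}"
    by (simp_all add: coordinate_subspace_point triple_root_locus_point quartic_I_def quartic_J_def)
qed

lemma plane_in_hypersurface: "coordinate_subspace {3, 4} \<subset> hypersurface quartic_disc_mpol"
proof (rule psubset_by_point)
  show "coordinate_subspace {3, 4} \<subseteq> hypersurface quartic_disc_mpol"
  proof (rule subset_by_points)
    show "coordinate_subspace {3, 4 :: 5} \<subseteq> proj_space"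
      using closed_coordinate_subspace by (rule zariski_closed_subset_space)
    fix x :: "complex ^ 5" assume x: "x \<noteq> 0" "proj_point x \<in> coordinate_subspace {3, 4}"
    then show "proj_point x \<in> hypersurface quartic_disc_mpol"
      unfolding hypersurface_disc_point[OF x(1)]
      by (simp add: coordinate_subspace_point quartic_disc_def)
  qed
  have 0: "pt5 0 0 0 0 1 \<noteq> 0" by (simp add: pt5_eq_0_iff)
  show "proj_point (pt5 0 0 0 0 1) \<in> hypersurface quartic_disc_mpol"
    unfolding hypersurface_disc_point[OF 0] by (simp add: quartic_disc_def)
  show "proj_point (pt5 0 0 0 0 1) \<notin> coordinate_subspace {3, 4}"
    using 0 by (simp add: coordinate_subspace_point)
qed

lemma chain_point_line:
  "irreducible_chain (coordinate_subspace {2, 3, 4 :: 5}) 1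
     ((\<lambda>_. coordinate_subspace {1, 2, 3, 4})(Suc 0 := coordinate_subspace {2, 3, 4}))"
proof -
  have "coordinate_subspace {1, 2, 3, 4 :: 5} \<subset> coordinate_subspace {2, 3, 4}"
  proof (rule psubset_by_point[OF coordinate_subspace_mono])
    have "pt5 0 1 0 0 0 \<noteq> 0" by (simp add: pt5_eq_0_iff)
    then show "proj_point (pt5 0 1 0 0 0) \<in> coordinate_subspace {2, 3, 4}"
      and "proj_point (pt5 0 1 0 0 0) \<notin> coordinate_subspace {1, 2, 3, 4}"
      by (simp_all add: coordinate_subspace_point)
  qed auto
  from irreducible_chain_extend[OF irreducible_chain_0 _ _ this] show ?thesis
    by (simp add: closed_coordinate_subspace irreducible_coordinate_subspace[of 0])
qed

lemma hypersurface_disc_psubset: "hypersurface quartic_disc_mpol \<subset> proj_space"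
proof (rule psubset_by_point)
  show "hypersurface quartic_disc_mpol \<subseteq> proj_space"
    unfolding hypersurface_def by (rule proj_zeros_subset_space)
  have 0: "pt5 1 0 0 0 1 \<noteq> 0" by (simp add: pt5_eq_0_iff)
  then show "proj_point (pt5 1 0 0 0 1) \<in> proj_space" by (auto simp: proj_space_eq)
  show "proj_point (pt5 1 0 0 0 1) \<notin> hypersurface quartic_disc_mpol"
    unfolding hypersurface_disc_point[OF 0] by (simp add: quartic_disc_def)
qed

lemma proj_space_closed_irreducible:
  "zariski_closed (proj_space :: (complex ^ 'v::finite) set set)"
  "zariski_irreducible (proj_space :: (complex ^ 'v::finite) set set)"
proof -
  have "coordinate_subspace {} = (proj_space :: (complex ^ 'v) set set)"
    by (auto simp: coordinate_subspace_def proj_zeros_def)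
  then show "zariski_closed (proj_space :: (complex ^ 'v) set set)"
    "zariski_irreducible (proj_space :: (complex ^ 'v) set set)"
    using closed_coordinate_subspace[of "{} :: 'v set"] irreducible_coordinate_subspace[of _ "{} :: 'v set"]
    by simp_all
qed

lemma closed_hypersurface_disc: "zariski_closed (hypersurface quartic_disc_mpol)"
  unfolding hypersurface_def using homog_quartic_disc by (intro zariski_closed_zeros) blast

lemma dim_hypersurface_disc: "zariski_dim (hypersurface quartic_disc_mpol) 3"
  unfolding zariski_dim_def
proof (intro conjI allI impI)
  show "zariski_closed (hypersurface quartic_disc_mpol)" by (rule closed_hypersurface_disc)
  have "coordinate_subspace {2, 3, 4 :: 5} \<subset> coordinate_subspace {3, 4}"
  proof (rule psubset_by_point[OF coordinate_subspace_mono])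
    have "pt5 0 0 1 0 0 \<noteq> 0" by (simp add: pt5_eq_0_iff)
    then show "proj_point (pt5 0 0 1 0 0) \<in> coordinate_subspace {3, 4}"
      and "proj_point (pt5 0 0 1 0 0) \<notin> coordinate_subspace {2, 3, 4}"
      by (simp_all add: coordinate_subspace_point)
  qed auto
  from irreducible_chain_extend[OF chain_point_line closed_coordinate_subspace
      irreducible_coordinate_subspace[of 0] this]
  have "\<exists>Z. irreducible_chain (coordinate_subspace {3, 4 :: 5}) (Suc 1) Z" by auto
  then have "\<exists>Z. irreducible_chain (hypersurface quartic_disc_mpol) (Suc (Suc 1)) Z"
    using irreducible_chain_extend[OF _ closed_hypersurface_disc irreducible_hypersurface_disc
        plane_in_hypersurface] by blast
  then show "\<exists>Z. irreducible_chain (hypersurface quartic_disc_mpol) 3 Z" by (simp add: eval_nat_numeral)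
next
  fix n Z assume "irreducible_chain (hypersurface quartic_disc_mpol) n Z"
  from irreducible_chain_length[OF irreducible_chain_extend[OF this proj_space_closed_irreducible
        hypersurface_disc_psubset]]
  show "n \<le> 3" by simp
qed

text \<open>
  The singular locus is a proper subset of the hypersurface, because the gradient is nonzero at
  \<open>y\<^sup>2 (x\<^sup>2 + y\<^sup>2)\<close>, a form with exactly one double root; so chains in it extend twice.
\<close>

lemma dim_singular_locus_disc: "zariski_dim (singular_locus quartic_disc_mpol) 2"
  unfolding zariski_dim_def
proof (intro conjI allI impI)
  have f: "quartic_disc_mpol \<in> homog_part (Suc 5)" using homog_quartic_disc by simp
  show "zariski_closed (singular_locus quartic_disc_mpol)"
    unfolding singular_locus_as_zeros(2)[OF f]
    by (rule zariski_closed_zeros[OF singular_locus_as_zeros(1)[OF f]])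
  have "\<exists>Z. irreducible_chain triple_root_locus (Suc 1) Z"
    using irreducible_chain_extend[OF chain_point_line closed_triple_root_locus
        irreducible_triple_root_locus line_in_triple_root_locus] by blast
  moreover have "triple_root_locus \<subseteq> singular_locus quartic_disc_mpol"
    by (rule subset_by_points[OF zariski_closed_subset_space[OF closed_triple_root_locus]])
      (simp add: triple_root_locus_point singular_locus_if_invariants_vanish)
  ultimately show "\<exists>Z. irreducible_chain (singular_locus quartic_disc_mpol) 2 Z"
    unfolding irreducible_chain_def by (auto simp: eval_nat_numeral)
next
  fix n Z assume chain: "irreducible_chain (singular_locus quartic_disc_mpol) n Z"
  have "singular_locus quartic_disc_mpol \<subset> hypersurface quartic_disc_mpol"
  proof (rule psubset_by_point)
    show "singular_locus quartic_disc_mpol \<subseteq> hypersurface quartic_disc_mpol"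
      by (auto simp: singular_locus_def)
    have 0: "pt5 0 0 1 0 1 \<noteq> 0" by (simp add: pt5_eq_0_iff)
    show "proj_point (pt5 0 0 1 0 1) \<in> hypersurface quartic_disc_mpol"
      unfolding hypersurface_disc_point[OF 0] by (simp add: quartic_disc_def)
    have "27 * mpol_eval (pt5 0 0 1 0 1) (mpol_pderiv 0 quartic_disc_mpol) =
      mpol_eval (pt5 0 0 1 0 1) (27 * mpol_pderiv 0 quartic_disc_mpol)"
      by (simp add: mpol_eval_mult)
    also have "\<dots> \<noteq> 0"
      unfolding pderiv_quartic_disc
      by (simp add: mpol_eval_simps mpol_eval_quartic_I mpol_eval_quartic_J quartic_I_def quartic_J_def
          mpol_pderiv_simps power2_eq_square power3_eq_cube)
    finally have "mpol_eval (pt5 0 0 1 0 1) (mpol_pderiv 0 quartic_disc_mpol) \<noteq> 0" by simp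
    then show "proj_point (pt5 0 0 1 0 1) \<notin> singular_locus quartic_disc_mpol"
      using proj_point_self by (auto simp: singular_locus_def)
  qed
  from irreducible_chain_length[OF irreducible_chain_extend[OF irreducible_chain_extend[OF chain
        closed_hypersurface_disc irreducible_hypersurface_disc this] proj_space_closed_irreducible
        hypersurface_disc_psubset]]
  show "n \<le> 2" by simp
qed

section \<open>Multiplicities\<close>

lemma prod_monom:
  "(\<Prod>i\<in>A. Polynomial.monom (a i) (n i)) = Polynomial.monom (\<Prod>i\<in>A. a i) (\<Sum>i\<in>A. n i)"
  for a :: "'i \<Rightarrow> complex"
  by (induction A rule: infinite_finite_induct) (simp_all add: mult_monom one_poly_eq_simps)

lemma mpol_along_ray:
  "mpol_along (\<lambda>i. Polynomial.monom (v $ i) 1) g = (\<Sum>m\<in>Poly_Mapping.keys g.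
     Polynomial.monom (Poly_Mapping.lookup g m * (\<Prod>i\<in>UNIV. (v $ i) ^ Poly_Mapping.lookup m i)) (mon_deg m))"
  unfolding mpol_along_def mon_deg_def
  by (simp add: monom_power prod_monom smult_monom)

text \<open>
  Restriction to a line can only raise the order.
\<close>

lemma order_at_origin_le:
  fixes g :: "'v::finite mpol"
  assumes p: "\<And>t. mpol_eval (t *s v) g = poly p t" and k: "Polynomial.coeff p k \<noteq> 0"
  shows "order_at_origin g \<le> k"
proof -
  let ?q = "mpol_along (\<lambda>i. Polynomial.monom (v $ i) 1) g"
  have "poly ?q t = poly p t" for t
  proof -
    have "curve_at (\<lambda>i. Polynomial.monom (v $ i) 1) t = t *s v"
      by (simp add: curve_at_def vec_eq_iff poly_monom mult.commute)
    then show ?thesis by (simp add: poly_mpol_along p)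
  qed
  then have "?q = p" using poly_eq_poly_eq_iff by blast
  with k have "Polynomial.coeff ?q k \<noteq> 0" by simp
  then obtain m where "m \<in> Poly_Mapping.keys g" "mon_deg m = k"
    unfolding mpol_along_ray Polynomial.coeff_sum
    by (metis (no_types, lifting) Polynomial.coeff_monom sum.neutral)
  then show ?thesis unfolding order_at_origin_def by (intro Least_le) auto
qed

lemma quartic_disc_swap: "quartic_disc e d c b a = quartic_disc a b c d e"
  unfolding quartic_disc_def by (simp add: algebra_simps)

text \<open>
  The expansion of the discriminant at \<open>e + t\<close> in powers of \<open>t\<close>; as a polynomial in the last
  coefficient the discriminant has degree 3.
\<close>

definition quartic_disc_shift :: "complex \<Rightarrow> complex \<Rightarrow> complex \<Rightarrow> complex \<Rightarrow> complex \<Rightarrow> complex poly" where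
  "quartic_disc_shift a b c d e = (let
       k0 = b^2 * c^2 * d^2 - 4 * a * c^3 * d^2 - 4 * b^3 * d^3 + 18 * a * b * c * d^3 - 27 * a^2 * d^4;
       k1 = - 4 * b^2 * c^3 + 16 * a * c^4 + 18 * b^3 * c * d - 80 * a * b * c^2 * d
            - 6 * a * b^2 * d^2 + 144 * a^2 * c * d^2;
       k2 = - 27 * b^4 + 144 * a * b^2 * c - 128 * a^2 * c^2 - 192 * a^2 * b * d;
       k3 = 256 * a^3
     in [:k0 + k1 * e + k2 * e^2 + k3 * e^3, k1 + 2 * k2 * e + 3 * k3 * e^2, k2 + 3 * k3 * e, k3:])"

lemma poly_quartic_disc_shift:
  "poly (quartic_disc_shift a b c d e) t = quartic_disc a b c d (e + t)"
  unfolding quartic_disc_shift_def quartic_disc_def Let_def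
  by (simp add: algebra_simps eval_nat_numeral)

lemma coeff_quartic_disc_shift:
  "Polynomial.coeff (quartic_disc_shift a b c d e) 3 = 256 * a^3"
  "Polynomial.coeff (quartic_disc_shift 0 b c d e) 2 = - 27 * b^4"
  unfolding quartic_disc_shift_def Let_def by (simp_all add: eval_nat_numeral)

text \<open>
  Coordinate \<open>i\<close> is set to 1 in the chart, so only directions with \<open>v $ i = 0\<close> are available, and along
  these the local equation is the discriminant itself, taken at the normalized point.
\<close>

lemma local_equation_along_ray:
  fixes x v :: "complex ^ 5"
  assumes "x $ i \<noteq> 0" and "v $ i = 0"
  shows "mpol_eval (t *s v) (local_equation quartic_disc_mpol x i) =
    quartic_disc (x $ 0 / x $ i + t * v $ 0) (x $ 1 / x $ i + t * v $ 1) (x $ 2 / x $ i + t * v $ 2)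
      (x $ 3 / x $ i + t * v $ 3) (x $ 4 / x $ i + t * v $ 4)"
proof -
  have "(\<chi> j. mpol_eval (t *s v) (if j = i then 1 else mvar j + mconst (x $ j / x $ i))) $ j =
    x $ j / x $ i + t * v $ j" for j
    using assms by (simp add: mpol_eval_add add.commute)
  then show ?thesis
    unfolding local_equation_def mpol_eval_subst mpol_eval_quartic_disc by simp
qed

text \<open>
  The direction is chosen according to the nonvanishing coordinates of the point: \<open>256 a\<^sup>3\<close> is the
  coefficient of \<open>t\<^sup>3\<close> in the direction of \<open>e\<close>, and \<open>- 27 b\<^sup>4\<close> is that of \<open>t\<^sup>2\<close> when \<open>a = 0\<close>. Reversing
  the form exchanges \<open>a\<close>, \<open>b\<close> with \<open>e\<close>, \<open>d\<close>. There remains the form \<open>x\<^sup>2 y\<^sup>2\<close>.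
\<close>

lemma multiplicity_quartic_disc_le_3:
  fixes x :: "complex ^ 5"
  assumes i: "x $ i \<noteq> 0"
  shows "point_multiplicity quartic_disc_mpol x i \<le> 3"
proof -
  let ?g = "local_equation quartic_disc_mpol x i"
  define y where "y j = x $ j / x $ i" for j
  have yi: "y i = 1" and y0: "y j = 0 \<longleftrightarrow> x $ j = 0" for j using i by (simp_all add: y_def)
  have last: ?thesis if "i \<noteq> 4" "Polynomial.coeff (quartic_disc_shift (y 0) (y 1) (y 2) (y 3) (y 4)) k \<noteq> 0"
    "k \<le> 3" for k
  proof -
    have v: "(axis 4 1 :: complex ^ 5) $ i = 0" using that by (simp add: axis_def)
    have "mpol_eval (t *s axis 4 1) ?g = poly (quartic_disc_shift (y 0) (y 1) (y 2) (y 3) (y 4)) t" for t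
      unfolding local_equation_along_ray[OF i v] poly_quartic_disc_shift
      by (simp add: axis_def y_def)
    from order_at_origin_le[OF this that(2)] that(3) show ?thesis
      by (simp add: point_multiplicity_def)
  qed
  have first: ?thesis if "i \<noteq> 0" "Polynomial.coeff (quartic_disc_shift (y 4) (y 3) (y 2) (y 1) (y 0)) k \<noteq> 0"
    "k \<le> 3" for k
  proof -
    have v: "(axis 0 1 :: complex ^ 5) $ i = 0" using that by (simp add: axis_def)
    have "mpol_eval (t *s axis 0 1) ?g = poly (quartic_disc_shift (y 4) (y 3) (y 2) (y 1) (y 0)) t" for t
      unfolding local_equation_along_ray[OF i v] poly_quartic_disc_shift
      by (subst quartic_disc_swap) (simp add: axis_def y_def)
    from order_at_origin_le[OF this that(2)] that(3) show ?thesis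
      by (simp add: point_multiplicity_def)
  qed
  consider (a) "y 0 \<noteq> 0" "i \<noteq> 4" | (e) "y 4 \<noteq> 0" "i \<noteq> 0"
    | (b) "y 0 = 0" "y 4 = 0" "y 1 \<noteq> 0" | (d) "y 0 = 0" "y 4 = 0" "y 3 \<noteq> 0"
    | (c) "y 0 = 0" "y 4 = 0" "y 1 = 0" "y 3 = 0"
    using yi by fastforce
  then show ?thesis
  proof cases
    case a
    then show ?thesis by (intro last[of 3]) (simp_all add: coeff_quartic_disc_shift)
  next
    case e
    then show ?thesis by (intro first[of 3]) (simp_all add: coeff_quartic_disc_shift)
  next
    case b
    moreover from this yi have "i \<noteq> 4" by auto
    ultimately show ?thesis by (intro last[of 2]) (simp_all add: coeff_quartic_disc_shift)
  next
    case d
    moreover from this yi have "i \<noteq> 0" by auto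
    ultimately show ?thesis by (intro first[of 2]) (simp_all add: coeff_quartic_disc_shift)
  next
    case c
    let ?v = "(\<chi> j. vec5 1 0 0 0 1 j) :: complex ^ 5"
    have "i \<noteq> 0" "i \<noteq> 1" "i \<noteq> 3" "i \<noteq> 4" using c yi by auto
    moreover have "\<forall>i::5. i = 0 \<or> i = 1 \<or> i = 2 \<or> i = 3 \<or> i = 4" by (subst forall_5) simp
    ultimately have i2: "i = 2" by blast
    then have v: "?v $ i = 0" by simp
    have "mpol_eval (t *s ?v) ?g = poly [:0, 0, 16, 0, - 128, 0, 256:] t" for t
      unfolding local_equation_along_ray[OF i v] y_def[symmetric] using c yi
      by (simp add: i2 quartic_disc_def algebra_simps eval_nat_numeral)
    from order_at_origin_le[OF this, of 2] show ?thesis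
      by (simp add: point_multiplicity_def eval_nat_numeral)
  qed
qed

section \<open>Leading monomials and divisibility\<close>

text \<open>
  A monomial order is presented by an additive injection of the exponents into a well-order, so that
  weighted orders are obtained by writing down a key.
\<close>

locale monomial_order =
  fixes key :: "('v::finite \<Rightarrow>\<^sub>0 nat) \<Rightarrow> 'o::wellorder"
  assumes key_inj: "key m = key n \<Longrightarrow> m = n"
    and key_add_mono: "key m < key n \<Longrightarrow> key (m + l) < key (n + l)"
begin

definition leads :: "'v mpol \<Rightarrow> ('v \<Rightarrow>\<^sub>0 nat) \<Rightarrow> bool" where
  "leads p m \<longleftrightarrow> m \<in> Poly_Mapping.keys p \<and> (\<forall>n\<in>Poly_Mapping.keys p. n \<noteq> m \<longrightarrow> key n < key m)"

lemma leads_exists: "p \<noteq> 0 \<Longrightarrow> \<exists>m. leads p m"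
proof -
  assume "p \<noteq> 0"
  then have "key ` Poly_Mapping.keys p \<noteq> {}" by auto
  then have "Max (key ` Poly_Mapping.keys p) \<in> key ` Poly_Mapping.keys p" by (intro Max_in) auto
  then obtain m where m: "m \<in> Poly_Mapping.keys p" "key m = Max (key ` Poly_Mapping.keys p)" by auto
  have "key n < key m" if "n \<in> Poly_Mapping.keys p" "n \<noteq> m" for n
    using that m key_inj[of n m] by (auto simp: order.strict_iff_order)
  with m show ?thesis unfolding leads_def by blast
qed

lemma leads_unique: "leads p m \<Longrightarrow> leads p n \<Longrightarrow> m = n"
  unfolding leads_def by (metis less_asym)

lemma leads_nonzero: "leads p m \<Longrightarrow> p \<noteq> 0"
  by (auto simp: leads_def)

lemma leads_keys_le: "leads p m \<Longrightarrow> n \<in> Poly_Mapping.keys p \<Longrightarrow> key n \<le> key m"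
  unfolding leads_def by (metis order.order_iff_strict)

lemma key_add_le: "key m \<le> key n \<Longrightarrow> key (m + l) \<le> key (n + l)"
  using key_add_mono[of m n l] key_inj[of m n] by (auto simp: order.order_iff_strict)

lemma key_add_less:
  assumes "key a \<le> key m" and "key b \<le> key n" and "a \<noteq> m \<or> b \<noteq> n"
  shows "key (a + b) < key (m + n)"
proof (cases "a = m")
  case True
  then have "key b < key n" using assms key_inj[of b n] by (auto simp: order.order_iff_strict)
  from key_add_mono[OF this, of m] True show ?thesis by (simp add: add.commute)
next
  case False
  then have "key a < key m" using assms key_inj[of a m] by (auto simp: order.order_iff_strict)
  from key_add_mono[OF this, of b] key_add_le[OF assms(2), of m] show ?thesis
    by (simp add: add.commute)
qed

lemma leads_mult:
  assumes p: "leads p m" and q: "leads q n"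
  shows "leads (p * q) (m + n)"
    and "Poly_Mapping.lookup (p * q) (m + n) = Poly_Mapping.lookup p m * Poly_Mapping.lookup q n"
proof -
  have other: "a + b \<noteq> m + n" if "a \<in> Poly_Mapping.keys p" "b \<in> Poly_Mapping.keys q" "a \<noteq> m \<or> b \<noteq> n" for a b
    using key_add_less[OF leads_keys_le[OF p that(1)] leads_keys_le[OF q that(2)] that(3)] by auto
  define P Q where "P = Poly_Mapping.single m (Poly_Mapping.lookup p m)"
    and "Q = Poly_Mapping.single n (Poly_Mapping.lookup q n)"
  have keys_p: "Poly_Mapping.keys (p - P) \<subseteq> Poly_Mapping.keys p - {m}"
    and keys_q: "Poly_Mapping.keys (q - Q) \<subseteq> Poly_Mapping.keys q - {n}"
    by (auto simp: P_def Q_def in_keys_iff lookup_minus lookup_single when_def split: if_splits)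
  have P: "Poly_Mapping.keys P \<subseteq> {m}" by (simp add: P_def)
  have "p * q = P * Q + P * (q - Q) + (p - P) * q" by (simp add: algebra_simps)
  moreover have "m + n \<notin> Poly_Mapping.keys (P * (q - Q))"
    using keys_mult[of P "q - Q"] P keys_q other p[unfolded leads_def] by fastforce
  moreover have "m + n \<notin> Poly_Mapping.keys ((p - P) * q)"
    using keys_mult[of "p - P" q] keys_p other by fastforce
  ultimately show coeff: "Poly_Mapping.lookup (p * q) (m + n) =
      Poly_Mapping.lookup p m * Poly_Mapping.lookup q n"
    by (simp add: in_keys_iff lookup_add P_def Q_def mult_single)
  have "key l < key (m + n)" if "l \<in> Poly_Mapping.keys (p * q)" "l \<noteq> m + n" for l
  proof -
    have "l \<in> {a + b | a b. a \<in> Poly_Mapping.keys p \<and> b \<in> Poly_Mapping.keys q}"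
      by (rule subsetD[OF keys_mult that(1)])
    then obtain a b where ab: "a \<in> Poly_Mapping.keys p" "b \<in> Poly_Mapping.keys q" "l = a + b"
      by blast
    with that(2) have "a \<noteq> m \<or> b \<noteq> n" by auto
    from key_add_less[OF leads_keys_le[OF p ab(1)] leads_keys_le[OF q ab(2)] this] ab(3)
    show ?thesis by simp
  qed
  with coeff p q show "leads (p * q) (m + n)"
    by (auto simp: leads_def in_keys_iff)
qed

lemma leads_mvar: "leads (mvar i) (Poly_Mapping.single i 1)"
  by (simp add: leads_def mvar_def)

lemma leads_numeral: "leads (numeral k) 0"
  by (auto simp: leads_def in_keys_iff lookup_numeral when_def)

lemma leads_square: "leads p m \<Longrightarrow> leads (p ^ 2) (m + m)"
  unfolding power2_eq_square by (rule leads_mult(1))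

lemma leads_cube: "leads p m \<Longrightarrow> leads (p ^ 3) (m + m + m)"
  unfolding power3_eq_cube by (intro leads_mult(1))

lemma leads_uminus: "leads p m \<Longrightarrow> leads (- p) m"
  by (simp add: leads_def)

lemma leads_add_left:
  assumes "leads p m" and "leads q n" and "key n < key m"
  shows "leads (p + q) m"
proof -
  have q: "key l < key m" if "l \<in> Poly_Mapping.keys q" for l
    using leads_keys_le[OF assms(2) that] assms(3) by simp
  then have "m \<notin> Poly_Mapping.keys q" by blast
  then have "m \<in> Poly_Mapping.keys (p + q)"
    using assms(1) by (simp add: leads_def in_keys_iff lookup_add)
  moreover have "key l < key m" if "l \<in> Poly_Mapping.keys (p + q)" "l \<noteq> m" for l
    using that keys_add[of p q] q assms(1) unfolding leads_def by blast
  ultimately show ?thesis unfolding leads_def by blast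
qed

lemma leads_add_right: "leads p m \<Longrightarrow> leads q n \<Longrightarrow> key m < key n \<Longrightarrow> leads (p + q) n"
  using leads_add_left[of q n p m] by (simp add: add.commute)

lemma leads_diff_left: "leads p m \<Longrightarrow> leads q n \<Longrightarrow> key n < key m \<Longrightarrow> leads (p - q) m"
  using leads_add_left[OF _ leads_uminus] by fastforce

lemma leads_diff_right: "leads p m \<Longrightarrow> leads q n \<Longrightarrow> key m < key n \<Longrightarrow> leads (p - q) n"
  using leads_add_right[OF _ leads_uminus] by fastforce

text \<open>
  A substitute for unique factorization: polynomials \<open>p\<close> whose leading monomials have no common
  variable may be cancelled from \<open>x dvd y * p\<close>. Comparing leading monomials, each variable occurs in
  that of \<open>x\<close> at most as often as in that of \<open>y\<close>. Hence one step of division replaces \<open>y\<close> by a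
  polynomial with a smaller leading monomial and the same property.
\<close>

lemma dvd_if_dvd_mult_coprime_leads:
  assumes x: "x \<noteq> 0" and "\<And>i. \<exists>p m. x dvd y * p \<and> leads p m \<and> Poly_Mapping.lookup m i = 0"
  shows "x dvd y"
proof -
  obtain a where a: "leads x a" using leads_exists[OF x] by blast
  have "x dvd y" if "leads y n" and "key n = k"
    and "\<And>i. \<exists>p m. x dvd y * p \<and> leads p m \<and> Poly_Mapping.lookup m i = 0" for k y n
    using that
  proof (induction k arbitrary: y n rule: less_induct)
    case (less k)
    have le: "Poly_Mapping.lookup a i \<le> Poly_Mapping.lookup n i" for i
    proof -
      obtain p m z where p: "y * p = x * z" "leads p m" "Poly_Mapping.lookup m i = 0"
        using less.prems(3)[of i] unfolding dvd_def by blast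
      have yp: "leads (x * z) (n + m)" using leads_mult(1)[OF less.prems(1) p(2)] p(1) by simp
      then have "z \<noteq> 0" using leads_nonzero by fastforce
      then obtain l where "leads z l" using leads_exists by blast
      from leads_unique[OF yp leads_mult(1)[OF a this]]
      have "Poly_Mapping.lookup (n + m) i = Poly_Mapping.lookup (a + l) i" by simp
      with p(3) show ?thesis by (simp add: lookup_add)
    qed
    define t where "t = n - a"
    have n: "n = t + a"
      by (intro poly_mapping_eqI) (simp add: t_def lookup_add lookup_minus le)
    define c where "c = Poly_Mapping.lookup y n / Poly_Mapping.lookup x a"
    have xa: "Poly_Mapping.lookup x a \<noteq> 0" and yn: "Poly_Mapping.lookup y n \<noteq> 0"
      using a less.prems(1) by (simp_all add: leads_def in_keys_iff)
    let ?T = "Poly_Mapping.single t c :: 'v mpol"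
    have T: "leads ?T t" using xa yn by (simp add: leads_def c_def)
    define y' where "y' = y - ?T * x"
    have "x dvd y'"
    proof (cases "y' = 0")
      case False
      then obtain n' where n': "leads y' n'" using leads_exists by blast
      have "Poly_Mapping.lookup y' n = 0"
        unfolding y'_def lookup_minus n leads_mult(2)[OF T a]
        using xa n by (simp add: c_def)
      then have "n' \<noteq> n" using n' by (auto simp: leads_def in_keys_iff)
      moreover have "key n' \<le> key n"
      proof -
        have "n' \<in> Poly_Mapping.keys y \<or> n' \<in> Poly_Mapping.keys (?T * x)"
          using n' keys_diff[of y "?T * x"] unfolding leads_def y'_def
          by (auto simp: in_keys_iff lookup_minus)
        then show ?thesis
          using leads_keys_le[OF less.prems(1)] leads_keys_le[OF leads_mult(1)[OF T a]] n by auto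
      qed
      ultimately have "key n' < key n" using key_inj by (auto simp: order.order_iff_strict)
      moreover have "\<exists>p m. x dvd y' * p \<and> leads p m \<and> Poly_Mapping.lookup m i = 0" for i
      proof -
        obtain p m where p: "x dvd y * p" "leads p m" "Poly_Mapping.lookup m i = 0"
          using less.prems(3) by blast
        have "y' * p = y * p - x * (?T * p)" by (simp add: y'_def algebra_simps)
        then have "x dvd y' * p" using p(1) by simp
        with p show ?thesis by blast
      qed
      ultimately show ?thesis using less.IH[OF _ n' refl] less.prems(2) by blast
    qed simp
    moreover have "y = y' + x * ?T" by (simp add: y'_def algebra_simps)
    ultimately show ?case by simp
  qed
  then show ?thesis
    using assms(2) leads_exists[of y] by (cases "y = 0") auto
qed

end

text \<open>
  The weights 3, 0, 2, 3, 0 are chosen to make \<open>c\<^sup>2\<close>, \<open>a d\<^sup>2\<close>, \<open>d\<^sup>3\<close> and \<open>a c\<^sup>2\<close> the leading monomials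
  of \<open>I\<close>, \<open>J\<close> and of the two minors below, so that the members of each pair have no common variable.
  The other entries of the key break ties; the exponent of \<open>d\<close> is determined by the weight and the rest.
\<close>

definition weighted_key :: "(5 \<Rightarrow>\<^sub>0 nat) \<Rightarrow> nat \<times> nat \<times> nat \<times> nat \<times> nat" where
  "weighted_key m =
     (3 * Poly_Mapping.lookup m 0 + 2 * Poly_Mapping.lookup m 2 + 3 * Poly_Mapping.lookup m 3,
      Poly_Mapping.lookup m 0, Poly_Mapping.lookup m 1, Poly_Mapping.lookup m 2, Poly_Mapping.lookup m 4)"

interpretation weighted: monomial_order weighted_key
proof
  fix m n l :: "5 \<Rightarrow>\<^sub>0 nat"
  show "m = n" if "weighted_key m = weighted_key n"
  proof (rule poly_mapping_eqI)
    have "\<forall>i. Poly_Mapping.lookup m i = Poly_Mapping.lookup n i"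
      by (subst forall_5) (use that in \<open>auto simp: weighted_key_def\<close>)
    then show "Poly_Mapping.lookup m i = Poly_Mapping.lookup n i" for i by blast
  qed
  show "weighted_key (m + l) < weighted_key (n + l)" if "weighted_key m < weighted_key n"
    using that by (auto simp: weighted_key_def lookup_add)
qed

abbreviation (input) X :: "5 \<Rightarrow> 5 mpol" where "X \<equiv> mvar"

text \<open>
  Up to constant factors, these are the minors of the Jacobian matrix of \<open>(I, J)\<close> for the variables
  with the two given indices. They are also, exactly, the complementary maximal minors of the matrix
  of the three linear fields below, in the columns 2, 3, 4 and 0, 1, 3.
\<close>

definition minor_10 :: "5 mpol" where
  "minor_10 = 24 * X 1 * X 4 ^ 2 - 12 * X 2 * X 3 * X 4 + 3 * X 3 ^ 3"

definition minor_42 :: "5 mpol" where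
  "minor_42 = 8 * X 0 * X 2 ^ 2 - 4 * X 0 * X 1 * X 3 - 32 * X 0 ^ 2 * X 4 - 2 * X 1 ^ 2 * X 2"

lemmas leads_intros = weighted.leads_mult(1) weighted.leads_numeral weighted.leads_mvar
  weighted.leads_square weighted.leads_cube

lemma lookup_singles: "Poly_Mapping.lookup (Poly_Mapping.single (i::5) n) j = (if i = j then n else (0::nat))"
  by (simp add: lookup_single when_def)

lemma leads_quartic_I: "\<exists>m. weighted.leads quartic_I_mpol m \<and> (\<forall>i. i \<noteq> 2 \<longrightarrow> Poly_Mapping.lookup m i = 0)"
proof -
  have "weighted.leads (12 * X 0 * X 4 - 3 * X 1 * X 3 + X 2 ^ 2)
    (Poly_Mapping.single 2 1 + Poly_Mapping.single 2 1)"
    by (rule weighted.leads_add_right[OF weighted.leads_diff_left])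
      (rule leads_intros | simp add: weighted_key_def lookup_add lookup_singles)+
  then show ?thesis
    unfolding quartic_I_def by - (rule exI, rule conjI, assumption, simp add: lookup_add lookup_singles)
qed

lemma leads_quartic_J:
  "\<exists>m. weighted.leads quartic_J_mpol m \<and> (\<forall>i. i \<noteq> 0 \<longrightarrow> i \<noteq> 3 \<longrightarrow> Poly_Mapping.lookup m i = 0)"
proof -
  have "weighted.leads (72 * X 0 * X 2 * X 4 + 9 * X 1 * X 2 * X 3 - 27 * X 0 * X 3 ^ 2
      - 27 * X 1 ^ 2 * X 4 - 2 * X 2 ^ 3)
    (0 + Poly_Mapping.single 0 1 + (Poly_Mapping.single 3 1 + Poly_Mapping.single 3 1))"
    by (rule weighted.leads_diff_left[OF weighted.leads_diff_left[OF weighted.leads_diff_right[OF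
        weighted.leads_add_left]]])
      (rule leads_intros | simp add: weighted_key_def lookup_add lookup_singles)+
  then show ?thesis
    unfolding quartic_J_def by - (rule exI, rule conjI, assumption, simp add: lookup_add lookup_singles)
qed

lemma leads_minor_10: "\<exists>m. weighted.leads minor_10 m \<and> (\<forall>i. i \<noteq> 3 \<longrightarrow> Poly_Mapping.lookup m i = 0)"
proof -
  have "weighted.leads minor_10
    (0 + (Poly_Mapping.single 3 1 + Poly_Mapping.single 3 1 + Poly_Mapping.single 3 1))"
    unfolding minor_10_def
    by (rule weighted.leads_add_right[OF weighted.leads_diff_right])
      (rule leads_intros | simp add: weighted_key_def lookup_add lookup_singles)+
  then show ?thesis by - (rule exI, rule conjI, assumption, simp add: lookup_add lookup_singles)
qed

lemma leads_minor_42: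
  "\<exists>m. weighted.leads minor_42 m \<and> (\<forall>i. i \<noteq> 0 \<longrightarrow> i \<noteq> 2 \<longrightarrow> Poly_Mapping.lookup m i = 0)"
proof -
  have "weighted.leads minor_42
    (0 + Poly_Mapping.single 0 1 + (Poly_Mapping.single 2 1 + Poly_Mapping.single 2 1))"
    unfolding minor_42_def
    by (rule weighted.leads_diff_left[OF weighted.leads_diff_left[OF weighted.leads_diff_left]])
      (rule leads_intros | simp add: weighted_key_def lookup_add lookup_singles)+
  then show ?thesis by - (rule exI, rule conjI, assumption, simp add: lookup_add lookup_singles)
qed

section \<open>Vector fields that annihilate the discriminant\<close>

definition apply_field :: "('v mpol) ^ 'v \<Rightarrow> 'v mpol \<Rightarrow> 'v::finite mpol" where
  "apply_field v f = (\<Sum>i\<in>UNIV. v $ i * mpol_pderiv i f)"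

text \<open>
  The first three fields are the action of \<open>x \<partial>/\<partial>y\<close>, of \<open>y \<partial>/\<partial>x\<close> and of half of \<open>x \<partial>/\<partial>x - y \<partial>/\<partial>y\<close> on
  the coefficients of the form. The last field is one third of the Hessian determinant of the form, which
  is again a quartic. The index 4 is the element 0 of its type.
\<close>

definition logarithmic_field :: "4 \<Rightarrow> 5 mpol ^ 5" where
  "logarithmic_field j = (\<chi> i.
     if j = 1 then vec5 (X 1) (2 * X 2) (3 * X 3) (4 * X 4) 0 i
     else if j = 2 then vec5 0 (4 * X 0) (3 * X 1) (2 * X 2) (X 3) i
     else if j = 3 then vec5 (2 * X 0) (X 1) 0 (- X 3) (- 2 * X 4) i
     else vec5 (8 * X 0 * X 2 - 3 * X 1 ^ 2) (24 * X 0 * X 3 - 4 * X 1 * X 2)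
       (48 * X 0 * X 4 + 6 * X 1 * X 3 - 4 * X 2 ^ 2) (24 * X 1 * X 4 - 4 * X 2 * X 3)
       (8 * X 2 * X 4 - 3 * X 3 ^ 2) i)"

lemma pderiv_quartic_I:
  "mpol_pderiv 0 quartic_I_mpol = 12 * X 4" "mpol_pderiv 1 quartic_I_mpol = - 3 * X 3"
  "mpol_pderiv 2 quartic_I_mpol = 2 * X 2" "mpol_pderiv 3 quartic_I_mpol = - 3 * X 1"
  "mpol_pderiv 4 quartic_I_mpol = 12 * X 0"
  unfolding quartic_I_def by (simp_all add: mpol_pderiv_simps power2_eq_square)

lemma pderiv_quartic_J:
  "mpol_pderiv 0 quartic_J_mpol = 72 * X 2 * X 4 - 27 * X 3 ^ 2"
  "mpol_pderiv 1 quartic_J_mpol = 9 * X 2 * X 3 - 54 * X 1 * X 4"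
  "mpol_pderiv 2 quartic_J_mpol = 72 * X 0 * X 4 + 9 * X 1 * X 3 - 6 * X 2 ^ 2"
  "mpol_pderiv 3 quartic_J_mpol = 9 * X 1 * X 2 - 54 * X 0 * X 3"
  "mpol_pderiv 4 quartic_J_mpol = 72 * X 0 * X 2 - 27 * X 1 ^ 2"
  unfolding quartic_J_def by (simp_all add: mpol_pderiv_simps power2_eq_square power3_eq_cube)

lemma apply_field_I:
  "apply_field v quartic_I_mpol = v $ 0 * (12 * X 4) + v $ 1 * (- 3 * X 3) + v $ 2 * (2 * X 2)
    + v $ 3 * (- 3 * X 1) + v $ 4 * (12 * X 0)"
  unfolding apply_field_def sum_5 pderiv_quartic_I ..

lemma apply_field_J:
  "apply_field v quartic_J_mpol = v $ 0 * (72 * X 2 * X 4 - 27 * X 3 ^ 2)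
    + v $ 1 * (9 * X 2 * X 3 - 54 * X 1 * X 4) + v $ 2 * (72 * X 0 * X 4 + 9 * X 1 * X 3 - 6 * X 2 ^ 2)
    + v $ 3 * (9 * X 1 * X 2 - 54 * X 0 * X 3) + v $ 4 * (72 * X 0 * X 2 - 27 * X 1 ^ 2)"
  unfolding apply_field_def sum_5 pderiv_quartic_J ..

lemma apply_field_disc:
  "27 * apply_field v quartic_disc_mpol =
    12 * quartic_I_mpol ^ 2 * apply_field v quartic_I_mpol
    - 2 * quartic_J_mpol * apply_field v quartic_J_mpol"
proof -
  have "27 * apply_field v quartic_disc_mpol =
    (\<Sum>i\<in>UNIV. v $ i * (27 * mpol_pderiv i quartic_disc_mpol))"
    by (simp add: apply_field_def sum_distrib_left mult.left_commute)
  then show ?thesis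
    unfolding pderiv_quartic_disc
    by (simp add: apply_field_def right_diff_distrib sum_subtractf sum_distrib_left mult_ac)
qed

lemma apply_field_diff: "apply_field (v - w) f = apply_field v f - apply_field w f"
  by (simp add: apply_field_def left_diff_distrib sum_subtractf)

lemma apply_field_add: "apply_field (v + w) f = apply_field v f + apply_field w f"
  by (simp add: apply_field_def distrib_right sum.distrib)

lemma apply_field_scale: "apply_field (p *s v) f = p * apply_field v f"
  by (simp add: apply_field_def sum_distrib_left mult.assoc)

text \<open>
  The linear fields annihilate the invariants of \<open>SL\<^sub>2\<close>; the derivative of an invariant along the
  Hessian covariant is an invariant again.
\<close>

lemma logarithmic_fields_on_invariants:
  "apply_field (logarithmic_field 1) quartic_I_mpol = 0"
  "apply_field (logarithmic_field 2) quartic_I_mpol = 0"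
  "apply_field (logarithmic_field 3) quartic_I_mpol = 0"
  "apply_field (logarithmic_field 4) quartic_I_mpol = 4 * quartic_J_mpol"
  "apply_field (logarithmic_field 1) quartic_J_mpol = 0"
  "apply_field (logarithmic_field 2) quartic_J_mpol = 0"
  "apply_field (logarithmic_field 3) quartic_J_mpol = 0"
  "apply_field (logarithmic_field 4) quartic_J_mpol = 24 * quartic_I_mpol ^ 2"
  unfolding apply_field_I apply_field_J unfolding quartic_I_def quartic_J_def
  by (simp_all add: logarithmic_field_def algebra_simps eval_nat_numeral)

lemma logarithmic_field_annihilates_disc: "apply_field (logarithmic_field j) quartic_disc_mpol = 0"
proof -
  have "\<forall>j::4. 27 * apply_field (logarithmic_field j) quartic_disc_mpol = 0"
    unfolding forall_4 apply_field_disc logarithmic_fields_on_invariants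
    by (simp add: algebra_simps)
  then show ?thesis by simp
qed

text \<open>
  Each equation of a pair of linear equations in two unknowns is multiplied by an entry of the adjugate
  matrix. It is applied to the two remaining components of a vector field that annihilates \<open>I\<close> and \<open>J\<close>.
\<close>

lemma two_equations_zero:
  fixes x y p q r s m :: "5 mpol"
  assumes "x * p + y * q = 0" and "x * r + y * s = 0" and "p * s - q * r = m" and "m \<noteq> 0"
  shows "x = 0" and "y = 0"
proof -
  have "x * m = s * (x * p + y * q) - q * (x * r + y * s)"
    unfolding assms(3)[symmetric] by (simp add: algebra_simps)
  also have "\<dots> = 0" using assms by simp
  finally show "x = 0" using assms(4) by simp
  have "y * m = p * (x * r + y * s) - r * (x * p + y * q)"
    unfolding assms(3)[symmetric] by (simp add: algebra_simps)
  also have "\<dots> = 0" using assms by simp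
  finally show "y = 0" using assms(4) by simp
qed

lemma minor_10_nonzero: "minor_10 \<noteq> 0"
  using leads_minor_10 weighted.leads_nonzero by blast

lemma minor_42_nonzero: "minor_42 \<noteq> 0"
  using leads_minor_42 weighted.leads_nonzero by blast

lemma field_with_two_components:
  assumes I: "apply_field r quartic_I_mpol = 0" and J: "apply_field r quartic_J_mpol = 0"
  shows "r $ 2 = 0 \<Longrightarrow> r $ 3 = 0 \<Longrightarrow> r $ 4 = 0 \<Longrightarrow> r = 0"
    and "r $ 0 = 0 \<Longrightarrow> r $ 1 = 0 \<Longrightarrow> r $ 3 = 0 \<Longrightarrow> r = 0"
proof -
  assume r: "r $ 2 = 0" "r $ 3 = 0" "r $ 4 = 0"
  have "r $ 0 * (12 * X 4) + r $ 1 * (- 3 * X 3) = 0"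
    "r $ 0 * (72 * X 2 * X 4 - 27 * X 3 ^ 2) + r $ 1 * (9 * X 2 * X 3 - 54 * X 1 * X 4) = 0"
    using I J r unfolding apply_field_I apply_field_J by simp_all
  moreover have "12 * X 4 * (9 * X 2 * X 3 - 54 * X 1 * X 4) - (- 3 * X 3) * (72 * X 2 * X 4 - 27 * X 3 ^ 2)
    = - 27 * minor_10"
    by (simp add: minor_10_def algebra_simps eval_nat_numeral)
  moreover have "- 27 * minor_10 \<noteq> 0" using minor_10_nonzero by simp
  ultimately have "r $ 0 = 0" "r $ 1 = 0" by (rule two_equations_zero)+
  with r show "r = 0" unfolding vec_eq_iff by (subst forall_5) simp
next
  assume r: "r $ 0 = 0" "r $ 1 = 0" "r $ 3 = 0"
  have "r $ 2 * (2 * X 2) + r $ 4 * (12 * X 0) = 0"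
    "r $ 2 * (72 * X 0 * X 4 + 9 * X 1 * X 3 - 6 * X 2 ^ 2) + r $ 4 * (72 * X 0 * X 2 - 27 * X 1 ^ 2) = 0"
    using I J r unfolding apply_field_I apply_field_J by simp_all
  moreover have "2 * X 2 * (72 * X 0 * X 2 - 27 * X 1 ^ 2)
      - 12 * X 0 * (72 * X 0 * X 4 + 9 * X 1 * X 3 - 6 * X 2 ^ 2) = 27 * minor_42"
    by (simp add: minor_42_def algebra_simps eval_nat_numeral)
  moreover have "27 * minor_42 \<noteq> 0" using minor_42_nonzero by simp
  ultimately have "r $ 2 = 0" "r $ 4 = 0" by (rule two_equations_zero)+
  with r show "r = 0" unfolding vec_eq_iff by (subst forall_5) simp
qed

abbreviation sl2_combination :: "5 mpol \<Rightarrow> 5 mpol \<Rightarrow> 5 mpol \<Rightarrow> 5 mpol ^ 5" where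
  "sl2_combination p q r \<equiv>
     p *s logarithmic_field 1 + q *s logarithmic_field 2 + r *s logarithmic_field 3"

lemma sl2_combination_on_invariants:
  "apply_field (sl2_combination p q r) quartic_I_mpol = 0"
  "apply_field (sl2_combination p q r) quartic_J_mpol = 0"
  by (simp_all add: apply_field_add apply_field_scale logarithmic_fields_on_invariants)

lemma sl2_combination_nth:
  "sl2_combination p q r $ 0 = p * X 1 + r * (2 * X 0)"
  "sl2_combination p q r $ 1 = p * (2 * X 2) + q * (4 * X 0) + r * X 1"
  "sl2_combination p q r $ 2 = p * (3 * X 3) + q * (3 * X 1)"
  "sl2_combination p q r $ 3 = p * (4 * X 4) + q * (2 * X 2) - r * X 3"
  "sl2_combination p q r $ 4 = q * X 3 - r * (2 * X 4)"
  by (simp_all add: logarithmic_field_def)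


text \<open>
  The coefficients \<open>p\<close>, \<open>q\<close>, \<open>r\<close> are given by the cofactors of the columns 2, 3, 4 of the three linear
  fields, so both sides agree in these columns. Their difference annihilates \<open>I\<close> and \<open>J\<close> and
  has only two components left.
\<close>

lemma cramer_10:
  assumes "apply_field u quartic_I_mpol = 0" and "apply_field u quartic_J_mpol = 0"
  shows "\<exists>p q r. minor_10 *s u = sl2_combination p q r"
proof -
  define p q r where
    "p = u $ 2 * (X 3 ^ 2 - 4 * X 2 * X 4) + u $ 3 * (6 * X 1 * X 4) - u $ 4 * (3 * X 1 * X 3)" and
    "q = u $ 2 * (8 * X 4 ^ 2) - u $ 3 * (6 * X 3 * X 4) + u $ 4 * (3 * X 3 ^ 2)" and
    "r = u $ 2 * (4 * X 3 * X 4) - u $ 3 * (3 * X 3 ^ 2) + u $ 4 * (6 * X 2 * X 3 - 12 * X 1 * X 4)"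
  have "minor_10 *s u - sl2_combination p q r = 0"
  proof (rule field_with_two_components(1))
    show "apply_field (minor_10 *s u - sl2_combination p q r) quartic_I_mpol = 0"
      and "apply_field (minor_10 *s u - sl2_combination p q r) quartic_J_mpol = 0"
      unfolding apply_field_diff sl2_combination_on_invariants apply_field_scale
      by (simp_all add: assms)
    show "(minor_10 *s u - sl2_combination p q r) $ 2 = 0"
      and "(minor_10 *s u - sl2_combination p q r) $ 3 = 0"
      and "(minor_10 *s u - sl2_combination p q r) $ 4 = 0"
      unfolding vector_minus_component vector_smult_component sl2_combination_nth
      by (simp_all add: minor_10_def p_def q_def r_def algebra_simps eval_nat_numeral)
  qed
  then show ?thesis by auto
qed

text \<open>
  The same with the cofactors of the columns 0, 1, 3.
\<close>

lemma cramer_42: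
  assumes "apply_field u quartic_I_mpol = 0" and "apply_field u quartic_J_mpol = 0"
  shows "\<exists>p q r. minor_42 *s u = sl2_combination p q r"
proof -
  define p q r where
    "p = u $ 1 * (4 * X 0 * X 2) - u $ 0 * (4 * X 0 * X 3 + 2 * X 1 * X 2) - u $ 3 * (8 * X 0 ^ 2)" and
    "q = u $ 0 * (4 * X 1 * X 4 + 2 * X 2 * X 3) - u $ 1 * (8 * X 0 * X 4 + X 1 * X 3)
      + u $ 3 * (4 * X 0 * X 2 - X 1 ^ 2)" and
    "r = u $ 0 * (4 * X 2 ^ 2 - 16 * X 0 * X 4) - u $ 1 * (2 * X 1 * X 2) + u $ 3 * (4 * X 0 * X 1)"
  have "minor_42 *s u - sl2_combination p q r = 0"
  proof (rule field_with_two_components(2))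
    show "apply_field (minor_42 *s u - sl2_combination p q r) quartic_I_mpol = 0"
      and "apply_field (minor_42 *s u - sl2_combination p q r) quartic_J_mpol = 0"
      unfolding apply_field_diff sl2_combination_on_invariants apply_field_scale
      by (simp_all add: assms)
    show "(minor_42 *s u - sl2_combination p q r) $ 0 = 0"
      and "(minor_42 *s u - sl2_combination p q r) $ 1 = 0"
      and "(minor_42 *s u - sl2_combination p q r) $ 3 = 0"
      unfolding vector_minus_component vector_smult_component sl2_combination_nth
      by (simp_all add: minor_42_def p_def q_def r_def algebra_simps eval_nat_numeral)
  qed
  then show ?thesis by auto
qed

lemma sl2_combination_eq_0:
  assumes "sl2_combination p q r = 0"
  shows "p = 0" and "q = 0" and "r = 0"
proof -
  have c: "p * (3 * X 3) + q * (3 * X 1) = 0" "p * (4 * X 4) + q * (2 * X 2) - r * X 3 = 0"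
    "q * X 3 - r * (2 * X 4) = 0"
    unfolding sl2_combination_nth(3-5)[of p q r, symmetric] assms by simp_all
  have "minor_10 * p = (p * (3 * X 3) + q * (3 * X 1)) * (X 3 ^ 2 - 4 * X 2 * X 4)
      + (p * (4 * X 4) + q * (2 * X 2) - r * X 3) * (6 * X 1 * X 4)
      - (q * X 3 - r * (2 * X 4)) * (3 * X 1 * X 3)"
    by (simp add: minor_10_def algebra_simps eval_nat_numeral)
  then show "p = 0" unfolding c using minor_10_nonzero by simp
  have "minor_10 * q = (p * (3 * X 3) + q * (3 * X 1)) * (8 * X 4 ^ 2)
      - (p * (4 * X 4) + q * (2 * X 2) - r * X 3) * (6 * X 3 * X 4)
      + (q * X 3 - r * (2 * X 4)) * (3 * X 3 ^ 2)"
    by (simp add: minor_10_def algebra_simps eval_nat_numeral)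
  then show "q = 0" unfolding c using minor_10_nonzero by simp
  have "minor_10 * r = (p * (3 * X 3) + q * (3 * X 1)) * (4 * X 3 * X 4)
      - (p * (4 * X 4) + q * (2 * X 2) - r * X 3) * (3 * X 3 ^ 2)
      + (q * X 3 - r * (2 * X 4)) * (6 * X 2 * X 3 - 12 * X 1 * X 4)"
    by (simp add: minor_10_def algebra_simps eval_nat_numeral)
  then show "r = 0" unfolding c using minor_10_nonzero by simp
qed

lemma minors_coprime:
  assumes "minor_10 dvd y * minor_42"
  shows "minor_10 dvd y"
proof (rule weighted.dvd_if_dvd_mult_coprime_leads[OF minor_10_nonzero])
  fix i :: 5
  show "\<exists>p m. minor_10 dvd y * p \<and> weighted.leads p m \<and> Poly_Mapping.lookup m i = 0"
  proof (cases "i = 3")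
    case True
    moreover from True have "i \<noteq> 0" "i \<noteq> 2" by simp_all
    ultimately show ?thesis using assms leads_minor_42 by blast
  next
    case False
    then show ?thesis using leads_minor_10 by (meson dvd_triv_right)
  qed
qed

lemma quartic_J_nonzero: "quartic_J_mpol \<noteq> 0"
  using leads_quartic_J weighted.leads_nonzero by blast

lemma invariants_coprime:
  assumes "quartic_J_mpol dvd y * quartic_I_mpol ^ 2"
  shows "quartic_J_mpol dvd y"
proof (rule weighted.dvd_if_dvd_mult_coprime_leads[OF quartic_J_nonzero])
  fix i :: 5
  show "\<exists>p m. quartic_J_mpol dvd y * p \<and> weighted.leads p m \<and> Poly_Mapping.lookup m i = 0"
  proof (cases "i = 2")
    case True
    moreover from True have "i \<noteq> 0" "i \<noteq> 3" by simp_all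
    ultimately show ?thesis using leads_quartic_J by (meson dvd_triv_right)
  next
    case False
    obtain m where "weighted.leads quartic_I_mpol m" "Poly_Mapping.lookup m i = 0"
      using leads_quartic_I False by blast
    then have "weighted.leads (quartic_I_mpol ^ 2) (m + m)" "Poly_Mapping.lookup (m + m) i = 0"
      by (simp_all add: weighted.leads_square lookup_add)
    with assms show ?thesis by blast
  qed
qed

text \<open>
  Cramer's rule gives the coefficients with the denominator \<open>minor_10\<close> and with the denominator
  \<open>minor_42\<close>. The linear fields are independent, so the two sets of fractions agree, and the
  denominators are coprime: the coefficients are polynomials.
\<close>

lemma field_annihilating_invariants:
  assumes "apply_field u quartic_I_mpol = 0" and "apply_field u quartic_J_mpol = 0"
  shows "\<exists>p q r. u = sl2_combination p q r"
proof -
  obtain p q r where pqr: "minor_10 *s u = sl2_combination p q r"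
    using cramer_10[OF assms] by blast
  obtain p' q' r' where pqr': "minor_42 *s u = sl2_combination p' q' r'"
    using cramer_42[OF assms] by blast
  have "sl2_combination (minor_42 * p - minor_10 * p') (minor_42 * q - minor_10 * q')
      (minor_42 * r - minor_10 * r') =
    minor_42 *s sl2_combination p q r - minor_10 *s sl2_combination p' q' r'"
    by (simp add: vec_eq_iff algebra_simps)
  also have "\<dots> = 0"
    unfolding pqr[symmetric] pqr'[symmetric] by (simp add: vec_eq_iff mult.left_commute)
  finally have "sl2_combination (minor_42 * p - minor_10 * p') (minor_42 * q - minor_10 * q')
      (minor_42 * r - minor_10 * r') = 0" .
  from sl2_combination_eq_0[OF this]
  have "minor_42 * p = minor_10 * p'" "minor_42 * q = minor_10 * q'" "minor_42 * r = minor_10 * r'"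
    by simp_all
  then have "minor_10 dvd p * minor_42" "minor_10 dvd q * minor_42" "minor_10 dvd r * minor_42"
    by (metis dvd_triv_left mult.commute)+
  then obtain f g h where "p = minor_10 * f" "q = minor_10 * g" "r = minor_10 * h"
    using minors_coprime by (meson dvdE)
  then have "minor_10 *s u = minor_10 *s sl2_combination f g h"
    unfolding pqr by (simp add: vec_eq_iff algebra_simps)
  then have "u = sl2_combination f g h"
    using minor_10_nonzero by (simp add: vec_eq_iff)
  then show ?thesis by blast
qed

text \<open>
  From \<open>6 I\<^sup>2 v(I) = J v(J)\<close> and coprimality, \<open>6 v(I) = J w\<close> and \<open>v(J) = I\<^sup>2 w\<close>. Subtracting
  \<open>w / 24\<close> times the Hessian field leaves a field that annihilates both invariants.
\<close>

theorem annihilating_fields_generated: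
  assumes "apply_field v quartic_disc_mpol = 0"
  shows "\<exists>h. v = (\<Sum>j\<in>UNIV. h $ j *s logarithmic_field j)"
proof -
  let ?I = quartic_I_mpol and ?J = quartic_J_mpol
  have "2 * (6 * ?I ^ 2 * apply_field v ?I) = 2 * (?J * apply_field v ?J)"
    using apply_field_disc[of v] assms by (simp add: algebra_simps)
  then have eq: "6 * ?I ^ 2 * apply_field v ?I = ?J * apply_field v ?J" by (simp add: mult_ac)
  have "(6 * apply_field v ?I) * ?I ^ 2 = ?J * apply_field v ?J"
    unfolding eq[symmetric] by (simp only: mult_ac)
  then have "?J dvd (6 * apply_field v ?I) * ?I ^ 2" by (rule dvdI)
  then obtain w where w: "6 * apply_field v ?I = ?J * w" using invariants_coprime by (meson dvdE)
  have "?J * (?I ^ 2 * w) = ?J * apply_field v ?J"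
    unfolding eq[symmetric] using w by (simp add: mult_ac)
  then have wJ: "apply_field v ?J = ?I ^ 2 * w" using quartic_J_nonzero by simp
  define s where "s = mconst (1 / 24) * w"
  have s: "24 * s = w"
    unfolding s_def mult.assoc[symmetric] mconst_numeral[symmetric] mconst_mult[symmetric] by simp
  have "6 * apply_field (v - s *s logarithmic_field 4) ?I = 0"
    unfolding apply_field_diff apply_field_scale logarithmic_fields_on_invariants right_diff_distrib w
    by (simp flip: s)
  moreover have "apply_field (v - s *s logarithmic_field 4) ?J = 0"
    unfolding apply_field_diff apply_field_scale logarithmic_fields_on_invariants wJ
    by (simp flip: s)
  ultimately obtain p q r where "v - s *s logarithmic_field 4 = sl2_combination p q r"
    using field_annihilating_invariants by fastforce
  then have v: "v = sl2_combination p q r + s *s logarithmic_field 4" by (simp add: algebra_simps)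
  define h :: "5 mpol ^ 4" where "h = (\<chi> j. if j = 1 then p else if j = 2 then q else if j = 3 then r else s)"
  have "v = (\<Sum>j\<in>UNIV. h $ j *s logarithmic_field j)"
    unfolding sum_4 v by (simp add: h_def)
  then show ?thesis by blast
qed

text \<open>
  Applied to \<open>I\<close>, a relation gives \<open>4 J h\<^sub>4 = 0\<close>, and the three linear fields are independent because
  \<open>minor_10\<close> is nonzero.
\<close>

theorem logarithmic_fields_independent:
  assumes "(\<Sum>j\<in>UNIV. h $ j *s logarithmic_field j) = 0"
  shows "h = 0"
proof -
  have sum: "sl2_combination (h $ 1) (h $ 2) (h $ 3) + h $ 4 *s logarithmic_field 4 = 0"
    using assms unfolding sum_4 .
  have "apply_field (sl2_combination (h $ 1) (h $ 2) (h $ 3) + h $ 4 *s logarithmic_field 4) quartic_I_mpol = 0"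
    unfolding sum by (simp add: apply_field_def)
  then have "h $ 4 * (4 * quartic_J_mpol) = 0"
    unfolding apply_field_add[of "sl2_combination _ _ _"] sl2_combination_on_invariants
      apply_field_scale[of "h $ 4"] logarithmic_fields_on_invariants by simp
  then have h4: "h $ 4 = 0" using quartic_J_nonzero by simp
  with sum have "sl2_combination (h $ 1) (h $ 2) (h $ 3) = 0" by simp
  from sl2_combination_eq_0[OF this] h4 show ?thesis
    unfolding vec_eq_iff forall_4 by simp
qed

section \<open>Dimensions of graded pieces\<close>

text \<open>
  Both spans determine the same representation in the basis \<open>B\<close>, with disjoint supports.
\<close>

lemma (in vector_space) independent_parts_span_disjoint:
  assumes "independent B" and "A \<subseteq> B" and "x \<in> span A" and "x \<in> span (B - A)"
  shows "x = 0"
proof -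
  have "representation B x = representation A x"
    by (rule representation_extend[OF assms(1,3,2)])
  moreover have "representation B x = representation (B - A) x"
    by (rule representation_extend[OF assms(1,4)]) auto
  ultimately have 0: "representation B x b = 0" for b
    using representation_ne_zero[of A x b] representation_ne_zero[of "B - A" x b] by auto
  have "x \<in> span B" using assms(2,3) span_mono by blast
  from sum_nonzero_representation_eq[OF assms(1) this] show ?thesis by (simp add: 0)
qed

text \<open>
  A basis of the kernel is extended to a basis of \<open>V\<close>; the added vectors are mapped to a basis of the
  image. Only \<open>V\<close> has finite dimension, not the ambient space.
\<close>

lemma (in vector_space_pair) rank_nullity:
  assumes f: "Vector_Spaces.linear s1 s2 f" and V: "vs1.subspace V"
    and T: "V \<subseteq> vs1.span T" "finite T"
  shows "vs1.dim V = vs2.dim (f ` V) + vs1.dim {v \<in> V. f v = 0}"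
proof -
  interpret f: Vector_Spaces.linear s1 s2 f by (rule f)
  let ?K = "{v \<in> V. f v = 0}"
  obtain A where A: "A \<subseteq> ?K" "vs1.independent A" "?K \<subseteq> vs1.span A" "card A = vs1.dim ?K"
    using vs1.basis_exists by blast
  obtain B where B: "A \<subseteq> B" "B \<subseteq> V" "vs1.independent B" "V \<subseteq> vs1.span B"
    using vs1.maximal_independent_subset_extend[of A V] A by blast
  have finB: "finite B" using vs1.independent_span_bound[OF T(2) B(3)] B(2) T(1) by blast
  let ?C = "B - A"
  have spanV: "vs1.span B = V"
    using B V vs1.span_minimal by blast
  have ind: "vs1.independent ?C" using B(3) vs1.independent_mono by blast
  have "x = 0" if "x \<in> vs1.span ?C" "f x = 0" for x
  proof -
    have "x \<in> ?K" using that spanV vs1.span_mono[of ?C B] by auto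
    with A(3) vs1.independent_parts_span_disjoint[OF B(3,1)] that show ?thesis by blast
  qed
  then have inj: "inj_on f (vs1.span ?C)"
    using f.inj_on_iff_eq_0[OF vs1.subspace_span] by blast
  have ind': "vs2.independent (f ` ?C)" by (rule f.independent_inj_on_image[OF ind inj])
  have "f ` B \<subseteq> insert 0 (f ` ?C)" using A(1) by auto
  then have "f ` V \<subseteq> vs2.span (f ` ?C)"
    unfolding spanV[symmetric] f.span_image[symmetric] using vs2.span_mono vs2.span_insert_0 by metis
  moreover have "f ` ?C \<subseteq> f ` V" using B(2) by auto
  ultimately have "card (f ` ?C) = vs2.dim (f ` V)"
    by (intro vs2.basis_card_eq_dim ind')
  moreover have "card (f ` ?C) = card ?C"
    using inj vs1.span_superset by (intro card_image) (rule inj_on_subset)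
  moreover have "card B = vs1.dim V" by (rule vs1.basis_card_eq_dim[OF B(2,4,3)])
  moreover have "card ?C + card A = card B"
    using card_Diff_subset[OF finite_subset[OF B(1) finB] B(1)] card_mono[OF finB B(1)] by simp
  ultimately show ?thesis using A(4) by simp
qed

lemma independent_monomials: "mpol_vs.independent (monomials k :: 'v::finite mpol set)"
proof (rule mpol_vs.independent_if_scalars_zero[OF card_monomials_set(1)])
  fix c :: "'v mpol \<Rightarrow> complex" and p :: "'v mpol"
  assume sum: "(\<Sum>p\<in>(monomials k :: 'v mpol set). mconst (c p) * p) = 0" and "p \<in> monomials k"
  then obtain m where m: "p = Poly_Mapping.single m 1" "mon_deg m = k" by (auto simp: monomials_def)
  have "(\<Sum>p\<in>(monomials k :: 'v mpol set). mconst (c p) * p) =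
    (\<Sum>n\<in>{n :: 'v \<Rightarrow>\<^sub>0 nat. mon_deg n = k}. mconst (c (Poly_Mapping.single n 1)) * Poly_Mapping.single n 1)"
    unfolding monomials_def by (simp add: sum.reindex[OF inj_on_single_1])
  with sum have "0 = Poly_Mapping.lookup
    (\<Sum>n\<in>{n :: 'v \<Rightarrow>\<^sub>0 nat. mon_deg n = k}. mconst (c (Poly_Mapping.single n 1)) * Poly_Mapping.single n 1) m"
    by simp
  also have "\<dots> = (\<Sum>n\<in>{n :: 'v \<Rightarrow>\<^sub>0 nat. mon_deg n = k}. if n = m then c p else 0)"
    unfolding lookup_sum lookup_mconst_mult by (intro sum.cong) (auto simp: lookup_single m(1))
  also have "\<dots> = c p" using m(2) by (simp add: card_monomials(1))
  finally show "c p = 0" by simp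
qed

lemma dim_homog_part:
  "mpol_vs.dim (homog_part k :: 'v::finite mpol set) = (k + CARD('v) - 1) choose k"
  using mpol_vs.dim_span_eq_card_independent[OF independent_monomials[where 'v = 'v, of k]]
  unfolding span_monomials card_monomials_set(2) .

global_interpretation mpol_vec_vs: vector_space "\<lambda>c (v :: 'v mpol ^ 'n). mconst c *s v"
  by unfold_locales
    (simp_all add: vector_add_ldistrib vector_sadd_rdistrib vector_smult_assoc mconst_add mconst_mult)

text \<open>
  The homogeneous part of a free module whose generators have different degrees: \<open>\<delta>\<close> gives the degrees
  of the components of its elements.
\<close>

definition graded_piece :: "('n \<Rightarrow> nat) \<Rightarrow> ('v::finite mpol ^ 'n) set" where
  "graded_piece \<delta> = {v. \<forall>i. v $ i \<in> homog_part (\<delta> i)}"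

definition graded_basis :: "('n \<Rightarrow> nat) \<Rightarrow> ('v::finite mpol ^ 'n) set" where
  "graded_basis \<delta> = (\<lambda>(i, m). axis i (Poly_Mapping.single m 1)) ` (SIGMA i:UNIV. {m. mon_deg m = \<delta> i})"

lemma graded_piece_subspace: "mpol_vec_vs.subspace (graded_piece \<delta>)"
  unfolding mpol_vec_vs.subspace_def graded_piece_def
  by (auto intro: homog_part_add homog_part_mconst_mult)

lemma inj_axis_single:
  "inj_on (\<lambda>(i, m). axis i (Poly_Mapping.single m (1::complex))) A"
proof (rule inj_onI, clarify)
  fix i j :: 'a and m n :: 'b
  assume eq: "axis i (Poly_Mapping.single m (1::complex)) = axis j (Poly_Mapping.single n 1)"
  have "Poly_Mapping.lookup (axis i (Poly_Mapping.single m (1::complex)) $ i) m = 1" by simp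
  then have "Poly_Mapping.lookup (axis j (Poly_Mapping.single n (1::complex)) $ i) m = 1"
    unfolding eq .
  then show "i = j \<and> m = n"
    by (auto simp: axis_def lookup_single when_def split: if_splits)
qed

lemma graded_basis_facts:
  fixes \<delta> :: "'n::finite \<Rightarrow> nat"
  shows "finite (graded_basis \<delta> :: ('v::finite mpol ^ 'n) set)"
    and "card (graded_basis \<delta> :: ('v mpol ^ 'n) set) = (\<Sum>i\<in>UNIV. (\<delta> i + CARD('v) - 1) choose (\<delta> i))"
    and "mpol_vec_vs.independent (graded_basis \<delta> :: ('v mpol ^ 'n) set)"
    and "mpol_vec_vs.span (graded_basis \<delta> :: ('v mpol ^ 'n) set) = graded_piece \<delta>"
proof -
  let ?S = "SIGMA i:UNIV :: 'n set. {m :: 'v \<Rightarrow>\<^sub>0 nat. mon_deg m = \<delta> i}"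
  let ?e = "\<lambda>(i, m). axis i (Poly_Mapping.single m 1) :: 'v mpol ^ 'n"
  let ?B = "graded_basis \<delta> :: ('v mpol ^ 'n) set"
  have finS: "finite ?S" by (intro finite_SigmaI) (simp_all add: card_monomials(1))
  show fin: "finite ?B" unfolding graded_basis_def using finS by (rule finite_imageI)
  show "card ?B = (\<Sum>i\<in>UNIV. (\<delta> i + CARD('v) - 1) choose (\<delta> i))"
    unfolding graded_basis_def card_image[OF inj_axis_single]
    by (simp add: card_SigmaI card_monomials)
  show "mpol_vec_vs.independent ?B"
  proof (rule mpol_vec_vs.independent_if_scalars_zero[OF fin])
    fix c :: "'v mpol ^ 'n \<Rightarrow> complex" and x :: "'v mpol ^ 'n"
    assume sum: "(\<Sum>x\<in>?B. mconst (c x) *s x) = 0" and "x \<in> ?B"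
    then obtain i m where x: "x = axis i (Poly_Mapping.single m 1)" "mon_deg m = \<delta> i"
      by (auto simp: graded_basis_def)
    have "(\<Sum>x\<in>?B. mconst (c x) *s x) = (\<Sum>s\<in>?S. mconst (c (?e s)) *s ?e s)"
      unfolding graded_basis_def by (subst sum.reindex[OF inj_axis_single]) (simp add: o_def)
    with sum have "0 = Poly_Mapping.lookup ((\<Sum>s\<in>?S. mconst (c (?e s)) *s ?e s) $ i) m" by simp
    also have "\<dots> = (\<Sum>s\<in>?S. if s = (i, m) then c x else 0)"
      unfolding sum_component vector_smult_component lookup_sum lookup_mconst_mult
      by (intro sum.cong) (auto simp: axis_def lookup_single x(1) when_def split: if_splits)
    also have "\<dots> = c x" using x(2) finS by simp
    finally show "c x = 0" by simp
  qed
  show "mpol_vec_vs.span ?B = graded_piece \<delta>"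
  proof
    show "mpol_vec_vs.span ?B \<subseteq> graded_piece \<delta>"
    proof (rule mpol_vec_vs.span_minimal[OF _ graded_piece_subspace])
      show "?B \<subseteq> graded_piece \<delta>"
        by (auto simp: graded_basis_def graded_piece_def axis_def homog_part_single)
    qed
    show "graded_piece \<delta> \<subseteq> mpol_vec_vs.span ?B"
    proof
      fix v :: "'v mpol ^ 'n" assume v: "v \<in> graded_piece \<delta>"
      have "v = (\<Sum>i\<in>UNIV. \<Sum>m\<in>Poly_Mapping.keys (v $ i).
        mconst (Poly_Mapping.lookup (v $ i) m) *s axis i (Poly_Mapping.single m 1))"
        (is "_ = ?sum")
      proof (subst vec_eq_iff, rule allI)
        fix j
        have "?sum $ j = (\<Sum>i\<in>UNIV. if i = j then
          (\<Sum>m\<in>Poly_Mapping.keys (v $ j). Poly_Mapping.single m (Poly_Mapping.lookup (v $ j) m)) else 0)"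
          unfolding sum_component
          by (intro sum.cong refl) (auto simp: axis_def mconst_def mult_single)
        also have "\<dots> = v $ j" using mpol_sum_of_terms[of "v $ j"] by simp
        finally show "v $ j = ?sum $ j" ..
      qed
      also have "\<dots> \<in> mpol_vec_vs.span ?B"
      proof (intro mpol_vec_vs.span_sum mpol_vec_vs.span_scale mpol_vec_vs.span_base)
        fix i m assume "m \<in> Poly_Mapping.keys (v $ i)"
        then have "mon_deg m = \<delta> i" using v by (auto simp: graded_piece_def homog_part_def)
        then show "axis i (Poly_Mapping.single m 1) \<in> ?B" by (force simp: graded_basis_def)
      qed
      finally show "v \<in> mpol_vec_vs.span ?B" .
    qed
  qed
qed

lemma dim_graded_piece:
  fixes \<delta> :: "'n::finite \<Rightarrow> nat"
  shows "mpol_vec_vs.dim (graded_piece \<delta> :: ('v::finite mpol ^ 'n) set) =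
    (\<Sum>i\<in>UNIV. (\<delta> i + CARD('v) - 1) choose (\<delta> i))"
  using mpol_vec_vs.dim_span_eq_card_independent[OF graded_basis_facts(3)[where 'v = 'v, of \<delta>]]
  unfolding graded_basis_facts(2,4) .

section \<open>The Milnor algebra in one degree\<close>

lemma mpol_ring_simps [simp]:
  "carrier mpol_ring = UNIV" "mult mpol_ring = (*)" "one mpol_ring = 1" "zero mpol_ring = 0"
  "add mpol_ring = (+)"
  by (simp_all add: mpol_ring_def)

lemma cring_mpol_ring: "cring (mpol_ring :: 'v mpol ring)"
proof (intro cringI abelian_groupI comm_monoidI)
  fix x :: "'v mpol" 
  show "\<exists>y\<in>carrier mpol_ring. y \<oplus>\<^bsub>mpol_ring\<^esub> x = \<zero>\<^bsub>mpol_ring\<^esub>"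
    by (rule bexI[of _ "- x"]) simp_all
qed (simp_all add: algebra_simps)

lemma ideal_jacobian_ideal: "ideal (jacobian_ideal f) mpol_ring"
proof -
  interpret cring "mpol_ring :: 'a mpol ring" by (rule cring_mpol_ring)
  show ?thesis unfolding jacobian_ideal_def by (rule genideal_ideal) simp
qed

lemmas jacobian_ideal_zero = additive_subgroup.zero_closed[OF ideal.axioms(1)[OF ideal_jacobian_ideal]]
  and jacobian_ideal_add = additive_subgroup.a_closed[OF ideal.axioms(1)[OF ideal_jacobian_ideal]]

lemma a_inv_mpol_ring: "a_inv mpol_ring x = - (x :: 'v mpol)"
proof -
  interpret cring "mpol_ring :: 'v mpol ring" by (rule cring_mpol_ring)
  show ?thesis by (rule minus_equality) simp_all
qed

lemma jacobian_ideal_eq: "jacobian_ideal f = range (\<lambda>v. apply_field v f)"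
proof
  interpret cring "mpol_ring :: 'a mpol ring" by (rule cring_mpol_ring)
  let ?R = "range (\<lambda>v. apply_field v f)"
  have add: "x + y \<in> ?R" if "x \<in> ?R" "y \<in> ?R" for x y
    using that by (auto simp flip: apply_field_add)
  have mult: "p * x \<in> ?R" if "x \<in> ?R" for p x
    using that by (auto simp flip: apply_field_scale)
  have zero: "0 \<in> ?R" by (rule range_eqI[of _ _ 0]) (simp add: apply_field_def)
  have "ideal ?R mpol_ring"
  proof (rule idealI)
    show "ring (mpol_ring :: 'a mpol ring)" by (rule ring_axioms)
    show "subgroup ?R (add_monoid mpol_ring)"
    proof (rule add.subgroupI)
      show "?R \<noteq> {}" by blast
      fix x assume "x \<in> ?R"
      from mult[OF this, of "- 1"] show "\<ominus>\<^bsub>mpol_ring\<^esub> x \<in> ?R" by (simp add: a_inv_mpol_ring)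
    qed (use add in auto)
  qed (use mult in \<open>auto simp: mult.commute\<close>)
  moreover have "range (\<lambda>i. mpol_pderiv i f) \<subseteq> ?R"
  proof clarify
    fix i
    have "apply_field (axis i 1) f = (\<Sum>j\<in>UNIV. if j = i then mpol_pderiv i f else 0)"
      unfolding apply_field_def by (intro sum.cong) (auto simp: axis_def)
    then show "mpol_pderiv i f \<in> ?R" by (intro range_eqI[of _ _ "axis i 1"]) simp
  qed
  ultimately show "jacobian_ideal f \<subseteq> ?R" unfolding jacobian_ideal_def by (rule genideal_minimal)
  interpret J: ideal "jacobian_ideal f" mpol_ring by (rule ideal_jacobian_ideal)
  have gen: "mpol_pderiv i f \<in> jacobian_ideal f" for i
    using genideal_self[of "range (\<lambda>i. mpol_pderiv i f)"] by (auto simp: jacobian_ideal_def)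
  have "(\<Sum>i\<in>M. v $ i * mpol_pderiv i f) \<in> jacobian_ideal f" for M v
  proof (induction M rule: infinite_finite_induct)
    case (insert i M)
    have "v $ i * mpol_pderiv i f \<in> jacobian_ideal f"
      using J.I_l_closed[OF gen, of "v $ i"] by simp
    from jacobian_ideal_add[OF this insert(3)] insert show ?case by simp
  qed (use jacobian_ideal_zero[of f] in simp_all)
  then show "?R \<subseteq> jacobian_ideal f" by (auto simp: apply_field_def)
qed

lemma jacobian_ideal_subspace: "mpol_vs.subspace (jacobian_ideal f \<inter> homog_part k)"
  unfolding mpol_vs.subspace_def
proof (intro conjI allI impI ballI)
  interpret J: ideal "jacobian_ideal f" mpol_ring by (rule ideal_jacobian_ideal)
  show "0 \<in> jacobian_ideal f \<inter> homog_part k" using jacobian_ideal_zero[of f] by simp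
  fix x assume x: "x \<in> jacobian_ideal f \<inter> homog_part k"
  show "mconst c * x \<in> jacobian_ideal f \<inter> homog_part k" for c
    using x J.I_l_closed[of x "mconst c"] by (simp add: homog_part_mconst_mult)
  fix y assume "y \<in> jacobian_ideal f \<inter> homog_part k"
  with x show "x + y \<in> jacobian_ideal f \<inter> homog_part k"
    using jacobian_ideal_add[of x f y] by (simp add: homog_part_add)
qed

text \<open>
  A basis of the degree \<open>k\<close> part of the Jacobian ideal is extended to a basis of all forms of degree \<open>k\<close>.
  The classes of the added forms are a basis of the degree \<open>k\<close> part of the Milnor algebra; adding
  them one at a time follows the inductive definition of the dimension.
\<close>

lemma milnor_dim_eq:
  fixes f :: "'v::finite mpol"
  assumes "mpol_vs.dim (homog_part k :: 'v mpol set) = d + mpol_vs.dim (jacobian_ideal f \<inter> homog_part k)"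
  shows "milnor_dim f k d"
proof -
  interpret R: cring "mpol_ring :: 'v mpol ring" by (rule cring_mpol_ring)
  interpret J: ideal "jacobian_ideal f" mpol_ring by (rule ideal_jacobian_ideal)
  interpret Q: ring "milnor_algebra f"
    unfolding milnor_algebra_def by (rule J.quotient_is_ring)
  let ?cl = "milnor_class f" and ?Jk = "jacobian_ideal f \<inter> homog_part k"
  let ?K = "?cl ` range mconst"
  have hom: "?cl \<in> ring_hom mpol_ring (milnor_algebra f)"
    using J.rcos_ring_hom by (simp add: milnor_class_def[abs_def] milnor_algebra_def)
  have cl_add: "?cl (p + q) = ?cl p \<oplus>\<^bsub>milnor_algebra f\<^esub> ?cl q"
    and cl_mult: "?cl (p * q) = ?cl p \<otimes>\<^bsub>milnor_algebra f\<^esub> ?cl q"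
    and cl_carrier: "?cl p \<in> carrier (milnor_algebra f)" for p q
    using ring_hom_add[OF hom, of p q] ring_hom_mult[OF hom, of p q] ring_hom_closed[OF hom, of p] by simp_all
  have cl_eq: "?cl p = ?cl q \<longleftrightarrow> p - q \<in> jacobian_ideal f" for p q
    using R.quotient_eq_iff_same_a_r_cos[OF J.ideal_axioms, of p q]
    by (simp add: milnor_class_def a_minus_def a_inv_mpol_ring)
  have cl_0: "?cl p = \<zero>\<^bsub>milnor_algebra f\<^esub> \<longleftrightarrow> p \<in> jacobian_ideal f" for p
  proof -
    have "?cl 0 = \<zero>\<^bsub>milnor_algebra f\<^esub>"
      using ring_hom_zero[OF hom R.ring_axioms Q.ring_axioms] by simp
    then show ?thesis using cl_eq[of p 0] by simp
  qed
  obtain A where A: "A \<subseteq> ?Jk" "mpol_vs.independent A" "?Jk \<subseteq> mpol_vs.span A" "card A = mpol_vs.dim ?Jk"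
    using mpol_vs.basis_exists by blast
  obtain B where B: "A \<subseteq> B" "B \<subseteq> homog_part k" "mpol_vs.independent B" "homog_part k \<subseteq> mpol_vs.span B"
    using mpol_vs.maximal_independent_subset_extend[of A "homog_part k"] A by blast
  have finB: "finite B"
    using mpol_vs.independent_span_bound[OF card_monomials_set(1)[of k] B(3)] B(2) span_monomials by blast
  have spanA: "mpol_vs.span A = ?Jk"
    using A mpol_vs.span_minimal[OF A(1) jacobian_ideal_subspace] by blast
  have spanB: "mpol_vs.span B = homog_part k"
    using B mpol_vs.span_minimal[OF B(2) homog_part_subspace] by blast
  have "Q.dimension (card C) ?K (?cl ` mpol_vs.span (A \<union> C))" if "finite C" "C \<subseteq> B - A" for C
    using that
  proof induction
    case empty
    have "?cl ` ?Jk = {\<zero>\<^bsub>milnor_algebra f\<^esub>}"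
      using cl_0 mpol_vs.subspace_0[OF jacobian_ideal_subspace[of f k]] by blast
    then show ?case by (simp add: spanA)
  next
    case (insert v C)
    let ?E = "mpol_vs.span (A \<union> C)"
    have v: "v \<in> B" "v \<notin> A \<union> C" using insert by auto
    have sub: "A \<union> C \<subseteq> B - {v}" using insert B(1) by auto
    have notin: "?cl v \<notin> ?cl ` ?E"
    proof
      assume "?cl v \<in> ?cl ` ?E"
      then obtain w where w: "w \<in> ?E" "v - w \<in> jacobian_ideal f" using cl_eq by auto
      have "w \<in> homog_part k" using w(1) sub mpol_vs.span_mono[of "A \<union> C" B] spanB by auto
      then have "v - w \<in> mpol_vs.span A"
        using w(2) v(1) B(2) homog_part_diff spanA by auto
      then have "v - w \<in> ?E" using mpol_vs.span_mono[of A "A \<union> C"] by auto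
      from mpol_vs.span_add[OF this w(1)] have "v \<in> ?E" by simp
      then have "v \<in> mpol_vs.span (B - {v})" using mpol_vs.span_mono[OF sub] by blast
      with B(3) v(1) show False unfolding mpol_vs.dependent_def by blast
    qed
    have "?cl ` mpol_vs.span (insert v (A \<union> C)) = Q.line_extension ?K (?cl v) (?cl ` ?E)"
    proof (intro equalityI subsetI)
      fix u assume "u \<in> ?cl ` mpol_vs.span (insert v (A \<union> C))"
      then obtain p c where u: "u = ?cl p" and p: "p - mconst c * v \<in> ?E"
        using mpol_vs.span_breakdown_eq by blast
      have "u = ?cl (mconst c) \<otimes>\<^bsub>milnor_algebra f\<^esub> ?cl v \<oplus>\<^bsub>milnor_algebra f\<^esub> ?cl (p - mconst c * v)"
        unfolding u by (simp flip: cl_add cl_mult)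
      with p show "u \<in> Q.line_extension ?K (?cl v) (?cl ` ?E)"
        unfolding Q.line_extension_mem_iff by blast
    next
      fix u assume "u \<in> Q.line_extension ?K (?cl v) (?cl ` ?E)"
      then obtain c w where w: "w \<in> ?E" and
        u: "u = ?cl (mconst c) \<otimes>\<^bsub>milnor_algebra f\<^esub> ?cl v \<oplus>\<^bsub>milnor_algebra f\<^esub> ?cl w"
        unfolding Q.line_extension_mem_iff by blast
      have "u = ?cl (mconst c * v + w)" unfolding u by (simp add: cl_add cl_mult)
      moreover have "mconst c * v + w \<in> mpol_vs.span (insert v (A \<union> C))"
        using w by (auto simp: mpol_vs.span_breakdown_eq intro: exI[of _ c])
      ultimately show "u \<in> ?cl ` mpol_vs.span (insert v (A \<union> C))" by blast
    qed
    moreover have "Q.dimension (Suc (card C)) ?K (Q.line_extension ?K (?cl v) (?cl ` ?E))"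
      using insert by (intro Q.Suc_dim cl_carrier notin) auto
    ultimately show ?case using insert by simp
  qed
  from this[of "B - A"] have "Q.dimension (card (B - A)) ?K (?cl ` homog_part k)"
    using finB B(1) spanB by (simp add: Un_absorb1)
  moreover have "card (B - A) = d"
  proof -
    have "card B = mpol_vs.dim (homog_part k :: 'v mpol set)"
      by (rule mpol_vs.basis_card_eq_dim[OF B(2,4,3)])
    then show ?thesis
      using assms A(4) B(1) card_Diff_subset[of A B] finite_subset[OF B(1) finB] by simp
  qed
  ultimately show ?thesis unfolding milnor_dim_def by simp
qed

section \<open>The Hilbert polynomial\<close>

lemma linear_apply_field:
  "Vector_Spaces.linear (\<lambda>c v. mconst c *s v) (\<lambda>c p. mconst c * p) (\<lambda>v. apply_field v f)"
  unfolding Vector_Spaces.linear_iff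
  by (simp add: mpol_vec_vs.vector_space_axioms mpol_vs.vector_space_axioms apply_field_add apply_field_scale)

text \<open>
  In a combination of the partial derivatives that is homogeneous, the coefficients can be replaced by
  their homogeneous components.
\<close>

lemma jacobian_ideal_homog_part:
  assumes f: "f \<in> homog_part (Suc n)"
  shows "jacobian_ideal f \<inter> homog_part (k + n) = (\<lambda>v. apply_field v f) ` graded_piece (\<lambda>_. k)"
proof (intro equalityI subsetI)
  fix p assume p: "p \<in> jacobian_ideal f \<inter> homog_part (k + n)"
  then obtain v where v: "p = apply_field v f" by (auto simp: jacobian_ideal_eq)
  let ?w = "\<chi> i. homog_component k (v $ i)"
  have "p = homog_component (k + n) p"
    using p by (simp add: homog_component_of_homog[of _ "k + n"])
  also have "\<dots> = apply_field ?w f"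
    unfolding v apply_field_def homog_component_sum
    by (simp add: homog_component_mult[OF homog_part_pderiv[OF f]])
  finally show "p \<in> (\<lambda>v. apply_field v f) ` graded_piece (\<lambda>_. k)"
    by (rule image_eqI) (simp add: graded_piece_def homog_component_in)
next
  fix p assume "p \<in> (\<lambda>v. apply_field v f) ` graded_piece (\<lambda>_. k)"
  then obtain v where v: "p = apply_field v f" "v \<in> graded_piece (\<lambda>_. k)" by blast
  have "p \<in> homog_part (k + n)"
    unfolding v(1) apply_field_def using v(2)
    by (intro homog_part_sum homog_part_mult homog_part_pderiv[OF f]) (simp add: graded_piece_def)
  then show "p \<in> jacobian_ideal f \<inter> homog_part (k + n)" by (auto simp: jacobian_ideal_eq v(1))
qed

definition log_combination :: "5 mpol ^ 4 \<Rightarrow> 5 mpol ^ 5" where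
  "log_combination h = (\<Sum>j\<in>UNIV. h $ j *s logarithmic_field j)"

lemma linear_log_combination:
  "Vector_Spaces.linear (\<lambda>c v. mconst c *s v) (\<lambda>c v. mconst c *s v) log_combination"
  unfolding Vector_Spaces.linear_iff
  by (simp add: mpol_vec_vs.vector_space_axioms log_combination_def vector_sadd_rdistrib sum.distrib
      vec_eq_iff sum_distrib_left mult.assoc distrib_right)

definition log_degree :: "4 \<Rightarrow> nat" where
  "log_degree j = (if j = 4 then 2 else 1)"

lemma homog_logarithmic_field: "logarithmic_field j $ i \<in> homog_part (log_degree j)"
proof -
  note v = homog_part_mvar
  have nv: "numeral n * X i \<in> homog_part (Suc 0)" for n i by (rule homog_part_numeral_mult[OF v])
  have sq: "X i ^ 2 \<in> homog_part 2" for i by (rule homog_part_power'[OF v]) simp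
  have nsq: "numeral n * X i ^ 2 \<in> homog_part 2" for n i by (rule homog_part_numeral_mult[OF sq])
  have nvv: "numeral n * X i * X j \<in> homog_part 2" for n i j
    by (rule homog_part_mult'[OF nv v]) simp
  have "\<forall>j i. logarithmic_field j $ i \<in> homog_part (log_degree j)"
    unfolding forall_4 unfolding forall_5
    by (simp add: logarithmic_field_def log_degree_def v nv sq nsq nvv homog_part_uminus
        homog_part_add homog_part_diff)
  then show ?thesis by blast
qed

text \<open>
  The resolution in one degree: the kernel of the gradient map is the image of the free module on the
  four fields.
\<close>

lemma annihilating_fields_in_degree:
  "{v \<in> graded_piece (\<lambda>_. k + 2). apply_field v quartic_disc_mpol = 0} =
    log_combination ` graded_piece (\<lambda>j. k + 2 - log_degree j)"
proof (intro equalityI subsetI)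
  fix v assume "v \<in> {v \<in> graded_piece (\<lambda>_. k + 2). apply_field v quartic_disc_mpol = 0}"
  then have v: "v \<in> graded_piece (\<lambda>_. k + 2)" "apply_field v quartic_disc_mpol = 0" by auto
  obtain h where h: "v = (\<Sum>j\<in>UNIV. h $ j *s logarithmic_field j)"
    using annihilating_fields_generated[OF v(2)] by blast
  let ?h = "\<chi> j. homog_component (k + 2 - log_degree j) (h $ j)"
  have deg: "k + 2 - log_degree j + log_degree j = k + 2" for j by (simp add: log_degree_def)
  have "v $ i = log_combination ?h $ i" for i
  proof -
    have "v $ i = homog_component (k + 2) (v $ i)"
      using v(1) by (simp add: graded_piece_def homog_component_of_homog[of _ "k + 2"])
    also have "\<dots> = (\<Sum>j\<in>UNIV. homog_component (k + 2) (h $ j * logarithmic_field j $ i))"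
      by (simp add: h homog_component_sum)
    also have "\<dots> = (\<Sum>j\<in>UNIV. homog_component (k + 2 - log_degree j) (h $ j) * logarithmic_field j $ i)"
      unfolding homog_component_mult[OF homog_logarithmic_field, symmetric] deg ..
    finally show ?thesis by (simp add: log_combination_def)
  qed
  then have "v = log_combination ?h" by (simp add: vec_eq_iff)
  then show "v \<in> log_combination ` graded_piece (\<lambda>j. k + 2 - log_degree j)"
    by (rule image_eqI) (simp add: graded_piece_def homog_component_in)
next
  fix v assume "v \<in> log_combination ` graded_piece (\<lambda>j. k + 2 - log_degree j)"
  then obtain h where h: "v = log_combination h" "\<And>j. h $ j \<in> homog_part (k + 2 - log_degree j)"
    by (auto simp: graded_piece_def)
  have "h $ j * logarithmic_field j $ i \<in> homog_part (k + 2)" for i j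
    by (rule homog_part_mult'[OF h(2) homog_logarithmic_field]) (simp add: log_degree_def)
  then have "v \<in> graded_piece (\<lambda>_. k + 2)"
    by (simp add: graded_piece_def h(1) log_combination_def homog_part_sum)
  moreover have "apply_field v quartic_disc_mpol = 0"
    unfolding h(1) log_combination_def sum_4 apply_field_add apply_field_scale
    by (simp add: logarithmic_field_annihilates_disc)
  ultimately show "v \<in> {v \<in> graded_piece (\<lambda>_. k + 2). apply_field v quartic_disc_mpol = 0}" by simp
qed

lemma choose_CARD_5: "(n + CARD(5) - 1) choose n = (n + 4) choose 4"
proof -
  have "n + CARD(5) - 1 = n + 4" by simp
  then show ?thesis using binomial_symmetric[of n "n + 4"] by (simp only: le_add1 add_diff_cancel_left')
qed

text \<open>
  Two applications of rank and nullity: to the gradient map on five forms of degree \<open>k + 2\<close>, and to the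
  injective map that sends coefficients, three of degree \<open>k + 1\<close> and one of degree \<open>k\<close>, to
  combinations of the four fields.
\<close>

lemma dim_jacobian_ideal_disc:
  "mpol_vs.dim (jacobian_ideal quartic_disc_mpol \<inter> homog_part (k + 7))
     + 3 * ((k + 5) choose 4) + ((k + 4) choose 4) = 5 * ((k + 6) choose 4)"
proof -
  interpret P: vector_space_pair "\<lambda>c (v :: 5 mpol ^ 5). mconst c *s v" "\<lambda>c (p :: 5 mpol). mconst c * p" ..
  interpret L: vector_space_pair "\<lambda>c (v :: 5 mpol ^ 4). mconst c *s v" "\<lambda>c (v :: 5 mpol ^ 5). mconst c *s v" ..
  let ?D = quartic_disc_mpol
  let ?V = "graded_piece (\<lambda>_. k + 2) :: (5 mpol ^ 5) set"
  let ?H = "graded_piece (\<lambda>j. k + 2 - log_degree j) :: (5 mpol ^ 4) set"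
  have f: "?D \<in> homog_part (Suc 5)" using homog_quartic_disc by simp
  have J: "jacobian_ideal ?D \<inter> homog_part (k + 7) = (\<lambda>v. apply_field v ?D) ` ?V"
    using jacobian_ideal_homog_part[OF f, of "k + 2"] by (simp add: add.commute)
  have "mpol_vec_vs.dim ?V = mpol_vs.dim ((\<lambda>v. apply_field v ?D) ` ?V)
      + mpol_vec_vs.dim {v \<in> ?V. apply_field v ?D = 0}"
    by (rule P.rank_nullity[OF linear_apply_field graded_piece_subspace _
          graded_basis_facts(1)[of "\<lambda>_. k + 2"]]) (simp add: graded_basis_facts(4))
  moreover have "mpol_vec_vs.dim {v \<in> ?V. apply_field v ?D = 0} = mpol_vec_vs.dim ?H"
  proof -
    have "mpol_vec_vs.dim ?H = mpol_vec_vs.dim (log_combination ` ?H)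
      + mpol_vec_vs.dim {h \<in> ?H. log_combination h = 0}"
      by (rule L.rank_nullity[OF linear_log_combination graded_piece_subspace _
            graded_basis_facts(1)[of "\<lambda>j. k + 2 - log_degree j"]]) (simp add: graded_basis_facts(4))
    moreover have "{h \<in> ?H. log_combination h = 0} \<subseteq> {0}"
      using logarithmic_fields_independent by (auto simp: log_combination_def)
    then have "mpol_vec_vs.dim {h \<in> ?H. log_combination h = 0} = 0"
      using mpol_vec_vs.dim_le_card[of "{h \<in> ?H. log_combination h = 0}" "{}"] by simp
    ultimately show ?thesis unfolding annihilating_fields_in_degree by simp
  qed
  moreover have "mpol_vec_vs.dim ?V = 5 * ((k + 6) choose 4)"
    unfolding dim_graded_piece choose_CARD_5 by (simp add: add.commute[of k])
  moreover have "mpol_vec_vs.dim ?H = 3 * ((k + 5) choose 4) + ((k + 4) choose 4)"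
    unfolding dim_graded_piece choose_CARD_5 sum_4 by (simp add: log_degree_def add.commute[of k])
  ultimately show ?thesis by (simp add: J)
qed

lemma choose_4: "(of_nat ((n + 4) choose 4) :: rat) =
  (of_nat n + 1) * (of_nat n + 2) * (of_nat n + 3) * (of_nat n + 4) / 24"
proof -
  have "(of_nat ((n + 4) choose 4) :: rat) = fact (n + 4) / (fact 4 * fact n)"
    by (simp add: binomial_fact)
  also have "(fact (n + 4) :: rat) =
      (of_nat n + 1) * (of_nat n + 2) * (of_nat n + 3) * (of_nat n + 4) * fact n"
    by (simp add: eval_nat_numeral algebra_simps)
  finally show ?thesis by (simp add: fact_numeral)
qed

lemma milnor_hilbert_poly_disc: "milnor_hilbert_poly quartic_disc_mpol [:26, -21, 8:]"
  unfolding milnor_hilbert_poly_def eventually_sequentially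
proof (rule exI[of _ 7], intro allI impI)
  fix n :: nat assume "7 \<le> n"
  then obtain k where n: "n = k + 7" by (metis le_iff_add add.commute)
  let ?j = "mpol_vs.dim (jacobian_ideal quartic_disc_mpol \<inter> homog_part n)"
  let ?s = "mpol_vs.dim (homog_part n :: 5 mpol set)"
  have j: "?j + 3 * ((k + 5) choose 4) + ((k + 4) choose 4) = 5 * ((k + 6) choose 4)"
    unfolding n by (rule dim_jacobian_ideal_disc)
  have s: "?s = (k + 11) choose 4"
    unfolding dim_homog_part choose_CARD_5 n by (simp add: add.commute[of k])
  have j': "of_nat ?j = 5 * (of_nat ((k + 6) choose 4) :: rat) - 3 * of_nat ((k + 5) choose 4)
      - of_nat ((k + 4) choose 4)"
    using arg_cong[OF j, of "of_nat :: nat \<Rightarrow> rat"] by simp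
  have shift: "k + 5 = (k + 1) + 4" "k + 6 = (k + 2) + 4" "k + 11 = (k + 7) + 4" by simp_all
  have diff: "of_nat ?s - of_nat ?j = poly [:26, -21, 8:] (of_nat n :: rat)"
    unfolding j' s unfolding shift choose_4 n by (simp add: field_simps)
  have "?j \<le> ?s"
    using mpol_vs.dim_le_card[of "jacobian_ideal quartic_disc_mpol \<inter> homog_part n" "monomials n"]
    by (simp add: card_monomials_set dim_homog_part span_monomials)
  then show "\<exists>d. milnor_dim quartic_disc_mpol n d \<and> of_nat d = poly [:26, -21, 8:] (of_nat n :: rat)"
    using diff by (intro exI[of _ "?s - ?j"] conjI milnor_dim_eq) (simp_all add: of_nat_diff)
qed

section \<open>The discriminant hypersurface of the binary quartic\<close>

theorem proposition4p15:
  fixes a b c d e :: "5 mpol"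
  assumes "a = mvar 0" and "b = mvar 1" and "c = mvar 2" and "d = mvar 3" and "e = mvar 4"
  shows "is_discriminant disc4
     \<and> disc4 =
        b^2 * c^2 * d^2 - 4 * a * c^3 * d^2 - 4 * b^3 * d^3 + 18 * a * b * c * d^3
        - 27 * a^2 * d^4 - 4 * b^2 * c^3 * e + 16 * a * c^4 * e + 18 * b^3 * c * d * e
        - 80 * a * b * c^2 * d * e - 6 * a * b^2 * d^2 * e + 144 * a^2 * c * d^2 * e
        - 27 * b^4 * e^2 + 144 * a * b^2 * c * e^2 - 128 * a^2 * c^2 * e^2
        - 192 * a^2 * b * d * e^2 + 256 * a^3 * e^3
     \<and> zariski_dim (hypersurface disc4) 3
     \<and> zariski_dim (singular_locus disc4) 2
     \<and> milnor_hilbert_poly disc4 [:26, -21, 8:]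
     \<and> (\<forall>p\<in>hypersurface disc4. \<forall>x\<in>p. \<forall>i. x $ i \<noteq> 0 \<longrightarrow> point_multiplicity disc4 x i \<le> 3)"
  unfolding disc4_eq assms
  by (intro conjI is_discriminant_quartic quartic_disc_def dim_hypersurface_disc
      dim_singular_locus_disc milnor_hilbert_poly_disc ballI allI impI multiplicity_quartic_disc_le_3)

end
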